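(* Let $N=\mathbb R^m$. For every $Z\in\mathcal Z$ and every $\mu\in\mathcal F_Z$, the metric measure space $(G,d_G,\mu)$ has the Calderón–Zygmund property (CZP) with respect to the family $\mathcal D^Z$.
   Context: **Group setting.** $N=\mathbb R^m$ (additive group) with Lebesgue measure $dn$ and Euclidean distance $d_N$. $A=(\mathbb R_+,\cdot)$ acts on $N$ by $D_a(n)=an$. $G=\mathbb R^m\rtimes A$ has product $(n,a)(n',a')=(n+an',aa')$, identity $1_G=(0,1)$, and right Haar measure $d\rho(n,a)=a^{-1}\,dn\,da$. In the Lie algebra $\mathfrak g$ of $G$, $X_0$ is the element with $\exp(tX_0)=(0,e^t)$, and $X_1,\dots,X_m$ are the left-invariant vector fields $X_\ell|_{(n,a)}=a\,\partial_{n_\ell}$. $d_G$ is the left-invariant Carnot–Carathéodory distance on $G$ for which $X_0,X_1,\dots,X_m$ is an orthonormal (horizontal) frame. $\langle\cdot,\cdot\rangle$ is the scalar product on $\mathfrak g$ making $X_0,\dots,X_m$ orthonormal, and $\mathcal Z=\{Z\in\mathfrak g:\langle Z,X_0\rangle=1\}$. **Flow measures.** A Borel measure $\mu$ on $G$ is a $Z$-flow measure if $d\mu=\varphi\,d\rho$ with $\varphi:G\to[0,\infty)$ satisfying $\varphi(x)=\varphi(x\exp(tZ))$ for all $x\in G$, $t\in\mathbb R$. Put $\mu_N(F)=\int_F\varphi(n,1)\,dn$ for Borel $F\subset N$. $\mathcal F_Z$ is the set of $Z$-flow measures $\mu$ such that $(N,d_N,\mu_N)$ is doubling, i.e. balls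 have positive finite measure and for every $C>1$ there is $D(\mu_N,C)>1$ with $\mu_N(B(x,Cr))\le D(\mu_N,C)\mu_N(B(x,r))$ for all $x\in N$, $r>0$. **Christ cubes.** For $\mu\in\mathcal F_Z$, fix a Christ decomposition of $(N,d_N,\mu_N)$: families $\mathcal Q_k$ ($k\in\mathbb Z$) of countably many pairwise disjoint open sets of $N$ ("cubes of generation $k$"), $\mathcal Q=\bigcup_k\mathcal Q_k$, and constants $\delta\in(0,1)$, $C_1,c>0$ such that: (i) $\mu_N(N\setminus\bigcup_{Q\in\mathcal Q_k}Q)=0$ for all $k$; (ii) each $Q\in\mathcal Q_k$ is contained in a unique $p_N(Q)\in\mathcal Q_{k-1}$ and is disjoint from every other element of $\mathcal Q_{k-1}$; (iii) for each $Q\in\mathcal Q_k$ there is $n_Q\in Q$ with $B_N(n_Q,c\delta^k)\subset Q\subset B_N(n_Q,C_1\delta^k)$; (iv) $\mu_N(p_N(Q))\le C_1\mu_N(Q)$ and $s_N(Q):=\{Q'\in\mathcal Q:p_N(Q')=Q\}$ has at most $C_1$ elements. It is assumed that $C_1\ge3$ and $\#s_N(Q)\ge2$ for all $Q$. **Cylinders.** For $E\subset N$, $r>1$, $a\in A$: $P_{r,E}(a)=\{(n,1)\exp(tZ):n\in E,\ t\in U_r(a)\}$, $U_r(a)=(\log(a/r),\log(ar))$. Fix $\gamma\ge5$ and $\lambda>e^3/\delta$. $P_{r,Q}(a)$ with $Q\in\mathcal Q_k$ is *admissible* if either $r>e$ and $ar^2\le\delta^k\le\lambda ar^\gamma$ (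 *large* ), or $1<r\le e$ and $ae^2\log r\le\delta^k\le\lambda ae^2\log r$ ( *small* ). **The family $\mathcal D^Z$.** For an admissible $P=P_{r,Q}(a)$, the set of sons is $s(P)=\{P_{\sqrt r,Q}(a/\sqrt r),P_{\sqrt r,Q}(a\sqrt r)\}$ if both of these are admissible, and $s(P)=\{P_{r,Q'}(a):Q'\in s_N(Q)\}$ otherwise; $s^1(P)=s(P)$, $s^{m+1}(P)=\bigcup_{P'\in s^m(P)}s(P')$. Put $p^\downarrow(P)=P_{r^3,Q}(a/r^2)$, $p^\uparrow(P)=P_{r^2,Q}(ar)$, $p^\leftrightarrow(P)=P_{r,p_N(Q)}(a)$, and $\mathcal S(P)=\{P_{r,Q'}(a):Q'\in\mathcal Q_j\}$ if $Q\in\mathcal Q_j$. Fix a large admissible $P_0=P_{r_0,Q_0}(1)$ and define recursively $P_{k+1}=p^\leftrightarrow(P_k)$ whenever this is admissible; at the successive values of $k$ for which it is not, $P_{k+1}$ is alternately $p^\uparrow(P_k)$ and $p^\downarrow(P_k)$, starting with $p^\uparrow$. For $k\ge0$ let $\mathcal S_k=\mathcal S(P_k)$; let $\widetilde{\mathcal S}_k=\emptyset$ if $P_{k+1}=p^\leftrightarrow(P_k)$ and $\widetilde{\mathcal S}_k=\mathcal S(P_{k+1}\setminus P_k)$ otherwise, where, if $P_k=P_{r,Q}(a)$, $P_{k+1}\setminus P_k$ stands (up to a null set) for the cylinder $P_{r,Q}(ar^2)$ when $P_{k+1}=p^\uparrow(P_k)$ and $P_{r^2,Q}(a/r^3)$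 when $P_{k+1}=p^\downarrow(P_k)$. With $\widetilde{\mathcal S}_\ell^m=\bigcup_{P\in\widetilde{\mathcal S}_\ell}s^m(P)$, put $\mathcal D^Z_{-k}=\mathcal S_k\cup\widetilde{\mathcal S}_k\cup\bigcup_{\ell>k}\widetilde{\mathcal S}_\ell^{\ell-k}$ for $k\ge0$, $\mathcal D^Z_k=\bigcup_{P\in\mathcal D^Z_{k-1}}s(P)$ for $k\ge1$, and $\mathcal D^Z=\bigcup_{k\in\mathbb Z}\mathcal D^Z_k$. **CZP.** A metric measure space $(X,d,\mu)$ with $\mu(X)=\infty$ has the CZP if there is $C_0\ge1$ such that for every $f\in L^1(\mu)$ and $\alpha>0$ there exist a countable family of sets $\mathcal E(f,\alpha)=\{E_j\}$, numbers $r_j>0$, points $x_j\in X$ and a decomposition $f=g+\sum_jb_j$ such that for every $j$: (a) $|g|\le C_0\alpha$ $\mu$-a.e.; (b) $b_j=0$ on $X\setminus E_j$; (c) $\sum_j\|b_j\|_1\le C_0\|f\|_1$ and $\int_{E_j}b_j\,d\mu=0$; (d) $E_j\subset B(x_j,C_0r_j)$; (e) $\sum_j\mu(E_j^* )\le\frac{C_0}{\alpha}\|f\|_1$, where $E_j^*=\{x:d(x,E_j)<r_j\}$. In this case, with $\mathcal E=\{E\in\mathcal E(f,\alpha):f\in L^1(\mu),\alpha>0\}$, the space has the CZP *with respect to the family* $\mathcal E$. *)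

theory Defs
  imports "HOL-Analysis.Analysis"
begin

section \<open>The group and its Lie algebra\<close>

text \<open>Points of $G = N \rtimes A$ are pairs $(n, a)$ with $n \in N = R^m$ and $a > 0$; the dimension
  $m$ is the cardinality of the index type. A Lie algebra element
  $\sum_l v_l X_l + s X_0$ is represented by the pair $(v, s)$ of its coordinates, so that the inner
  product of the product type is the one for which $X_0, X_1, \dots, X_m$ are orthonormal.\<close>

type_synonym 'm point = "(real^'m) \<times> real"
type_synonym 'm lie = "(real^'m) \<times> real"

definition G_carrier :: "'m::finite point set" where
  "G_carrier = {(n, a). a > 0}"

definition G_mult :: "'m::finite point \<Rightarrow> 'm point \<Rightarrow> 'm point" where
  "G_mult = (\<lambda>(n, a) (n', a'). (n + a *\<^sub>R n', a * a'))"

definition G_one :: "'m::finite point" where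
  "G_one = (0, 1)"

definition X0 :: "'m::finite lie" where
  "X0 = (0, 1)"

definition calZ :: "'m::finite lie set" where
  "calZ = {Z. Z \<bullet> X0 = 1}"

text \<open>The left-invariant vector field of a Lie algebra element: $X_l = a \, \partial_{n_l}$ and
  $X_0 = a \, \partial_a$ at $(n, a)$.\<close>

definition left_field :: "'m::finite lie \<Rightarrow> 'm point \<Rightarrow> 'm point" where
  "left_field Z x = snd x *\<^sub>R Z"

definition G_exp :: "'m::finite lie \<Rightarrow> 'm point" where
  "G_exp Z = (THE x. \<exists>\<eta> :: real \<Rightarrow> 'm point. \<eta> 0 = G_one \<and>
     (\<forall>t. (\<eta> has_vector_derivative left_field Z (\<eta> t)) (at t)) \<and> \<eta> 1 = x)"

lemma G_exp_eqI:
  fixes \<eta> :: "real \<Rightarrow> 'm::finite point"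
  assumes "\<eta> 0 = G_one" and "\<And>t. (\<eta> has_vector_derivative left_field Z (\<eta> t)) (at t)"
  shows "G_exp Z = \<eta> 1"
proof -
  have uniq: "\<eta> 1 = \<zeta> 1"
    if z0: "\<zeta> 0 = G_one" and z': "\<And>t. (\<zeta> has_vector_derivative left_field Z (\<zeta> t)) (at t)"
    for \<zeta> :: "real \<Rightarrow> 'm point"
  proof -
    have *: "snd (\<xi> t) = exp (t * snd Z)"
      if x0: "\<xi> 0 = G_one" and x': "\<And>t. (\<xi> has_vector_derivative left_field Z (\<xi> t)) (at t)"
      for \<xi> :: "real \<Rightarrow> 'm point" and t
    proof -
      have d: "((\<lambda>t. snd (\<xi> t)) has_real_derivative snd (\<xi> t) * snd Z) (at t)" for t
        using bounded_linear.has_vector_derivative[OF bounded_linear_snd x'[of t]]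
        by (simp add: left_field_def has_real_derivative_iff_has_vector_derivative)
      have "((\<lambda>t. snd (\<xi> t) * exp (- (t * snd Z))) has_real_derivative 0) (at t)" for t
        by (auto intro!: derivative_eq_intros d simp: algebra_simps)
      then have "snd (\<xi> t) * exp (- (t * snd Z)) = snd (\<xi> 0) * exp (- (0 * snd Z))"
        using DERIV_isconst_all by blast
      then show ?thesis
        using x0 by (simp add: G_one_def exp_minus field_simps)
    qed
    have "((\<lambda>t. \<eta> t - \<zeta> t) has_vector_derivative 0) (at t)" for t
      using has_vector_derivative_diff[OF assms(2)[of t] z'[of t]] *[OF assms] *[OF z0 z']
      by (simp add: left_field_def)
    then obtain c where "\<And>t. \<eta> t - \<zeta> t = c"
      using has_vector_derivative_zero_constant[of UNIV "\<lambda>t. \<eta> t - \<zeta> t"] by auto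
    then have "\<eta> 1 - \<zeta> 1 = \<eta> 0 - \<zeta> 0" by simp
    then show ?thesis using assms(1) z0 by simp
  qed
  show ?thesis
    unfolding G_exp_def
  proof (rule the_equality)
    show "\<exists>\<zeta>. \<zeta> 0 = G_one \<and>
        (\<forall>t. (\<zeta> has_vector_derivative left_field Z (\<zeta> t)) (at t)) \<and> \<zeta> 1 = \<eta> 1"
      using assms by blast
  qed (use uniq in metis)
qed

lemma G_exp_horizontal:
  fixes v :: "real^'m::finite"
  shows "G_exp (t *\<^sub>R (v, 1)) = ((exp t - 1) *\<^sub>R v, exp t)"
proof -
  let ?\<eta> = "\<lambda>u. ((exp (u * t) - 1) *\<^sub>R v, exp (u * t))"
  have "(?\<eta> has_vector_derivative left_field (t *\<^sub>R (v, 1)) (?\<eta> u)) (at u)" for u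
    unfolding left_field_def
    by (auto intro!: has_vector_derivative_Pair derivative_eq_intros
        simp: has_real_derivative_iff_has_vector_derivative[symmetric])
  then have "G_exp (t *\<^sub>R (v, 1)) = ?\<eta> 1"
    by (intro G_exp_eqI) (simp_all add: G_one_def)
  then show ?thesis by simp
qed


section \<open>The Carnot--Caratheodory distance\<close>

text \<open>A horizontal curve comes with its vector \<open>c t\<close> of coordinates with respect to the frame
  $X_0, \dots, X_m$. In the library, the derivative of a piecewise $C^1$ function may be unbounded
  near the exceptional points, whence the separate integrability requirement.\<close>

definition horizontal_curve ::
    "(real \<Rightarrow> 'm::finite point) \<Rightarrow> (real \<Rightarrow> 'm lie) \<Rightarrow> bool" where
  "horizontal_curve \<eta> c \<longleftrightarrow>
     \<eta> ` {0..1} \<subseteq> G_carrier \<and> \<eta> piecewise_C1_differentiable_on {0..1} \<and>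
     c absolutely_integrable_on {0..1} \<and>
     (\<exists>S. finite S \<and>
        (\<forall>t\<in>{0..1} - S. (\<eta> has_vector_derivative left_field (c t) (\<eta> t)) (at t)))"

definition d_G :: "'m::finite point \<Rightarrow> 'm point \<Rightarrow> real" where
  "d_G x y = Inf {integral {0..1} (\<lambda>t. norm (c t)) | \<eta> c.
                    horizontal_curve \<eta> c \<and> \<eta> 0 = x \<and> \<eta> 1 = y}"


section \<open>Flow measures\<close>

definition rho :: "'m::finite point measure" where
  "rho = density (restrict_space lborel G_carrier) (\<lambda>(n, a). ennreal (1 / a))"

definition flow_density ::
    "'m::finite lie \<Rightarrow> 'm point measure \<Rightarrow> ('m point \<Rightarrow> real) \<Rightarrow> bool" where
  "flow_density Z \<mu> \<phi> \<longleftrightarrow>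
     \<phi> \<in> borel_measurable rho \<and> (\<forall>x\<in>G_carrier. 0 \<le> \<phi> x) \<and>
     (\<forall>x\<in>G_carrier. \<forall>t. \<phi> x = \<phi> (G_mult x (G_exp (t *\<^sub>R Z)))) \<and>
     \<mu> = density rho (\<lambda>x. ennreal (\<phi> x))"

definition mu_N :: "('m::finite point \<Rightarrow> real) \<Rightarrow> (real^'m) measure" where
  "mu_N \<phi> = density lborel (\<lambda>n. ennreal (\<phi> (n, 1)))"

definition doubling :: "'a::metric_space measure \<Rightarrow> bool" where
  "doubling M \<longleftrightarrow>
     (\<forall>x. \<forall>r>0. 0 < emeasure M (ball x r) \<and> emeasure M (ball x r) < \<infinity>) \<and>
     (\<forall>C>1. \<exists>D>1. \<forall>x. \<forall>r>0. emeasure M (ball x (C * r)) \<le> ennreal D * emeasure M (ball x r))"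

text \<open>The density of a flow measure is determined only almost everywhere. By the invariance along
  the flow, two densities of the same flow measure agree almost everywhere on $N \times \{1\}$ as
  well, so that \<open>mu_N \<phi>\<close> does not depend on the choice of \<open>\<phi>\<close>.\<close>

definition flow_measures :: "'m::finite lie \<Rightarrow> 'm point measure set" where
  "flow_measures Z = {\<mu>. (\<exists>\<phi>. flow_density Z \<mu> \<phi>) \<and>
                         (\<forall>\<phi>. flow_density Z \<mu> \<phi> \<longrightarrow> doubling (mu_N \<phi>))}"


section \<open>Christ cubes\<close>

text \<open>A cube is a set together with its generation, \<open>(k, Q)\<close> with \<open>Q \<in> \<Q> k\<close>, which
  makes its parent unambiguous.\<close>

type_synonym 'm cube = "int \<times> (real^'m) set"

definition cubes :: "(int \<Rightarrow> (real^'m::finite) set set) \<Rightarrow> 'm cube set" where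
  "cubes \<Q> = {(k, Q). Q \<in> \<Q> k}"

definition p_N :: "(int \<Rightarrow> (real^'m::finite) set set) \<Rightarrow> 'm cube \<Rightarrow> 'm cube" where
  "p_N \<Q> = (\<lambda>(k, Q). (k - 1, THE Q'. Q' \<in> \<Q> (k - 1) \<and> Q \<subseteq> Q'))"

definition s_N :: "(int \<Rightarrow> (real^'m::finite) set set) \<Rightarrow> 'm cube \<Rightarrow> 'm cube set" where
  "s_N \<Q> q = {q' \<in> cubes \<Q>. p_N \<Q> q' = q}"

definition christ_decomposition ::
    "(real^'m::finite) measure \<Rightarrow> (int \<Rightarrow> (real^'m) set set) \<Rightarrow> real \<Rightarrow> real \<Rightarrow> real \<Rightarrow> bool" where
  "christ_decomposition M \<Q> \<delta> C\<^sub>1 c \<longleftrightarrow>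
     0 < \<delta> \<and> \<delta> < 1 \<and> 0 < C\<^sub>1 \<and> 0 < c \<and>
     (\<forall>k. countable (\<Q> k) \<and> pairwise disjnt (\<Q> k) \<and> (\<forall>Q\<in>\<Q> k. open Q)) \<and>
     (\<forall>k. emeasure M (UNIV - \<Union>(\<Q> k)) = 0) \<and>
     (\<forall>k. \<forall>Q\<in>\<Q> k. (\<exists>!Q'. Q' \<in> \<Q> (k - 1) \<and> Q \<subseteq> Q') \<and>
        (\<forall>Q'\<in>\<Q> (k - 1). \<not> Q \<subseteq> Q' \<longrightarrow> disjnt Q Q')) \<and>
     (\<forall>k. \<forall>Q\<in>\<Q> k. \<exists>n\<in>Q. ball n (c * \<delta> powi k) \<subseteq> Q \<and> Q \<subseteq> ball n (C\<^sub>1 * \<delta> powi k)) \<and>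
     (\<forall>q\<in>cubes \<Q>. emeasure M (snd (p_N \<Q> q)) \<le> ennreal C\<^sub>1 * emeasure M (snd q) \<and>
        finite (s_N \<Q> q) \<and> real (card (s_N \<Q> q)) \<le> C\<^sub>1)"


section \<open>Cylinders\<close>

definition U_int :: "real \<Rightarrow> real \<Rightarrow> real set" where
  "U_int r a = {ln (a / r) <..< ln (a * r)}"

definition cylinder ::
    "'m::finite lie \<Rightarrow> real \<Rightarrow> (real^'m) set \<Rightarrow> real \<Rightarrow> 'm point set" where
  "cylinder Z r E a = {G_mult (n, 1) (G_exp (t *\<^sub>R Z)) | n t. n \<in> E \<and> t \<in> U_int r a}"

text \<open>The combinatorics of the cylinders $P_{r,Q}(a)$ over cubes $Q$ is expressed through the
  parameters \<open>(r, (k, Q), a)\<close>, where \<open>k\<close> is the generation of \<open>Q\<close>.\<close>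

type_synonym 'm cyl = "real \<times> 'm cube \<times> real"

fun cyl_set :: "'m::finite lie \<Rightarrow> 'm cyl \<Rightarrow> 'm point set" where
  "cyl_set Z (r, (k, Q), a) = cylinder Z r Q a"

fun large_admissible ::
    "(int \<Rightarrow> (real^'m::finite) set set) \<Rightarrow> real \<Rightarrow> real \<Rightarrow> real \<Rightarrow> 'm cyl \<Rightarrow> bool" where
  "large_admissible \<Q> \<delta> lam \<gamma> (r, (k, Q), a) \<longleftrightarrow>
     Q \<in> \<Q> k \<and> a > 0 \<and> r > exp 1 \<and>
     a * r ^ 2 \<le> \<delta> powi k \<and> \<delta> powi k \<le> lam * a * r powr \<gamma>"

fun small_admissible ::
    "(int \<Rightarrow> (real^'m::finite) set set) \<Rightarrow> real \<Rightarrow> real \<Rightarrow> 'm cyl \<Rightarrow> bool" where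
  "small_admissible \<Q> \<delta> lam (r, (k, Q), a) \<longleftrightarrow>
     Q \<in> \<Q> k \<and> a > 0 \<and> 1 < r \<and> r \<le> exp 1 \<and>
     a * exp 2 * ln r \<le> \<delta> powi k \<and> \<delta> powi k \<le> lam * a * exp 2 * ln r"

definition admissible ::
    "(int \<Rightarrow> (real^'m::finite) set set) \<Rightarrow> real \<Rightarrow> real \<Rightarrow> real \<Rightarrow> 'm cyl \<Rightarrow> bool" where
  "admissible \<Q> \<delta> lam \<gamma> P \<longleftrightarrow> large_admissible \<Q> \<delta> lam \<gamma> P \<or> small_admissible \<Q> \<delta> lam P"


section \<open>The family of dyadic cylinders\<close>

fun sons ::
    "(int \<Rightarrow> (real^'m::finite) set set) \<Rightarrow> real \<Rightarrow> real \<Rightarrow> real \<Rightarrow> 'm cyl \<Rightarrow> 'm cyl set" where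
  "sons \<Q> \<delta> lam \<gamma> (r, q, a) =
     (if admissible \<Q> \<delta> lam \<gamma> (sqrt r, q, a / sqrt r) \<and>
         admissible \<Q> \<delta> lam \<gamma> (sqrt r, q, a * sqrt r)
      then {(sqrt r, q, a / sqrt r), (sqrt r, q, a * sqrt r)}
      else {(r, q', a) | q'. q' \<in> s_N \<Q> q})"

primrec sons_pow ::
    "(int \<Rightarrow> (real^'m::finite) set set) \<Rightarrow> real \<Rightarrow> real \<Rightarrow> real \<Rightarrow> nat \<Rightarrow> 'm cyl \<Rightarrow> 'm cyl set" where
  "sons_pow \<Q> \<delta> lam \<gamma> 0 P = {P}"
| "sons_pow \<Q> \<delta> lam \<gamma> (Suc m) P = (\<Union>P'\<in>sons_pow \<Q> \<delta> lam \<gamma> m P. sons \<Q> \<delta> lam \<gamma> P')"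

fun p_down :: "'m::finite cyl \<Rightarrow> 'm cyl" where
  "p_down (r, q, a) = (r ^ 3, q, a / r ^ 2)"

fun p_up :: "'m::finite cyl \<Rightarrow> 'm cyl" where
  "p_up (r, q, a) = (r ^ 2, q, a * r)"

fun p_across :: "(int \<Rightarrow> (real^'m::finite) set set) \<Rightarrow> 'm cyl \<Rightarrow> 'm cyl" where
  "p_across \<Q> (r, q, a) = (r, p_N \<Q> q, a)"

fun siblings :: "(int \<Rightarrow> (real^'m::finite) set set) \<Rightarrow> 'm cyl \<Rightarrow> 'm cyl set" where
  "siblings \<Q> (r, (j, Q), a) = {(r, (j, Q'), a) | Q'. Q' \<in> \<Q> j}"

text \<open>The cylinders that \<open>p_up P\<close> and \<open>p_down P\<close> add to \<open>P\<close>, up to null sets.\<close>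

fun up_difference :: "'m::finite cyl \<Rightarrow> 'm cyl" where
  "up_difference (r, q, a) = (r, q, a * r ^ 2)"

fun down_difference :: "'m::finite cyl \<Rightarrow> 'm cyl" where
  "down_difference (r, q, a) = (r ^ 2, q, a / r ^ 3)"

text \<open>The ancestor $P_k$, paired with a flag telling whether the next non-horizontal step
  goes up.\<close>

primrec ancestor ::
    "(int \<Rightarrow> (real^'m::finite) set set) \<Rightarrow> real \<Rightarrow> real \<Rightarrow> real \<Rightarrow> 'm cyl \<Rightarrow> nat \<Rightarrow> 'm cyl \<times> bool" where
  "ancestor \<Q> \<delta> lam \<gamma> P\<^sub>0 0 = (P\<^sub>0, True)"
| "ancestor \<Q> \<delta> lam \<gamma> P\<^sub>0 (Suc k) =
     (case ancestor \<Q> \<delta> lam \<gamma> P\<^sub>0 k of (P, up) \<Rightarrow>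
        if admissible \<Q> \<delta> lam \<gamma> (p_across \<Q> P) then (p_across \<Q> P, up)
        else if up then (p_up P, False)
        else (p_down P, True))"

definition S_fam ::
    "(int \<Rightarrow> (real^'m::finite) set set) \<Rightarrow> real \<Rightarrow> real \<Rightarrow> real \<Rightarrow> 'm cyl \<Rightarrow> nat \<Rightarrow> 'm cyl set" where
  "S_fam \<Q> \<delta> lam \<gamma> P\<^sub>0 k = siblings \<Q> (fst (ancestor \<Q> \<delta> lam \<gamma> P\<^sub>0 k))"

definition S_tilde ::
    "(int \<Rightarrow> (real^'m::finite) set set) \<Rightarrow> real \<Rightarrow> real \<Rightarrow> real \<Rightarrow> 'm cyl \<Rightarrow> nat \<Rightarrow> 'm cyl set" where
  "S_tilde \<Q> \<delta> lam \<gamma> P\<^sub>0 k =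
     (case ancestor \<Q> \<delta> lam \<gamma> P\<^sub>0 k of (P, up) \<Rightarrow>
        if admissible \<Q> \<delta> lam \<gamma> (p_across \<Q> P) then {}
        else if up then siblings \<Q> (up_difference P)
        else siblings \<Q> (down_difference P))"

text \<open>\<open>D_neg k\<close> is the level $-k$ and \<open>D_pos k\<close> the level $k$ of the family.\<close>

definition D_neg ::
    "(int \<Rightarrow> (real^'m::finite) set set) \<Rightarrow> real \<Rightarrow> real \<Rightarrow> real \<Rightarrow> 'm cyl \<Rightarrow> nat \<Rightarrow> 'm cyl set" where
  "D_neg \<Q> \<delta> lam \<gamma> P\<^sub>0 k =
     S_fam \<Q> \<delta> lam \<gamma> P\<^sub>0 k \<union> S_tilde \<Q> \<delta> lam \<gamma> P\<^sub>0 k \<union>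
     (\<Union>l\<in>{k<..}. \<Union>P\<in>S_tilde \<Q> \<delta> lam \<gamma> P\<^sub>0 l. sons_pow \<Q> \<delta> lam \<gamma> (l - k) P)"

primrec D_pos ::
    "(int \<Rightarrow> (real^'m::finite) set set) \<Rightarrow> real \<Rightarrow> real \<Rightarrow> real \<Rightarrow> 'm cyl \<Rightarrow> nat \<Rightarrow> 'm cyl set" where
  "D_pos \<Q> \<delta> lam \<gamma> P\<^sub>0 0 = D_neg \<Q> \<delta> lam \<gamma> P\<^sub>0 0"
| "D_pos \<Q> \<delta> lam \<gamma> P\<^sub>0 (Suc k) = (\<Union>P\<in>D_pos \<Q> \<delta> lam \<gamma> P\<^sub>0 k. sons \<Q> \<delta> lam \<gamma> P)"

definition D_family ::
    "'m::finite lie \<Rightarrow> (int \<Rightarrow> (real^'m) set set) \<Rightarrow> real \<Rightarrow> real \<Rightarrow> real \<Rightarrow> 'm cyl \<Rightarrow> 'm point set set" where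
  "D_family Z \<Q> \<delta> lam \<gamma> P\<^sub>0 =
     cyl_set Z ` ((\<Union>k. D_neg \<Q> \<delta> lam \<gamma> P\<^sub>0 k) \<union> (\<Union>k. D_pos \<Q> \<delta> lam \<gamma> P\<^sub>0 k))"


section \<open>The Calderon--Zygmund property\<close>

definition L1_norm :: "'a measure \<Rightarrow> ('a \<Rightarrow> complex) \<Rightarrow> ennreal" where
  "L1_norm M f = (\<integral>\<^sup>+x. ennreal (norm (f x)) \<partial>M)"

definition neighbourhood :: "'a set \<Rightarrow> ('a \<Rightarrow> 'a \<Rightarrow> real) \<Rightarrow> 'a set \<Rightarrow> real \<Rightarrow> 'a set" where
  "neighbourhood X d E r = {x\<in>X. E \<noteq> {} \<and> (INF y\<in>E. d x y) < r}"

text \<open>The index set \<open>J\<close> may be finite, even empty. The measurability of the sets in condition (e) is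
  required because \<open>emeasure\<close> is 0 on nonmeasurable sets.\<close>

definition CZ_decomposition ::
    "'a set \<Rightarrow> ('a \<Rightarrow> 'a \<Rightarrow> real) \<Rightarrow> 'a measure \<Rightarrow> real \<Rightarrow> ('a \<Rightarrow> complex) \<Rightarrow> real \<Rightarrow>
     nat set \<Rightarrow> (nat \<Rightarrow> 'a set) \<Rightarrow> (nat \<Rightarrow> real) \<Rightarrow> (nat \<Rightarrow> 'a) \<Rightarrow>
     ('a \<Rightarrow> complex) \<Rightarrow> (nat \<Rightarrow> 'a \<Rightarrow> complex) \<Rightarrow> bool" where
  "CZ_decomposition X d M C\<^sub>0 f \<alpha> J E r x g b \<longleftrightarrow>
     (\<forall>j\<in>J. E j \<in> sets M \<and> r j > 0 \<and> x j \<in> X) \<and>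
     g \<in> borel_measurable M \<and> (\<forall>j\<in>J. integrable M (b j)) \<and>
     (AE y in M. ((\<lambda>j. b j y) has_sum (f y - g y)) J) \<and>
     \<comment> \<open>(a)\<close> (AE y in M. norm (g y) \<le> C\<^sub>0 * \<alpha>) \<and>
     \<comment> \<open>(b)\<close> (\<forall>j\<in>J. \<forall>y\<in>X - E j. b j y = 0) \<and>
     \<comment> \<open>(c)\<close> (\<Sum>\<^sub>\<infinity>j\<in>J. L1_norm M (b j)) \<le> ennreal C\<^sub>0 * L1_norm M f \<and>
             (\<forall>j\<in>J. (LINT y:E j|M. b j y) = 0) \<and>
     \<comment> \<open>(d)\<close> (\<forall>j\<in>J. E j \<subseteq> {y\<in>X. d (x j) y < C\<^sub>0 * r j}) \<and>
     \<comment> \<open>(e)\<close> (\<forall>j\<in>J. neighbourhood X d (E j) (r j) \<in> sets M) \<and>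
             (\<Sum>\<^sub>\<infinity>j\<in>J. emeasure M (neighbourhood X d (E j) (r j)))
               \<le> ennreal (C\<^sub>0 / \<alpha>) * L1_norm M f"

text \<open>\<open>F f \<alpha>\<close> is the family $\mathcal{E}(f, \alpha)$.\<close>

definition has_CZP_wrt ::
    "'a set \<Rightarrow> ('a \<Rightarrow> 'a \<Rightarrow> real) \<Rightarrow> 'a measure \<Rightarrow> 'a set set \<Rightarrow> bool" where
  "has_CZP_wrt X d M \<E> \<longleftrightarrow>
     space M = X \<and> emeasure M X = \<infinity> \<and>
     (\<exists>C\<^sub>0\<ge>1. \<exists>F :: ('a \<Rightarrow> complex) \<Rightarrow> real \<Rightarrow> 'a set set.
        (\<forall>f \<alpha>. integrable M f \<longrightarrow> \<alpha> > 0 \<longrightarrow>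
           (\<exists>J E r x g b. F f \<alpha> = E ` J \<and> CZ_decomposition X d M C\<^sub>0 f \<alpha> J E r x g b)) \<and>
        \<E> = {E. \<exists>f \<alpha>. integrable M f \<and> \<alpha> > 0 \<and> E \<in> F f \<alpha>})"

end

theory Submission
  imports Defs
begin

text \<open>In the coordinates (base of the flow line, height) a flow measure is the product of
  $\mu_N$ and $da/a$, so that $\mu(P_{r,Q}(a)) = 2 \log r \cdot \mu_N(Q)$. Admissibility bounds the base
  of a cylinder from below by its height, hence its neighbourhood of width $\frac12 \log r$ lies over a
  multiple of the cube and has comparable measure by doubling; it bounds the base from above, hence
  the cylinder lies in a ball of radius a multiple of $\log r$. The levels of the family are nested
  partitions of $G$ up to null sets, with bounded measure ratios between consecutive levels, whose
  members shrink to points in one direction and grow to infinite measure in the other. The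
  Calderon--Zygmund decomposition at height $\alpha$ therefore stops at the maximal cylinders on which
  the average of $|f|$ exceeds $\alpha$.\<close>

section \<open>The Carnot--Caratheodory distance\<close>

text \<open>A curve of length \<open>L\<close> distorts horizontal lengths by \<open>exp L\<close>,
  so a cylinder of logarithmic radius \<open>s\<close> tolerates a neighbourhood of width comparable
  to \<open>s\<close> only if its base is at least about \<open>exp (3 / 2 * s) * s\<close> times
  its height \<open>a\<close>. Admissibility guarantees this, and every step between levels has to
  preserve it; that is what the thresholds are for. With \<open>s = ln r\<close> and
  \<open>D = \<delta> powi k / a\<close>, the bound \<open>\<gamma> \<ge> 5\<close> is exactly what
  two places ask for: \<open>\<gamma> * (s / 2) - s / 2 \<ge> 2 * s\<close> when a large cylinder
  has large halves, and \<open>exp (5 * s) \<le> D\<close> for \<open>p_up\<close>. The number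
  \<open>exp 3\<close> is sharp at \<open>s = 2\<close>, the end of the range where a large cylinder
  has small halves, and \<open>C\<^sub>1 \<ge> 3\<close> absorbs the tripling of \<open>s\<close> by
  \<open>p_down\<close>. The ancestors alternate between \<open>p_up\<close> and
  \<open>p_down\<close> so that both ends of their height interval escape; with one kind of step
  alone the levels would leave part of \<open>G\<close> uncovered.\<close>

lemma carrier_iff: "x \<in> G_carrier \<longleftrightarrow> 0 < snd x"
  by (cases x) (simp add: G_carrier_def)

text \<open>In the frame, \<open>ln (snd (\<eta> t))\<close> has derivative \<open>snd (c t)\<close>
  and \<open>fst (\<eta> t)\<close> has derivative
  \<open>snd (\<eta> t) *\<^sub>R fst (c t)\<close>. So length controls the logarithm of the height,
  and horizontal displacement is at most length times the largest height met, itself at most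
  \<open>snd (\<eta> 1) * exp L\<close>.\<close>

lemma horizontal_curve_distortion:
  fixes \<eta> :: "real \<Rightarrow> 'm::finite point"
  assumes "horizontal_curve \<eta> c"
  defines "L \<equiv> integral {0..1} (\<lambda>t. norm (c t))"
  shows "\<bar>ln (snd (\<eta> 1)) - ln (snd (\<eta> 0))\<bar> \<le> L"
    and "norm (fst (\<eta> 1) - fst (\<eta> 0)) \<le> snd (\<eta> 1) * exp L * L"
proof -
  from assms(1) obtain S where pos: "\<And>t. t \<in> {0..1} \<Longrightarrow> 0 < snd (\<eta> t)"
    and pw: "\<eta> piecewise_C1_differentiable_on {0..1}"
    and ac: "c absolutely_integrable_on {0..1}" and fS: "finite S"
    and d: "\<And>t. t \<in> {0..1} - S \<Longrightarrow> (\<eta> has_vector_derivative left_field (c t) (\<eta> t)) (at t)"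
    unfolding horizontal_curve_def by (auto simp: image_subset_iff carrier_iff)
  have cont: "continuous_on {0..1} \<eta>"
    using pw by (simp add: piecewise_C1_differentiable_on_def)
  have ni: "(\<lambda>t. norm (c t)) integrable_on {0..1}"
    using ac by (simp add: absolutely_integrable_on_def)
  have dln: "((\<lambda>t. ln (snd (\<eta> t))) has_vector_derivative snd (c t)) (at t)" if "t \<in> {0..1} - S" for t
  proof -
    have "((\<lambda>t. snd (\<eta> t)) has_real_derivative snd (\<eta> t) * snd (c t)) (at t)"
      using bounded_linear.has_vector_derivative[OF bounded_linear_snd d[OF that]]
      by (simp add: left_field_def has_real_derivative_iff_has_vector_derivative)
    then have "((\<lambda>t. ln (snd (\<eta> t))) has_real_derivative snd (c t)) (at t)"
      using pos[of t] that by (auto intro!: derivative_eq_intros)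
    then show ?thesis by (simp add: has_real_derivative_iff_has_vector_derivative)
  qed
  have dfst: "((\<lambda>t. fst (\<eta> t)) has_vector_derivative snd (\<eta> t) *\<^sub>R fst (c t)) (at t)"
    if "t \<in> {0..1} - S" for t
    using bounded_linear.has_vector_derivative[OF bounded_linear_fst d[OF that]]
    by (simp add: left_field_def)
  \<comment> \<open>Subintervals are needed because the horizontal estimate uses the height at every
    intermediate time, compared with that at time 1.\<close>
  have sub: "\<bar>ln (snd (\<eta> t)) - ln (snd (\<eta> s))\<bar> \<le> L" if "0 \<le> s" "s \<le> t" "t \<le> 1" for s t
  proof -
    have I: "((\<lambda>t. snd (c t)) has_integral ln (snd (\<eta> t)) - ln (snd (\<eta> s))) {s..t}"
    proof (rule fundamental_theorem_of_calculus_strong[OF fS \<open>s \<le> t\<close>])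
      show "continuous_on {s..t} (\<lambda>t. ln (snd (\<eta> t)))"
        using that pos[THEN less_imp_neq]
        by (intro continuous_intros continuous_on_subset[OF cont]) fastforce+
      show "((\<lambda>t. ln (snd (\<eta> t))) has_vector_derivative snd (c x)) (at x)"
        if "x \<in> {s..t} - S" for x
        using dln[of x] that \<open>0 \<le> s\<close> \<open>t \<le> 1\<close> by auto
    qed
    have nsc: "\<bar>snd (c t)\<bar> \<le> norm (c t)" for t
      using norm_snd_le[of "snd (c t)" "fst (c t)"] by simp
    have ns: "(\<lambda>t. norm (c t)) integrable_on {s..t}"
      by (rule integrable_on_subinterval[OF ni]) (use that in auto)
    have "\<bar>ln (snd (\<eta> t)) - ln (snd (\<eta> s))\<bar> = norm (integral {s..t} (\<lambda>t. snd (c t)))"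
      using I by (simp add: integral_unique)
    also have "\<dots> \<le> integral {s..t} (\<lambda>t. norm (c t))"
      by (rule integral_norm_bound_integral)
        (use I ns nsc in \<open>auto simp: has_integral_iff\<close>)
    also have "\<dots> \<le> L"
      unfolding L_def by (rule integral_subset_le) (use that ns ni in auto)
    finally show ?thesis .
  qed
  show "\<bar>ln (snd (\<eta> 1)) - ln (snd (\<eta> 0))\<bar> \<le> L" using sub[of 0 1] by simp
  have hb: "snd (\<eta> t) \<le> snd (\<eta> 1) * exp L" if "t \<in> {0..1}" for t
  proof -
    have "ln (snd (\<eta> t)) \<le> ln (snd (\<eta> 1)) + L" using sub[of t 1] that by auto
    then have "exp (ln (snd (\<eta> t))) \<le> exp (ln (snd (\<eta> 1)) + L)" by simp
    then show ?thesis using pos[OF that] pos[of 1] by (simp add: exp_add)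
  qed
  have I: "((\<lambda>t. snd (\<eta> t) *\<^sub>R fst (c t)) has_integral fst (\<eta> 1) - fst (\<eta> 0)) {0..1}"
    by (rule fundamental_theorem_of_calculus_strong[OF fS]) (use dfst cont in \<open>auto intro!: continuous_intros\<close>)
  have "norm (fst (\<eta> 1) - fst (\<eta> 0)) = norm (integral {0..1} (\<lambda>t. snd (\<eta> t) *\<^sub>R fst (c t)))"
    using I by (simp add: integral_unique)
  also have "\<dots> \<le> integral {0..1} (\<lambda>t. (snd (\<eta> 1) * exp L) * norm (c t))"
  proof (rule integral_norm_bound_integral)
    show "(\<lambda>t. snd (\<eta> t) *\<^sub>R fst (c t)) integrable_on {0..1}" using I by (simp add: has_integral_iff)
    show "(\<lambda>t. (snd (\<eta> 1) * exp L) * norm (c t)) integrable_on {0..1}"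
      using ni by (intro integrable_on_mult_right)
    show "norm (snd (\<eta> t) *\<^sub>R fst (c t)) \<le> (snd (\<eta> 1) * exp L) * norm (c t)" if "t \<in> {0..1}" for t
      using hb[OF that] pos[OF that] norm_fst_le[of "fst (c t)" "snd (c t)"]
      by (auto intro!: mult_mono)
  qed
  also have "\<dots> = snd (\<eta> 1) * exp L * L"
    by (simp add: L_def)
  finally show "norm (fst (\<eta> 1) - fst (\<eta> 0)) \<le> snd (\<eta> 1) * exp L * L" .
qed

section \<open>Upper bounds for the distance from explicit curves\<close>

lemma length_nonneg:
  fixes \<eta> :: "real \<Rightarrow> 'm::finite point"
  assumes "horizontal_curve \<eta> c"
  shows "0 \<le> integral {0..1} (\<lambda>t. norm (c t))"
  using assms unfolding horizontal_curve_def
  by (intro integral_nonneg) (auto simp: absolutely_integrable_on_def)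

lemma d_G_le:
  fixes \<eta> :: "real \<Rightarrow> 'm::finite point"
  assumes "horizontal_curve \<eta> c" "\<eta> 0 = x" "\<eta> 1 = y"
  shows "d_G x y \<le> integral {0..1} (\<lambda>t. norm (c t))"
  unfolding d_G_def
  by (rule cInf_lower) (use assms length_nonneg in \<open>auto intro!: bdd_belowI[of _ 0]\<close>)

lemma smooth_horizontal_curve:
  fixes \<eta> :: "real \<Rightarrow> 'm::finite point"
  assumes pos: "\<And>t. t \<in> {0..1} \<Longrightarrow> 0 < snd (\<eta> t)"
    and d: "\<And>t. (\<eta> has_vector_derivative \<eta>' t) (at t)"
    and c': "continuous_on UNIV \<eta>'"
  shows "horizontal_curve \<eta> (\<lambda>t. (1 / snd (\<eta> t)) *\<^sub>R \<eta>' t)"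
  unfolding horizontal_curve_def
proof (intro conjI exI[of _ "{}"] ballI)
  show "\<eta> ` {0..1} \<subseteq> G_carrier" using pos by (auto simp: carrier_iff)
  have "\<eta> C1_differentiable_on {0..1}"
    unfolding C1_differentiable_on_def
    using d c' continuous_on_subset by blast
  then show "\<eta> piecewise_C1_differentiable_on {0..1}"
    by (rule C1_differentiable_imp_piecewise)
  have "continuous_on {0..1} \<eta>"
    using d by (meson continuous_at_imp_continuous_on has_vector_derivative_continuous)
  moreover have "snd (\<eta> t) \<noteq> 0" if "t \<in> {0..1}" for t using pos[OF that] by simp
  ultimately show "(\<lambda>t. (1 / snd (\<eta> t)) *\<^sub>R \<eta>' t) absolutely_integrable_on {0..1}"
    by (intro absolutely_integrable_continuous_real continuous_intros
        continuous_on_subset[OF c']) auto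
  show "(\<eta> has_vector_derivative left_field ((1 / snd (\<eta> t)) *\<^sub>R \<eta>' t) (\<eta> t)) (at t)"
    if "t \<in> {0..1} - {}" for t
    using d[of t] pos[of t] that by (auto simp: left_field_def)
qed simp

lemma smooth_curve_d_G_le:
  fixes \<eta> :: "real \<Rightarrow> 'm::finite point"
  assumes "\<And>t. t \<in> {0..1} \<Longrightarrow> 0 < snd (\<eta> t)"
    and "\<And>t. (\<eta> has_vector_derivative \<eta>' t) (at t)"
    and "continuous_on UNIV \<eta>'"
    and bound: "\<And>t. t \<in> {0..1} \<Longrightarrow> norm (\<eta>' t) \<le> B * snd (\<eta> t)"
  shows "d_G (\<eta> 0) (\<eta> 1) \<le> B"
proof -
  let ?c = "\<lambda>t. (1 / snd (\<eta> t)) *\<^sub>R \<eta>' t"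
  have h: "horizontal_curve \<eta> ?c" using assms(1-3) by (rule smooth_horizontal_curve)
  then have "d_G (\<eta> 0) (\<eta> 1) \<le> integral {0..1} (\<lambda>t. norm (?c t))"
    by (rule d_G_le) auto
  also have "\<dots> \<le> integral {0..1} (\<lambda>t::real. B)"
  proof (rule integral_le)
    show "(\<lambda>t. norm (?c t)) integrable_on {0..1}"
      using h by (simp only: horizontal_curve_def absolutely_integrable_on_def)
    show "norm (?c t) \<le> B" if "t \<in> {0..1}" for t
      using assms(1)[OF that] bound[OF that] by (simp add: divide_le_eq)
  qed auto
  finally show ?thesis by simp
qed

text \<open>A straight segment stays above height \<open>m\<close>, where a Euclidean vector has
  left-invariant length at most \<open>1 / m\<close> times its norm. The second claim keeps the set
  in the definition of \<open>d_G\<close> nonempty, so that its \<open>Inf\<close> is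
  meaningful.\<close>

lemma d_G_segment:
  fixes x y :: "'m::finite point"
  assumes "0 < m" "m \<le> snd x" "m \<le> snd y"
  shows "d_G x y \<le> norm (y - x) / m"
    and "\<exists>\<eta> c. horizontal_curve \<eta> c \<and> \<eta> 0 = x \<and> \<eta> 1 = y"
proof -
  let ?\<eta> = "\<lambda>t. x + t *\<^sub>R (y - x)"
  have ge: "m \<le> snd (?\<eta> t)" if "t \<in> {0..1}" for t
  proof -
    have "snd (?\<eta> t) = (1 - t) * snd x + t * snd y" by (simp add: algebra_simps)
    moreover have "(1 - t) * m + t * m \<le> (1 - t) * snd x + t * snd y"
      using that assms by (intro add_mono mult_left_mono) auto
    ultimately show ?thesis by (simp add: algebra_simps)
  qed
  have d: "(?\<eta> has_vector_derivative y - x) (at t)" for t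
    by (auto intro!: derivative_eq_intros)
  have "d_G (?\<eta> 0) (?\<eta> 1) \<le> norm (y - x) / m"
  proof (rule smooth_curve_d_G_le[OF _ d])
    show "norm (y - x) \<le> norm (y - x) / m * snd (?\<eta> t)" if "t \<in> {0..1}" for t
      using mult_left_mono[OF ge[OF that], of "norm (y - x)"] assms(1)
      by (simp add: field_simps)
  qed (use ge assms(1) in \<open>force intro: continuous_intros\<close>)+
  then show "d_G x y \<le> norm (y - x) / m" by simp
  have "horizontal_curve ?\<eta> (\<lambda>t. (1 / snd (?\<eta> t)) *\<^sub>R (y - x))"
    by (rule smooth_horizontal_curve[OF _ d]) (use ge assms(1) in \<open>force intro: continuous_intros\<close>)+
  then show "\<exists>\<eta> c. horizontal_curve \<eta> c \<and> \<eta> 0 = x \<and> \<eta> 1 = y"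
    by (intro exI[of _ ?\<eta>] exI conjI) (assumption, auto)
qed

text \<open>The curve follows the flow line of \<open>(v, 1)\<close> through \<open>x\<close> at
  constant logarithmic speed \<open>\<tau>\<close>; its frame coordinates are
  \<open>\<tau> *\<^sub>R (v, 1)\<close>, of norm at most
  \<open>(1 + norm v) * \<bar>\<tau>\<bar>\<close>.\<close>

lemma d_G_flow_line:
  fixes x :: "'m::finite point" and v :: "real^'m"
  assumes "0 < snd x" "0 < a"
  shows "d_G x (fst x + (a - snd x) *\<^sub>R v, a) \<le> (1 + norm v) * \<bar>ln (a / snd x)\<bar>"
proof -
  define \<tau> where "\<tau> = ln (a / snd x)"
  let ?\<eta> = "\<lambda>t. (fst x + (snd x * (exp (\<tau> * t) - 1)) *\<^sub>R v, snd x * exp (\<tau> * t))"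
  let ?\<eta>' = "\<lambda>t. ((snd x * exp (\<tau> * t) * \<tau>) *\<^sub>R v, snd x * exp (\<tau> * t) * \<tau>)"
  have "d_G (?\<eta> 0) (?\<eta> 1) \<le> (1 + norm v) * \<bar>\<tau>\<bar>"
  proof (rule smooth_curve_d_G_le[where \<eta>' = ?\<eta>'])
    show "(?\<eta> has_vector_derivative ?\<eta>' t) (at t)" for t
      by (auto intro!: has_vector_derivative_Pair derivative_eq_intros
          simp: has_real_derivative_iff_has_vector_derivative[symmetric])
    show "norm (?\<eta>' t) \<le> (1 + norm v) * \<bar>\<tau>\<bar> * snd (?\<eta> t)" for t
      using norm_Pair_le[of "(snd x * exp (\<tau> * t) * \<tau>) *\<^sub>R v" "snd x * exp (\<tau> * t) * \<tau>"] assms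
      by (simp add: abs_mult algebra_simps)
    show "continuous_on UNIV ?\<eta>'" by (intro continuous_intros)
  qed (use assms in auto)
  moreover have "snd x * exp \<tau> = a" using assms by (simp add: \<tau>_def)
  ultimately show ?thesis by (simp add: \<tau>_def algebra_simps)
qed

section \<open>Concatenation of curves and the triangle inequality\<close>

lemma horizontal_curve_join:
  fixes \<eta>1 \<eta>2 :: "real \<Rightarrow> 'm::finite point"
  assumes h1: "horizontal_curve \<eta>1 c1" and h2: "horizontal_curve \<eta>2 c2"
    and eq: "\<eta>1 1 = \<eta>2 0"
  defines "c \<equiv> \<lambda>t. if t \<le> 1/2 then 2 *\<^sub>R c1 (2 * t) else 2 *\<^sub>R c2 (2 * t - 1)"
  shows "horizontal_curve (\<eta>1 +++ \<eta>2) c"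
    and "integral {0..1} (\<lambda>t. norm (c t)) =
      integral {0..1} (\<lambda>t. norm (c1 t)) + integral {0..1} (\<lambda>t. norm (c2 t))"
proof -
  from h1 obtain S1 where p1: "\<eta>1 ` {0..1} \<subseteq> G_carrier"
    and pw1: "\<eta>1 piecewise_C1_differentiable_on {0..1}"
    and ac1: "c1 absolutely_integrable_on {0..1}" and fS1: "finite S1"
    and d1: "\<And>t. t \<in> {0..1} - S1 \<Longrightarrow> (\<eta>1 has_vector_derivative left_field (c1 t) (\<eta>1 t)) (at t)"
    unfolding horizontal_curve_def by blast
  from h2 obtain S2 where p2: "\<eta>2 ` {0..1} \<subseteq> G_carrier"
    and pw2: "\<eta>2 piecewise_C1_differentiable_on {0..1}"
    and ac2: "c2 absolutely_integrable_on {0..1}" and fS2: "finite S2"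
    and d2: "\<And>t. t \<in> {0..1} - S2 \<Longrightarrow> (\<eta>2 has_vector_derivative left_field (c2 t) (\<eta>2 t)) (at t)"
    unfolding horizontal_curve_def by blast
  have left: "((\<lambda>t. h (2 * t)) has_integral (1/2) *\<^sub>R I) {0..1/2}"
    if "(h has_integral I) {0..1}" for h :: "real \<Rightarrow> 'b::banach" and I
    using has_integral_affinity[of h I 0 1 2 0] that by simp
  have right: "((\<lambda>t. h (2 * t - 1)) has_integral (1/2) *\<^sub>R I) {1/2..1}"
    if "(h has_integral I) {0..1}" for h :: "real \<Rightarrow> 'b::banach" and I
    using has_integral_affinity[of h I 0 1 2 "-1"] that
    by (simp add: image_affinity_atLeastAtMost[of "1/2" "1/2" 0 1, simplified])
  have join: "((\<lambda>t. if t \<le> 1/2 then 2 *\<^sub>R h (2 * t) else 2 *\<^sub>R k (2 * t - 1)) has_integral I + J) {0..1}"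
    if h: "(h has_integral I) {0..1}" and k: "(k has_integral J) {0..1}" for h k :: "real \<Rightarrow> 'b::banach" and I J
  proof (rule has_integral_combine[of 0 "1/2" 1])
    show "((\<lambda>t. if t \<le> 1/2 then 2 *\<^sub>R h (2 * t) else 2 *\<^sub>R k (2 * t - 1)) has_integral I) {0..1/2}"
      by (rule has_integral_eq[OF _ has_integral_cmul[OF left[OF h], of 2, simplified]]) auto
    \<comment> \<open>At \<open>t = 1/2\<close> the first branch is taken, so on the right half the
      integrand agrees with the second branch only off that point.\<close>
    show "((\<lambda>t. if t \<le> 1/2 then 2 *\<^sub>R h (2 * t) else 2 *\<^sub>R k (2 * t - 1)) has_integral J) {1/2..1}"
      by (rule has_integral_spike_finite[of "{1/2}", OF _ _ has_integral_cmul[OF right[OF k], of 2, simplified]]) auto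
  qed auto
  have n1: "((\<lambda>t. norm (c1 t)) has_integral integral {0..1} (\<lambda>t. norm (c1 t))) {0..1}"
    and i1: "(c1 has_integral integral {0..1} c1) {0..1}"
    using ac1 by (auto simp: absolutely_integrable_on_def has_integral_iff)
  have n2: "((\<lambda>t. norm (c2 t)) has_integral integral {0..1} (\<lambda>t. norm (c2 t))) {0..1}"
    and i2: "(c2 has_integral integral {0..1} c2) {0..1}"
    using ac2 by (auto simp: absolutely_integrable_on_def has_integral_iff)
  have nc: "((\<lambda>t. norm (c t)) has_integral
      integral {0..1} (\<lambda>t. norm (c1 t)) + integral {0..1} (\<lambda>t. norm (c2 t))) {0..1}"
    by (rule has_integral_eq[OF _ join[OF n1 n2]]) (auto simp: c_def)
  show "integral {0..1} (\<lambda>t. norm (c t)) =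
      integral {0..1} (\<lambda>t. norm (c1 t)) + integral {0..1} (\<lambda>t. norm (c2 t))"
    using nc by (rule integral_unique)
  \<comment> \<open>The exceptional times of both halves after rescaling, and the junction.\<close>
  define S where "S = insert (1/2) ((*) (1/2) ` S1 \<union> (\<lambda>t. (t + 1) / 2) ` S2)"
  show "horizontal_curve (\<eta>1 +++ \<eta>2) c"
    unfolding horizontal_curve_def
  proof (intro conjI exI[of _ S] ballI)
    have "path_image (\<eta>1 +++ \<eta>2) \<subseteq> path_image \<eta>1 \<union> path_image \<eta>2"
      by (rule path_image_join_subset)
    then show "(\<eta>1 +++ \<eta>2) ` {0..1} \<subseteq> G_carrier"
      using p1 p2 unfolding path_image_def by blast
    have "valid_path (\<eta>1 +++ \<eta>2)"
      by (rule valid_path_join) (use pw1 pw2 eq in \<open>auto simp: valid_path_def pathfinish_def pathstart_def\<close>)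
    then show "(\<eta>1 +++ \<eta>2) piecewise_C1_differentiable_on {0..1}" by (simp add: valid_path_def)
    have "(c has_integral integral {0..1} c1 + integral {0..1} c2) {0..1}"
      unfolding c_def by (rule join[OF i1 i2])
    then show "c absolutely_integrable_on {0..1}"
      using nc by (auto simp: absolutely_integrable_on_def has_integral_iff)
    show "finite S" unfolding S_def using fS1 fS2 by auto
    fix t assume t: "t \<in> {0..1} - S"
    consider "t < 1/2" | "t > 1/2" using t unfolding S_def by fastforce
    then show "((\<eta>1 +++ \<eta>2) has_vector_derivative left_field (c t) ((\<eta>1 +++ \<eta>2) t)) (at t)"
    proof cases
      case 1
      have "2 * t \<notin> S1"
      proof
        assume "2 * t \<in> S1"
        then have "t \<in> (*) (1/2) ` S1" by (intro image_eqI[of _ _ "2 * t"]) auto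
        with t show False unfolding S_def by blast
      qed
      then have "(\<eta>1 has_vector_derivative left_field (c1 (2 * t)) (\<eta>1 (2 * t))) (at (2 * t))"
        using d1[of "2 * t"] t 1 by auto
      from vector_diff_chain_at[of "\<lambda>t. 2 * t" 2 t, OF _ this]
      have "((\<lambda>t. \<eta>1 (2 * t)) has_vector_derivative 2 *\<^sub>R left_field (c1 (2 * t)) (\<eta>1 (2 * t))) (at t)"
        by (auto simp: o_def intro!: derivative_eq_intros
            simp: has_real_derivative_iff_has_vector_derivative[symmetric])
      then have "((\<eta>1 +++ \<eta>2) has_vector_derivative 2 *\<^sub>R left_field (c1 (2 * t)) (\<eta>1 (2 * t))) (at t)"
        by (rule has_vector_derivative_transform_within_open[where S = "{..<1/2}"])
          (use 1 in \<open>auto simp: joinpaths_def\<close>)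
      then show ?thesis using 1 by (simp add: c_def joinpaths_def left_field_def mult.commute)
    next
      case 2
      have "2 * t - 1 \<notin> S2"
      proof
        assume "2 * t - 1 \<in> S2"
        then have "t \<in> (\<lambda>t. (t + 1) / 2) ` S2" by (intro image_eqI[of _ _ "2 * t - 1"]) auto
        with t show False unfolding S_def by blast
      qed
      then have "(\<eta>2 has_vector_derivative left_field (c2 (2 * t - 1)) (\<eta>2 (2 * t - 1))) (at (2 * t - 1))"
        using d2[of "2 * t - 1"] t 2 by auto
      from vector_diff_chain_at[of "\<lambda>t. 2 * t - 1" 2 t, OF _ this]
      have "((\<lambda>t. \<eta>2 (2 * t - 1)) has_vector_derivative
          2 *\<^sub>R left_field (c2 (2 * t - 1)) (\<eta>2 (2 * t - 1))) (at t)"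
        unfolding o_def
        \<comment> \<open>The chained fact is still an implication whose premise is the derivative
          of \<open>\<lambda>t. 2 * t - 1\<close>; \<open>meta_mp\<close> leaves that premise to
          \<open>auto\<close>.\<close>
        by (rule meta_mp) (auto intro!: derivative_eq_intros
            simp: has_real_derivative_iff_has_vector_derivative[symmetric])
      then have "((\<eta>1 +++ \<eta>2) has_vector_derivative
          2 *\<^sub>R left_field (c2 (2 * t - 1)) (\<eta>2 (2 * t - 1))) (at t)"
        by (rule has_vector_derivative_transform_within_open[where S = "{1/2<..}"])
          (use 2 in \<open>auto simp: joinpaths_def\<close>)
      then show ?thesis using 2 by (simp add: c_def joinpaths_def left_field_def mult.commute)
    qed
  qed
qed

lemma d_G_less_obtain:
  fixes x y :: "'m::finite point"
  assumes "d_G x y < R" "0 < snd x" "0 < snd y"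
  obtains \<eta> c where "horizontal_curve \<eta> c" "\<eta> 0 = x" "\<eta> 1 = y"
    "integral {0..1} (\<lambda>t. norm (c t)) < R"
proof -
  let ?L = "{integral {0..1} (\<lambda>t. norm (c t)) | \<eta> c.
    horizontal_curve \<eta> c \<and> \<eta> 0 = x \<and> \<eta> 1 = y}"
  have "?L \<noteq> {}"
    using d_G_segment(2)[of "min (snd x) (snd y)" x y] assms by auto
  then have "\<exists>l\<in>?L. l < R" using assms(1) unfolding d_G_def by (rule cInf_lessD)
  then show ?thesis using that by blast
qed

lemma d_G_triangle:
  fixes x y z :: "'m::finite point"
  assumes "0 < snd x" "0 < snd y" "0 < snd z"
  shows "d_G x z \<le> d_G x y + d_G y z"
proof (rule field_le_epsilon)
  fix e :: real assume "0 < e"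
  obtain \<eta>1 c1 where 1: "horizontal_curve \<eta>1 c1" "\<eta>1 0 = x" "\<eta>1 1 = y"
      "integral {0..1} (\<lambda>t. norm (c1 t)) < d_G x y + e/2"
    using d_G_less_obtain[of x y "d_G x y + e/2"] assms \<open>0 < e\<close> by auto
  obtain \<eta>2 c2 where 2: "horizontal_curve \<eta>2 c2" "\<eta>2 0 = y" "\<eta>2 1 = z"
      "integral {0..1} (\<lambda>t. norm (c2 t)) < d_G y z + e/2"
    using d_G_less_obtain[of y z "d_G y z + e/2"] assms \<open>0 < e\<close> by auto
  have "d_G x z \<le> integral {0..1} (\<lambda>t. norm (c1 t)) + integral {0..1} (\<lambda>t. norm (c2 t))"
    using horizontal_curve_join[OF 1(1) 2(1)] 1 2
      d_G_le[OF horizontal_curve_join(1)[OF 1(1) 2(1)], of x z]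
    by (simp add: joinpaths_def)
  then show "d_G x z \<le> d_G x y + d_G y z + e" using 1(4) 2(4) by simp
qed

section \<open>Distortion in terms of the distance, and openness of neighbourhoods\<close>

lemma d_G_less_distortion:
  fixes x y :: "'m::finite point"
  assumes "d_G x y < R" "0 < snd x" "0 < snd y"
  shows "\<bar>ln (snd y) - ln (snd x)\<bar> < R"
    and "norm (fst y - fst x) \<le> snd y * exp R * R"
proof -
  obtain \<eta> c where h: "horizontal_curve \<eta> c" "\<eta> 0 = x" "\<eta> 1 = y"
    "integral {0..1} (\<lambda>t. norm (c t)) < R" using d_G_less_obtain[OF assms] .
  let ?L = "integral {0..1} (\<lambda>t. norm (c t))"
  note D = horizontal_curve_distortion[OF h(1), unfolded h(2,3)]
  show "\<bar>ln (snd y) - ln (snd x)\<bar> < R" using D(1) h(4) by simp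
  have "snd y * exp ?L * ?L \<le> snd y * exp R * R"
    using h(4) assms(3) length_nonneg[OF h(1)] by (intro mult_mono) auto
  with D(2) show "norm (fst y - fst x) \<le> snd y * exp R * R" by simp
qed

lemma d_G_nonneg:
  fixes x y :: "'m::finite point"
  assumes "0 < snd x" "0 < snd y"
  shows "0 \<le> d_G x y"
  \<comment> \<open>With \<open>R = 0\<close>, a negative distance would put an absolute value
    strictly below 0.\<close>
  using d_G_less_distortion(1)[of x y 0] assms by force

text \<open>Near \<open>x\<close> all points lie above half its height, so the segment bound makes
  \<open>d_G x' x\<close> as small as desired and the triangle inequality applies. Openness is
  Euclidean, since the measurable sets of \<open>\<mu>\<close> are Euclidean Borel sets.\<close>

lemma open_d_G_ball:
  fixes y :: "'m::finite point"
  assumes "0 < snd y"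
  shows "open {x \<in> G_carrier. d_G x y < R}"
  unfolding open_dist
proof (rule ballI, goal_cases)
  case (1 x)
  then have x: "0 < snd x" "d_G x y < R" by (auto simp: carrier_iff)
  define m where "m = snd x / 2"
  define e where "e = min m ((R - d_G x y) * m)"
  have m: "0 < m" "m \<le> snd x" using x by (auto simp: m_def)
  have "0 < e" using x m by (auto simp: e_def)
  moreover have "x' \<in> {x \<in> G_carrier. d_G x y < R}" if "dist x' x < e" for x'
  proof -
    have "dist (snd x') (snd x) < m"
      using that dist_snd_le[of x' x] by (simp add: e_def)
    then have m': "m \<le> snd x'" by (auto simp: m_def dist_real_def abs_if split: if_splits)
    have "norm (x - x') < (R - d_G x y) * m"
      using that by (simp add: e_def dist_norm norm_minus_commute)
    then have "norm (x - x') / m < R - d_G x y" using m by (simp add: divide_less_eq)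
    then have "d_G x' x < R - d_G x y"
      using d_G_segment(1)[of m x' x] m m' by simp
    then show ?thesis
      using d_G_triangle[of x' x y] x m m' assms by (simp add: carrier_iff)
  qed
  ultimately show ?case by blast
qed

text \<open>Distances are bounded below by 0, so an infimum below \<open>\<rho>\<close> means that
  some point is closer than \<open>\<rho>\<close>. The neighbourhood is thus a union of open balls,
  which gives the measurability in condition (e).\<close>

lemma neighbourhood_eq:
  fixes E :: "'m::finite point set"
  assumes "E \<subseteq> G_carrier"
  shows "neighbourhood G_carrier d_G E \<rho> = (\<Union>y\<in>E. {x \<in> G_carrier. d_G x y < \<rho>})"
proof -
  have "(INF y\<in>E. d_G x y) < \<rho> \<longleftrightarrow> (\<exists>y\<in>E. d_G x y < \<rho>)" if "x \<in> G_carrier" "E \<noteq> {}" for x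
  proof (rule cINF_less_iff[OF \<open>E \<noteq> {}\<close>])
    show "bdd_below (d_G x ` E)"
      using assms that d_G_nonneg[of x] by (intro bdd_belowI[of _ 0]) (auto simp: carrier_iff subset_iff)
  qed
  then show ?thesis unfolding neighbourhood_def by blast
qed

lemma open_neighbourhood:
  fixes E :: "'m::finite point set"
  assumes "E \<subseteq> G_carrier"
  shows "open (neighbourhood G_carrier d_G E \<rho>)"
  unfolding neighbourhood_eq[OF assms]
  using assms by (intro open_UN ballI open_d_G_ball) (auto simp: carrier_iff)

section \<open>Flow measures in flow coordinates\<close>

text \<open>The first coordinate of the point where the flow line of \<open>(v, 1)\<close> through
  \<open>x\<close> crosses height 1: the line through \<open>(n, 1)\<close> consists of the points
  \<open>(n + (a - 1) *\<^sub>R v, a)\<close>.\<close>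

definition flow_base :: "real^'m::finite \<Rightarrow> 'm point \<Rightarrow> real^'m" where
  "flow_base v x = fst x - (snd x - 1) *\<^sub>R v"

definition flow_tile :: "real^'m::finite \<Rightarrow> (real^'m) set \<Rightarrow> real set \<Rightarrow> 'm point set" where
  "flow_tile v E B = {x. flow_base v x \<in> E \<and> snd x \<in> B}"

text \<open>The flow parameter \<open>t\<close> is the logarithm of the height, because
  \<open>(n, 1)\<close> has height 1 and \<open>G_exp (t *\<^sub>R (v, 1))\<close> has height
  \<open>exp t\<close>.\<close>

lemma cylinder_eq_tile:
  fixes v :: "real^'m::finite"
  assumes "0 < a" "0 < r"
  shows "cylinder (v, 1) r E a = flow_tile v E {a / r <..< a * r}"
proof (intro equalityI subsetI)
  fix x assume "x \<in> cylinder (v, 1) r E a"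
  then obtain n t where nt: "n \<in> E" "ln (a / r) < t" "t < ln (a * r)"
    and x: "x = (n + (exp t - 1) *\<^sub>R v, exp t)"
    by (auto simp: cylinder_def U_int_def G_exp_horizontal G_mult_def simp del: scaleR_Pair)
  have "a / r < exp t"
    using nt(2) assms exp_less_mono[of "ln (a / r)" t] by simp
  moreover have "exp t < a * r"
    using nt(3) assms exp_less_mono[of t "ln (a * r)"] by simp
  ultimately show "x \<in> flow_tile v E {a / r <..< a * r}"
    using nt(1) by (simp add: x flow_tile_def flow_base_def)
next
  fix x assume x: "x \<in> flow_tile v E {a / r <..< a * r}"
  then have pos: "0 < snd x" using assms
    by (auto simp: flow_tile_def intro: less_trans[of 0 "a / r"])
  have "x = G_mult (flow_base v x, 1) (G_exp (ln (snd x) *\<^sub>R (v, 1)))"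
    using pos by (simp add: G_exp_horizontal G_mult_def flow_base_def prod_eq_iff del: scaleR_Pair)
  moreover have "ln (snd x) \<in> U_int r a"
    using x pos assms by (simp add: U_int_def flow_tile_def)
  ultimately show "x \<in> cylinder (v, 1) r E a"
    using x unfolding cylinder_def flow_tile_def by blast
qed

lemma continuous_flow_base: "continuous_on S (flow_base v)"
  unfolding flow_base_def by (intro continuous_intros)

lemma borel_flow_base [measurable]: "flow_base v \<in> borel_measurable borel"
  by (intro borel_measurable_continuous_onI continuous_flow_base)

lemma borel_flow_tile:
  fixes v :: "real^'a::finite"
  assumes [measurable]: "E \<in> sets borel" "B \<in> sets borel"
  shows "flow_tile v E B \<in> sets borel"
proof -
  have eq: "flow_tile v E B = flow_base v -` E \<inter> snd -` B" by (auto simp: flow_tile_def)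
  have "(snd :: 'a point \<Rightarrow> real) \<in> borel_measurable borel"
    by (intro borel_measurable_continuous_onI continuous_intros)
  then have "(snd :: 'a point \<Rightarrow> real) -` B \<in> sets borel"
    using assms(2) by (metis inf_top.right_neutral measurable_sets space_borel)
  moreover have "flow_base v -` E \<in> sets borel"
    using borel_flow_base assms(1) by (metis inf_top.right_neutral measurable_sets space_borel)
  ultimately show ?thesis by (simp add: eq)
qed

lemma open_flow_tile:
  assumes "open E" "open B"
  shows "open (flow_tile v E B)"
proof -
  have "flow_tile v E B = flow_base v -` E \<inter> snd -` B" by (auto simp: flow_tile_def)
  then show ?thesis
    using assms continuous_flow_base[of UNIV v]
    by (simp only: open_Int open_vimage continuous_on_snd continuous_on_id)
qed

lemma open_G_carrier: "open (G_carrier :: 'm::finite point set)"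
proof -
  have "(G_carrier :: 'm point set) = snd -` {0<..}" by (auto simp: carrier_iff)
  moreover have "open (snd -` {0<..} :: 'm point set)"
    by (intro open_vimage open_greaterThan continuous_on_snd continuous_on_id)
  ultimately show ?thesis by (simp only:)
qed

lemma borel_G_carrier [measurable]: "(G_carrier :: 'm::finite point set) \<in> sets borel"
  using open_G_carrier by (rule borel_open)

lemma nn_integral_inverse_Ioo:
  fixes p q :: real
  assumes "0 < p" "p \<le> q"
  shows "(\<integral>\<^sup>+b. ennreal (1 / b) * indicator {p<..<q} b \<partial>lborel) = ennreal (ln q - ln p)"
proof -
  have "(\<integral>\<^sup>+b. ennreal (1 / b) * indicator {p<..<q} b \<partial>lborel) =
      (\<integral>\<^sup>+b. ennreal (1 / b) * indicator {p..q} b \<partial>lborel)"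
  proof (rule nn_integral_cong_AE)
    have "AE b in lborel. b \<notin> {p, q}" by (rule AE_not_in) (auto intro: finite_imp_null_set_lborel)
    then show "AE b in lborel. ennreal (1 / b) * indicator {p<..<q} b = ennreal (1 / b) * indicator {p..q} b"
      by eventually_elim (auto split: split_indicator)
  qed
  also have "\<dots> = ennreal (ln q - ln p)"
    by (rule nn_integral_FTC_Icc) (use assms in \<open>auto intro!: derivative_eq_intros\<close>)
  finally show ?thesis .
qed

locale flow =
  fixes v :: "real^'m::finite" and \<mu> :: "'m point measure" and \<phi> :: "'m point \<Rightarrow> real"
  assumes density: "flow_density (v, 1) \<mu> \<phi>"
begin

text \<open>The density of \<open>\<mu>\<close> with respect to Lebesgue measure, with
  \<open>\<phi>\<close> evaluated at the base point. While \<open>\<phi>\<close> is only known to be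
  measurable on \<open>G_carrier\<close>, this function is Borel on the whole ambient space, so
  integrals can be taken over \<open>lborel\<close>.\<close>

definition weight :: "'m point \<Rightarrow> ennreal" where
  "weight x = ennreal (\<phi> (flow_base v x, 1)) * ennreal (1 / snd x)"

lemma space_\<mu>: "space \<mu> = G_carrier"
  and sets_\<mu>: "X \<in> sets \<mu> \<longleftrightarrow> X \<subseteq> G_carrier \<and> X \<in> sets borel"
proof -
  have s: "sets \<mu> = sets (restrict_space lborel G_carrier)"
    using density by (simp add: flow_density_def rho_def)
  show "space \<mu> = G_carrier" using sets_eq_imp_space_eq[OF s] by (simp add: space_restrict_space)
  show "X \<in> sets \<mu> \<longleftrightarrow> X \<subseteq> G_carrier \<and> X \<in> sets borel"
    unfolding s using open_G_carrier by (subst sets_restrict_space_iff) auto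
qed

lemma sets_mu_N [simp]: "sets (mu_N \<phi>) = sets borel" by (simp add: mu_N_def)

lemma borel_density [measurable]: "(\<lambda>n. \<phi> (n, 1)) \<in> borel_measurable borel"
proof -
  have "\<phi> \<in> borel_measurable (restrict_space lborel G_carrier)"
    using density by (simp add: flow_density_def rho_def)
  moreover have "(\<lambda>n::real^'m. (n, 1::real)) \<in> measurable borel (restrict_space lborel G_carrier)"
    by (rule measurable_restrict_space2) (auto simp: carrier_iff borel_prod[symmetric] measurable_lborel1)
  ultimately show ?thesis by (rule measurable_compose[rotated])
qed

lemma borel_weight [measurable]: "weight \<in> borel_measurable borel"
proof -
  have [measurable]: "(\<lambda>x. snd x) \<in> borel_measurable (borel :: 'm point measure)"
    by (simp add: borel_prod[symmetric])
  have [measurable]: "(\<lambda>x. \<phi> (flow_base v x, 1)) \<in> borel_measurable borel"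
    by (rule measurable_compose[OF borel_flow_base borel_density])
  show ?thesis unfolding weight_def by measurable
qed

lemma density_flow_base:
  assumes "x \<in> G_carrier"
  shows "\<phi> x = \<phi> (flow_base v x, 1)"
proof -
  have "x = G_mult (flow_base v x, 1) (G_exp (ln (snd x) *\<^sub>R (v, 1)))"
    using assms
    by (simp add: carrier_iff G_exp_horizontal G_mult_def flow_base_def prod_eq_iff del: scaleR_Pair)
  moreover have "(flow_base v x, 1) \<in> G_carrier" by (simp add: carrier_iff)
  ultimately show ?thesis using density unfolding flow_density_def by metis
qed

lemma emeasure_\<mu>:
  assumes "X \<in> sets \<mu>"
  shows "emeasure \<mu> X = (\<integral>\<^sup>+x. weight x * indicator X x \<partial>lborel)"
proof -
  have X: "X \<subseteq> G_carrier" "X \<in> sets borel" using assms by (auto simp: sets_\<mu>)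
  have m: "\<phi> \<in> borel_measurable (restrict_space lborel G_carrier)"
    using density by (simp add: flow_density_def rho_def)
  have XR: "X \<in> sets (restrict_space lborel G_carrier)"
    using X open_G_carrier by (subst sets_restrict_space_iff) auto
  have a: "(\<lambda>(n, a). ennreal (1 / a)) \<in> borel_measurable (restrict_space (lborel :: 'm point measure) G_carrier)"
    by (intro measurable_restrict_space1) (simp add: borel_prod[symmetric] measurable_lborel1)
  have "emeasure \<mu> X = (\<integral>\<^sup>+x. ennreal (\<phi> x) * indicator X x \<partial>rho)"
    using density XR m by (simp add: flow_density_def emeasure_density rho_def)
  also have "\<dots> = (\<integral>\<^sup>+x. (case x of (n, a) \<Rightarrow> ennreal (1 / a)) * (ennreal (\<phi> x) * indicator X x)
      \<partial>restrict_space lborel G_carrier)"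
    unfolding rho_def using m XR a by (subst nn_integral_density) auto
  also have "\<dots> = (\<integral>\<^sup>+x. (case x of (n, a) \<Rightarrow> ennreal (1 / a)) * (ennreal (\<phi> x) * indicator X x)
      * indicator G_carrier x \<partial>lborel)"
    using open_G_carrier by (subst nn_integral_restrict_space) auto
  also have "\<dots> = (\<integral>\<^sup>+x. weight x * indicator X x \<partial>lborel)"
    using X(1) by (intro nn_integral_cong)
      (auto simp: weight_def density_flow_base[symmetric] split: split_indicator, auto simp: mult.commute)
  finally show ?thesis .
qed

text \<open>At height \<open>b\<close> the slice of the tile is \<open>E\<close> translated by
  \<open>(b - 1) *\<^sub>R v\<close>, and the density on it is translated in the same way. By
  translation invariance of Lebesgue measure the inner integral depends on \<open>b\<close> only
  through the factor \<open>1 / b\<close>.\<close>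

lemma emeasure_flow_tile:
  assumes E [measurable]: "E \<in> sets borel" and B [measurable]: "B \<in> sets borel" "B \<subseteq> {0<..}"
  shows "emeasure \<mu> (flow_tile v E B) =
    emeasure (mu_N \<phi>) E * (\<integral>\<^sup>+b. ennreal (1 / b) * indicator B b \<partial>lborel)"
proof -
  let ?h = "\<lambda>n. ennreal (\<phi> (n, 1)) * indicator E n"
  let ?g = "\<lambda>b::real. ennreal (1 / b) * indicator B b"
  have T: "flow_tile v E B \<in> sets borel" using E B(1) by (rule borel_flow_tile)
  then have "flow_tile v E B \<in> sets \<mu>"
    using B by (auto simp: sets_\<mu> flow_tile_def carrier_iff)
  then have "emeasure \<mu> (flow_tile v E B) = (\<integral>\<^sup>+x. weight x * indicator (flow_tile v E B) x \<partial>lborel)"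
    by (rule emeasure_\<mu>)
  also have "\<dots> = (\<integral>\<^sup>+x. weight x * indicator (flow_tile v E B) x \<partial>(lborel \<Otimes>\<^sub>M lborel))"
    by (simp add: lborel_prod)
  also have "\<dots> = (\<integral>\<^sup>+b. \<integral>\<^sup>+n. weight (n, b) * indicator (flow_tile v E B) (n, b) \<partial>lborel \<partial>lborel)"
    by (rule lborel_pair.nn_integral_snd[symmetric])
      (use T borel_weight in \<open>simp add: lborel_prod measurable_lborel1\<close>)
  also have "\<dots> = (\<integral>\<^sup>+b. \<integral>\<^sup>+n. ?g b * ?h (- ((b - 1) *\<^sub>R v) + n) \<partial>lborel \<partial>lborel)"
    by (intro nn_integral_cong)
      (auto simp: weight_def flow_tile_def flow_base_def mult.commute split: split_indicator)
  also have "\<dots> = (\<integral>\<^sup>+b. ?g b * (\<integral>\<^sup>+n. ?h n \<partial>lborel) \<partial>lborel)"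
  proof (rule nn_integral_cong)
    fix b :: real
    let ?c = "- ((b - 1) *\<^sub>R v)"
    have "(\<integral>\<^sup>+n. ?h n \<partial>lborel) = (\<integral>\<^sup>+n. ?h n \<partial>distr lborel borel ((+) ?c))"
      by (simp only: lborel_distr_plus)
    also have "\<dots> = (\<integral>\<^sup>+n. ?h (?c + n) \<partial>lborel)"
      by (rule nn_integral_distr) auto
    finally show "(\<integral>\<^sup>+n. ?g b * ?h (?c + n) \<partial>lborel) = ?g b * (\<integral>\<^sup>+n. ?h n \<partial>lborel)"
      by (subst nn_integral_cmult) auto
  qed
  also have "\<dots> = (\<integral>\<^sup>+b. ?g b \<partial>lborel) * (\<integral>\<^sup>+n. ?h n \<partial>lborel)"
    by (rule nn_integral_multc) measurable
  also have "(\<integral>\<^sup>+n. ?h n \<partial>lborel) = emeasure (mu_N \<phi>) E"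
    by (simp add: mu_N_def emeasure_density)
  finally show ?thesis by (simp add: mult.commute)
qed

lemma emeasure_flow_tile_Ioo:
  assumes "E \<in> sets borel" "0 < p" "p \<le> q"
  shows "emeasure \<mu> (flow_tile v E {p<..<q}) = emeasure (mu_N \<phi>) E * ennreal (ln q - ln p)"
  using assms by (subst emeasure_flow_tile) (auto simp: nn_integral_inverse_Ioo)

lemma emeasure_cylinder:
  assumes "E \<in> sets borel" "0 < a" "1 < r"
  shows "emeasure \<mu> (cylinder (v, 1) r E a) = emeasure (mu_N \<phi>) E * ennreal (2 * ln r)"
proof -
  have "a / r \<le> a * r"
    using assms by (simp add: divide_le_eq mult_left_le[of a "r*r"] mult.assoc one_le_mult_iff)
      (smt (verit) mult_less_cancel_left2 mult_less_cancel_left1)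
  then show ?thesis
    using assms by (simp add: cylinder_eq_tile emeasure_flow_tile_Ioo ln_div ln_mult)
qed

lemma flow_tile_null_base:
  assumes "E \<in> null_sets (mu_N \<phi>)" "B \<in> sets borel" "B \<subseteq> {0<..}"
  shows "flow_tile v E B \<in> null_sets \<mu>"
proof (rule null_setsI)
  have E: "E \<in> sets borel" using assms(1) by (auto dest: null_setsD2)
  show "emeasure \<mu> (flow_tile v E B) = 0"
    using assms E by (simp add: emeasure_flow_tile null_setsD1)
  show "flow_tile v E B \<in> sets \<mu>"
    using borel_flow_tile[OF E assms(2)] assms(3) by (auto simp: sets_\<mu> flow_tile_def carrier_iff)
qed

lemma flow_tile_null_height:
  assumes "0 < b"
  shows "flow_tile v UNIV {b} \<in> null_sets \<mu>"
proof (rule null_setsI)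
  have "(\<integral>\<^sup>+x. ennreal (1 / x) * indicator {b} x \<partial>lborel) = 0" by simp
  then show "emeasure \<mu> (flow_tile v UNIV {b}) = 0"
    using assms by (subst emeasure_flow_tile) auto
  show "flow_tile v UNIV {b} \<in> sets \<mu>"
    using borel_flow_tile[of UNIV "{b}" v] assms by (auto simp: sets_\<mu> flow_tile_def carrier_iff)
qed

text \<open>The strip between heights 1 and \<open>exp n\<close> has measure \<open>n\<close> times
  that of \<open>N\<close>.\<close>

lemma infinite_\<mu>:
  assumes "emeasure (mu_N \<phi>) UNIV \<noteq> 0"
  shows "emeasure \<mu> G_carrier = \<infinity>"
proof -
  have "emeasure (mu_N \<phi>) UNIV * of_nat n \<le> emeasure \<mu> G_carrier" for n
  proof -
    have "emeasure (mu_N \<phi>) UNIV * of_nat n = emeasure \<mu> (flow_tile v UNIV {1<..<exp (real n)})"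
      by (subst emeasure_flow_tile_Ioo) (auto simp: ennreal_of_nat_eq_real_of_nat)
    also have "\<dots> \<le> emeasure \<mu> G_carrier"
      using open_G_carrier
      by (intro emeasure_mono) (auto simp: flow_tile_def carrier_iff sets_\<mu>)
    finally show ?thesis .
  qed
  then have "(SUP n. emeasure (mu_N \<phi>) UNIV * of_nat n) \<le> emeasure \<mu> G_carrier"
    by (rule SUP_least)
  moreover have "(SUP n. emeasure (mu_N \<phi>) UNIV * of_nat n) = \<infinity>"
    using assms by (simp add: SUP_mult_left_ennreal[symmetric] ennreal_SUP_of_nat_eq_top ennreal_mult_eq_top_iff)
  ultimately show ?thesis by (simp add: top_unique)
qed

text \<open>The outer regularity theorem concerns finite Borel measures on the whole space, while
  \<open>\<mu>\<close> lives on \<open>G_carrier\<close> and may be infinite. Cutting the density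
  off at \<open>V\<close> gives such a measure \<open>M\<close>, and intersecting an open set with
  \<open>V\<close> leads back to \<open>\<mu>\<close>.\<close>

lemma outer_regular_\<mu>:
  assumes A: "A \<in> sets \<mu>" "A \<subseteq> V" and V: "open V" "V \<subseteq> G_carrier" "emeasure \<mu> V < \<infinity>"
    and e: "0 < e"
  obtains U where "open U" "A \<subseteq> U" "U \<subseteq> V" "emeasure \<mu> U \<le> emeasure \<mu> A + e"
proof -
  define M where "M = density lborel (\<lambda>x. weight x * indicator V x)"
  have sM: "sets M = sets borel" by (simp add: M_def)
  have M: "emeasure M X = emeasure \<mu> (X \<inter> V)" if "X \<in> sets borel" for X
  proof -
    have "emeasure M X = (\<integral>\<^sup>+x. weight x * indicator V x * indicator X x \<partial>lborel)"
      unfolding M_def using that V(1) borel_weight by (subst emeasure_density) auto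
    also have "\<dots> = (\<integral>\<^sup>+x. weight x * indicator (X \<inter> V) x \<partial>lborel)"
      by (intro nn_integral_cong) (auto split: split_indicator)
    also have "\<dots> = emeasure \<mu> (X \<inter> V)"
      using that V by (intro emeasure_\<mu>[symmetric]) (auto simp: sets_\<mu>)
    finally show ?thesis .
  qed
  have fin: "emeasure M (space M) \<noteq> \<infinity>"
    using V by (simp add: M_def M[unfolded M_def])
  have Ab: "A \<in> sets borel" using A by (simp add: sets_\<mu>)
  have "emeasure M A = (INF U \<in> {U. A \<subseteq> U \<and> open U}. emeasure M U)"
    by (rule outer_regular[OF sM fin Ab])
  moreover have "emeasure M A < emeasure M A + e"
  proof -
    have "emeasure M A \<le> emeasure M (space M)" by (rule emeasure_space)
    then have "emeasure M A < \<infinity>" using fin by (simp add: less_top top_unique)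
    then show ?thesis using e by (metis add.right_neutral ennreal_add_left_cancel_less infinity_ennreal_def top.not_eq_extremum)
  qed
  ultimately have "(INF U \<in> {U. A \<subseteq> U \<and> open U}. emeasure M U) < emeasure M A + e" by simp
  then obtain U where U: "A \<subseteq> U" "open U" "emeasure M U < emeasure M A + e"
    unfolding INF_less_iff by blast
  have "emeasure \<mu> (U \<inter> V) \<le> emeasure \<mu> A + e"
    using U M[of U] M[of A] Ab A(2) by (simp add: Int_absorb2)
  then show ?thesis
    using that[of "U \<inter> V"] U V A(2) by blast
qed

end

section \<open>Calderon--Zygmund decompositions along nested partitions\<close>

text \<open>Nodes are abstract indices because the combinatorics of cylinders is carried by their
  parameters. \<open>good\<close> is a set of full measure covered by every level.
  \<open>growth\<close> prevents infinite ascent and so yields maximal nodes; \<open>shrink\<close>,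
  \<open>V\<close> and \<open>outer_regular_V\<close> serve to compare a function with its averages
  almost everywhere.\<close>

locale dyadic_levels =
  fixes M :: "'a::topological_space measure" and Lev :: "int \<Rightarrow> 'i set" and S :: "'i \<Rightarrow> 'a set"
    and C :: real and good :: "'a set" and V :: "nat \<Rightarrow> 'a set"
  assumes countable_Lev: "countable (Lev n)"
    and sets_S: "i \<in> Lev n \<Longrightarrow> S i \<in> sets M"
    and emeasure_S_pos: "i \<in> Lev n \<Longrightarrow> 0 < emeasure M (S i)"
    and emeasure_S_finite: "i \<in> Lev n \<Longrightarrow> emeasure M (S i) < \<infinity>"
    and level_disjoint: "\<lbrakk>i \<in> Lev n; j \<in> Lev n; x \<in> S i; x \<in> S j\<rbrakk> \<Longrightarrow> i = j"
    and AE_good: "AE x in M. x \<in> good"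
    and level_cover: "x \<in> good \<Longrightarrow> \<exists>i\<in>Lev n. x \<in> S i"
    and parent: "i \<in> Lev (n + 1) \<Longrightarrow>
      \<exists>j\<in>Lev n. S i \<subseteq> S j \<and> emeasure M (S j) \<le> ennreal C * emeasure M (S i)"
    and growth: "i \<in> Lev n \<Longrightarrow> \<exists>m\<le>n. \<forall>j\<in>Lev m. S i \<subseteq> S j \<longrightarrow> ennreal R < emeasure M (S j)"
    and shrink: "\<lbrakk>x \<in> good; open U; x \<in> U\<rbrakk> \<Longrightarrow> \<exists>n. \<forall>i\<in>Lev n. x \<in> S i \<longrightarrow> S i \<subseteq> U"
    and C_ge_1: "1 \<le> C"
    and sets_V: "V k \<in> sets M"
    and emeasure_V_finite: "emeasure M (V k) < \<infinity>"
    and V_cover: "space M \<subseteq> (\<Union>k. V k)"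
    and outer_regular_V: "\<lbrakk>A \<in> sets M; A \<subseteq> V k; 0 < e\<rbrakk> \<Longrightarrow>
      \<exists>U. open U \<and> U \<in> sets M \<and> A \<subseteq> U \<and> emeasure M U \<le> emeasure M A + ennreal e"
begin

section \<open>Nested nodes and maximal nodes with a given property\<close>

lemma ancestor_exists:
  assumes "m \<le> n" "i \<in> Lev n"
  shows "\<exists>j\<in>Lev m. S i \<subseteq> S j"
  using assms
proof (induction m rule: int_le_induct)
  case base
  then show ?case by auto
next
  case (step m)
  then obtain j where j: "j \<in> Lev m" "S i \<subseteq> S j" by auto
  from parent[of j "m - 1"] j(1) obtain j' where "j' \<in> Lev (m - 1)" "S j \<subseteq> S j'" by auto
  with j(2) show ?case by blast
qed

lemma nested:
  assumes "i \<in> Lev n" "j \<in> Lev m" "m \<le> n" "x \<in> S i" "x \<in> S j"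
  shows "S i \<subseteq> S j"
  using ancestor_exists[of m n i] level_disjoint[of _ m j x] assms by blast

text \<open>The coarsest nodes with property \<open>Q\<close>. This is applied twice: to nodes with
  large average, and to nodes contained in an open set. The level is recorded since an index need
  not determine it.\<close>

definition first_nodes :: "('i \<Rightarrow> bool) \<Rightarrow> (int \<times> 'i) set" where
  "first_nodes Q = {(n, i). i \<in> Lev n \<and> Q i \<and> (\<forall>m<n. \<forall>j\<in>Lev m. S i \<subseteq> S j \<longrightarrow> \<not> Q j)}"

lemma countable_first_nodes: "countable (first_nodes Q)"
proof (rule countable_subset)
  show "first_nodes Q \<subseteq> (SIGMA n:UNIV. Lev n)" by (auto simp: first_nodes_def)
qed (use countable_Lev in \<open>intro countable_SIGMA, auto\<close>)

lemma first_nodes_disjoint: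
  assumes "(n, i) \<in> first_nodes Q" "(m, j) \<in> first_nodes Q" "x \<in> S i" "x \<in> S j"
  shows "(n, i) = (m, j)"
proof -
  note i = assms(1)[unfolded first_nodes_def, simplified] and j = assms(2)[unfolded first_nodes_def, simplified]
  consider "m < n" | "n < m" | "m = n" by linarith
  then show ?thesis
  proof cases
    case 1
    then have "S i \<subseteq> S j" using nested[of i n j m x] i j assms(3,4) by simp
    then show ?thesis using 1 i j by blast
  next
    case 2
    then have "S j \<subseteq> S i" using nested[of j m i n x] i j assms(3,4) by simp
    then show ?thesis using 2 i j by blast
  next
    case 3
    then show ?thesis using level_disjoint[of i n j x] i j assms(3,4) by simp
  qed
qed

lemma disjoint_family_first_nodes: "disjoint_family_on (\<lambda>\<kappa>. S (snd \<kappa>)) (first_nodes Q)"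
  unfolding disjoint_family_on_def using first_nodes_disjoint by fastforce

text \<open>By \<open>growth\<close>, the ancestors of \<open>i\<close> at some level
  \<open>m0\<close> are too large for the bound on \<open>Q\<close>, and coarser ancestors are
  larger still. So the levels of ancestors with \<open>Q\<close> are bounded below and there is a
  coarsest one.\<close>

lemma first_node_exists:
  assumes "i \<in> Lev n" "Q i" and bound: "\<And>m j. j \<in> Lev m \<Longrightarrow> Q j \<Longrightarrow> emeasure M (S j) \<le> ennreal R"
  shows "\<exists>(m, j)\<in>first_nodes Q. S i \<subseteq> S j"
proof -
  obtain m0 where m0: "m0 \<le> n" "\<And>j. j \<in> Lev m0 \<Longrightarrow> S i \<subseteq> S j \<Longrightarrow> ennreal R < emeasure M (S j)"
    using growth[OF assms(1), of R] by blast
  let ?L = "\<lambda>m. \<exists>j\<in>Lev m. S i \<subseteq> S j \<and> Q j"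
  have ge: "m0 \<le> m" if "?L m" for m
  proof (rule ccontr)
    assume "\<not> m0 \<le> m"
    then have "m \<le> m0" by simp
    from that obtain j where j: "j \<in> Lev m" "S i \<subseteq> S j" "Q j" by blast
    obtain j0 where j0: "j0 \<in> Lev m0" "S i \<subseteq> S j0"
      using ancestor_exists[OF m0(1) assms(1)] by blast
    obtain x where "x \<in> S i" using emeasure_S_pos[OF assms(1)] by fastforce
    then have "S j0 \<subseteq> S j" using nested[OF j0(1) j(1) \<open>m \<le> m0\<close>] j j0 by blast
    then have "emeasure M (S j0) \<le> emeasure M (S j)"
      using sets_S[OF j(1)] by (rule emeasure_mono)
    also have "\<dots> \<le> ennreal R" using bound j by blast
    finally show False using m0(2)[OF j0] by simp
  qed
  \<comment> \<open>Levels are counted from \<open>m0\<close> to make \<open>LEAST\<close> over the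
    natural numbers available.\<close>
  define P where "P = (\<lambda>k. ?L (m0 + int k))"
  have "P (nat (n - m0))" unfolding P_def using assms m0(1) by auto
  then have PL: "P (LEAST k. P k)" by (rule LeastI)
  define m where "m = m0 + int (LEAST k. P k)"
  from PL obtain j where j: "j \<in> Lev m" "S i \<subseteq> S j" "Q j" unfolding P_def m_def by blast
  have "\<not> Q j'" if "m' < m" "j' \<in> Lev m'" "S j \<subseteq> S j'" for m' j'
  proof
    assume "Q j'"
    then have L: "?L m'" using that j by blast
    then have "P (nat (m' - m0))" unfolding P_def using ge by simp
    then have "(LEAST k. P k) \<le> nat (m' - m0)" by (rule Least_le)
    then show False using that(1) ge[OF L] unfolding m_def by linarith
  qed
  then have "(m, j) \<in> first_nodes Q" using j by (auto simp: first_nodes_def)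
  then show ?thesis using j by blast
qed

lemma first_nodes_emeasure_le:
  assumes "K \<subseteq> first_nodes Q" and le: "\<And>n i. (n, i) \<in> K \<Longrightarrow> emeasure N (S i) \<le> ennreal \<alpha> * emeasure M (S i)"
    and N: "sets N = sets M"
  shows "emeasure N (\<Union>\<kappa>\<in>K. S (snd \<kappa>)) \<le> ennreal \<alpha> * emeasure M (\<Union>\<kappa>\<in>K. S (snd \<kappa>))"
proof -
  have c: "countable K" using countable_first_nodes assms(1) countable_subset by blast
  have d: "disjoint_family_on (\<lambda>\<kappa>. S (snd \<kappa>)) K"
    using disjoint_family_first_nodes assms(1) by (rule disjoint_family_on_mono[rotated])
  have s: "S (snd \<kappa>) \<in> sets M" if "\<kappa> \<in> K" for \<kappa>
    using that assms(1) sets_S by (auto simp: first_nodes_def)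
  have "emeasure N (\<Union>\<kappa>\<in>K. S (snd \<kappa>)) = (\<integral>\<^sup>+\<kappa>. emeasure N (S (snd \<kappa>)) \<partial>count_space K)"
    using c d s N by (intro emeasure_UN_countable) auto
  also have "\<dots> \<le> (\<integral>\<^sup>+\<kappa>. ennreal \<alpha> * emeasure M (S (snd \<kappa>)) \<partial>count_space K)"
    by (intro nn_integral_mono) (use le in auto)
  also have "\<dots> = ennreal \<alpha> * (\<integral>\<^sup>+\<kappa>. emeasure M (S (snd \<kappa>)) \<partial>count_space K)"
    by (rule nn_integral_cmult) auto
  also have "(\<integral>\<^sup>+\<kappa>. emeasure M (S (snd \<kappa>)) \<partial>count_space K) = emeasure M (\<Union>\<kappa>\<in>K. S (snd \<kappa>))"
    using c d s by (intro emeasure_UN_countable[symmetric]) auto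
  finally show ?thesis .
qed

section \<open>Stopping nodes of an integrable function\<close>

context
  fixes h :: "'a \<Rightarrow> ennreal" and \<alpha> :: real
  assumes h [measurable]: "h \<in> borel_measurable M" and h_fin: "(\<integral>\<^sup>+x. h x \<partial>M) < \<infinity>" and \<alpha>: "0 < \<alpha>"
begin

definition stopping :: "(int \<times> 'i) set" where
  "stopping = first_nodes (\<lambda>i. ennreal \<alpha> * emeasure M (S i) < emeasure (density M h) (S i))"

lemma emeasure_density_le: "emeasure (density M h) X \<le> (\<integral>\<^sup>+x. h x \<partial>M)"
proof -
  have "emeasure (density M h) X \<le> emeasure (density M h) (space M)"
    using emeasure_space[of "density M h"] by simp
  also have "\<dots> = (\<integral>\<^sup>+x. h x \<partial>M)"
    by (subst emeasure_density) (auto intro!: nn_integral_cong)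
  finally show ?thesis .
qed

lemma stopping_exists:
  assumes "i \<in> Lev n" "ennreal \<alpha> * emeasure M (S i) < emeasure (density M h) (S i)"
  shows "\<exists>(m, j)\<in>stopping. S i \<subseteq> S j"
  unfolding stopping_def
proof (rule first_node_exists[OF assms(1)])
  \<comment> \<open>Chebyshev: a node with average above \<open>\<alpha>\<close> has measure at most
    the integral divided by \<open>\<alpha>\<close>.\<close>
  let ?R = "enn2real (\<integral>\<^sup>+x. h x \<partial>M) / \<alpha>"
  fix m j assume j: "j \<in> Lev m" "ennreal \<alpha> * emeasure M (S j) < emeasure (density M h) (S j)"
  have I: "(\<integral>\<^sup>+x. h x \<partial>M) = ennreal (enn2real (\<integral>\<^sup>+x. h x \<partial>M))"
    using h_fin by simp
  have E: "emeasure M (S j) = ennreal (measure M (S j))"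
    using emeasure_S_finite[OF j(1)] by (intro emeasure_eq_ennreal_measure) simp
  have "ennreal \<alpha> * emeasure M (S j) \<le> (\<integral>\<^sup>+x. h x \<partial>M)"
    using j(2) emeasure_density_le[of "S j"] by (meson less_imp_le order_trans)
  then have "ennreal (\<alpha> * measure M (S j)) \<le> ennreal (enn2real (\<integral>\<^sup>+x. h x \<partial>M))"
    unfolding E using \<alpha> I by (simp add: ennreal_mult)
  then have "\<alpha> * measure M (S j) \<le> enn2real (\<integral>\<^sup>+x. h x \<partial>M)" by (simp add: ennreal_le_iff)
  then show "emeasure M (S j) \<le> ennreal ?R"
    unfolding E using \<alpha> by (intro ennreal_leI) (simp add: field_simps)
qed (use assms in simp)

lemma stopping_Lev: "(n, i) \<in> stopping \<Longrightarrow> i \<in> Lev n"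
  by (simp add: stopping_def first_nodes_def)

lemma stopping_lower:
  "(n, i) \<in> stopping \<Longrightarrow> ennreal \<alpha> * emeasure M (S i) < emeasure (density M h) (S i)"
  by (simp add: stopping_def first_nodes_def)

text \<open>By maximality the parent has average at most \<open>\<alpha>\<close>, and its measure is
  at most \<open>C\<close> times that of \<open>S i\<close>.\<close>

lemma stopping_upper:
  assumes "(n, i) \<in> stopping"
  shows "emeasure (density M h) (S i) \<le> ennreal (C * \<alpha>) * emeasure M (S i)"
proof -
  obtain j where j: "j \<in> Lev (n - 1)" "S i \<subseteq> S j" "emeasure M (S j) \<le> ennreal C * emeasure M (S i)"
    using parent[of i "n - 1"] stopping_Lev[OF assms] by auto
  have "emeasure (density M h) (S i) \<le> emeasure (density M h) (S j)"
    using j sets_S[OF j(1)] by (intro emeasure_mono) auto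
  also have "\<dots> \<le> ennreal \<alpha> * emeasure M (S j)"
    using assms j(1,2) unfolding stopping_def first_nodes_def
    by (auto simp: not_less dest!: spec[of _ "n - 1"])
  also have "\<dots> \<le> ennreal \<alpha> * (ennreal C * emeasure M (S i))"
    using j by (intro mult_left_mono) auto
  also have "\<dots> = ennreal (C * \<alpha>) * emeasure M (S i)"
    using \<alpha> C_ge_1 by (simp add: ennreal_mult mult.assoc mult.left_commute)
  finally show ?thesis .
qed

text \<open>Instead of a differentiation theorem: a set on which \<open>h\<close> exceeds $\alpha$ is covered by
  disjoint nodes inside an open set of nearly the same measure, and \<open>h\<close> has average at most
  $\alpha$ on each of them.\<close>

lemma AE_le_off_stopping: "AE x in M. x \<notin> (\<Union>\<kappa>\<in>stopping. S (snd \<kappa>)) \<longrightarrow> h x \<le> ennreal \<alpha>"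
proof -
  define Om where "Om = (\<Union>\<kappa>\<in>stopping. S (snd \<kappa>))"
  have sS: "S (snd \<kappa>) \<in> sets M" if "\<kappa> \<in> stopping" for \<kappa>
    using that stopping_Lev[of "fst \<kappa>" "snd \<kappa>"] sets_S by simp
  have Om [measurable]: "Om \<in> sets M"
    unfolding Om_def using sS countable_first_nodes
    by (intro sets.countable_UN'') (auto simp: stopping_def)
  \<comment> \<open>The exceptional set is a countable union over \<open>k\<close> and
    \<open>p\<close> of pieces of finite measure on which \<open>h\<close> exceeds
    \<open>\<alpha>\<close> by a fixed amount.\<close>
  define A where "A = (\<lambda>k p. {x \<in> V k - Om. ennreal (\<alpha> + 1 / real (Suc p)) \<le> h x})"
  have A_null: "A k p \<in> null_sets M" for k p
  proof -
    have [measurable]: "V k \<in> sets M" by (rule sets_V)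
    have "A k p = (V k - Om) \<inter> {x \<in> space M. ennreal (\<alpha> + 1 / real (Suc p)) \<le> h x}"
      unfolding A_def using sets.sets_into_space[OF sets_V] by auto
    moreover have "{x \<in> space M. ennreal (\<alpha> + 1 / real (Suc p)) \<le> h x} \<in> sets M" by measurable
    ultimately have sA: "A k p \<in> sets M" by auto
    have AV: "A k p \<subseteq> V k" by (auto simp: A_def)
    have fA: "emeasure M (A k p) < \<infinity>"
      using emeasure_mono[OF AV sets_V] emeasure_V_finite[of k] by (rule order.strict_trans1)
    \<comment> \<open>Letting \<open>e\<close> tend to 0 will bound \<open>1 / real (Suc p)\<close>
      times the measure of \<open>A k p\<close> by 0; finiteness of that measure is what allows the
      subtraction.\<close>
    have main: "ennreal (\<alpha> + 1 / real (Suc p)) * emeasure M (A k p) \<le> ennreal \<alpha> * (emeasure M (A k p) + ennreal e)"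
      if e: "0 < e" for e :: real
    proof -
      obtain U where U: "open U" "U \<in> sets M" "A k p \<subseteq> U" "emeasure M U \<le> emeasure M (A k p) + ennreal e"
        using outer_regular_V[OF sA AV e] by blast
      define K where "K = {(n, i) \<in> first_nodes (\<lambda>i. S i \<subseteq> U).
        emeasure (density M h) (S i) \<le> ennreal \<alpha> * emeasure M (S i)}"
      define W where "W = (\<Union>\<kappa>\<in>K. S (snd \<kappa>))"
      have KF: "K \<subseteq> first_nodes (\<lambda>i. S i \<subseteq> U)" by (auto simp: K_def)
      have sW: "W \<in> sets M" unfolding W_def
      proof (rule sets.countable_UN'')
        show "countable K" using countable_first_nodes KF countable_subset by blast
        show "S (snd \<kappa>) \<in> sets M" if "\<kappa> \<in> K" for \<kappa>
          using that sets_S by (auto simp: K_def first_nodes_def)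
      qed
      have WU: "W \<subseteq> U" by (auto simp: W_def K_def first_nodes_def)
      have finU: "emeasure M U < \<infinity>" using U(4) fA
        by (metis ennreal_add_less_top ennreal_less_top infinity_ennreal_def order.strict_trans1)
      \<comment> \<open>A small node around \<open>x\<close> inside \<open>U\<close> lies in a
        maximal one. The average there cannot exceed \<open>\<alpha>\<close>, for then the node
        would sit inside a stopping node and \<open>x\<close> would lie in
        \<open>Om\<close>.\<close>
      have in_W: "x \<in> W" if xA: "x \<in> A k p" and "x \<in> good" for x
      proof -
        obtain n where n: "\<And>i. i \<in> Lev n \<Longrightarrow> x \<in> S i \<Longrightarrow> S i \<subseteq> U"
          using shrink[OF \<open>x \<in> good\<close> \<open>open U\<close>] xA U(3) by blast
        obtain i where i: "i \<in> Lev n" "x \<in> S i" using level_cover[OF \<open>x \<in> good\<close>] by blast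
        have "\<exists>(m, j)\<in>first_nodes (\<lambda>i. S i \<subseteq> U). S i \<subseteq> S j"
        proof (rule first_node_exists[where Q = "\<lambda>i. S i \<subseteq> U", OF i(1) n[OF i]])
          fix m j assume "j \<in> Lev m" "S j \<subseteq> U"
          then have "emeasure M (S j) \<le> emeasure M U" using U(2) by (intro emeasure_mono)
          also have "\<dots> = ennreal (measure M U)"
            using finU by (intro emeasure_eq_ennreal_measure) simp
          finally show "emeasure M (S j) \<le> ennreal (measure M U)" .
        qed
        then obtain m j where j: "(m, j) \<in> first_nodes (\<lambda>i. S i \<subseteq> U)" "S i \<subseteq> S j" by blast
        then have jL: "j \<in> Lev m" by (simp add: first_nodes_def)
        have "emeasure (density M h) (S j) \<le> ennreal \<alpha> * emeasure M (S j)"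
        proof (rule ccontr)
          assume "\<not> ?thesis"
          then obtain m' j' where "(m', j') \<in> stopping" "S j \<subseteq> S j'"
            using stopping_exists[OF jL] by (auto simp: not_le)
          then have "x \<in> Om" unfolding Om_def using i j by force
          then show False using xA by (simp add: A_def)
        qed
        then show ?thesis unfolding W_def K_def using j i by force
      qed
      have "ennreal (\<alpha> + 1 / real (Suc p)) * emeasure M (A k p) \<le> emeasure (density M h) (A k p)"
      proof -
        have "ennreal (\<alpha> + 1 / real (Suc p)) * emeasure M (A k p) =
            (\<integral>\<^sup>+x. ennreal (\<alpha> + 1 / real (Suc p)) * indicator (A k p) x \<partial>M)"
          using sA by (simp add: nn_integral_cmult_indicator)
        also have "\<dots> \<le> (\<integral>\<^sup>+x. h x * indicator (A k p) x \<partial>M)"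
          by (intro nn_integral_mono) (auto simp: A_def split: split_indicator)
        also have "\<dots> = emeasure (density M h) (A k p)"
          using sA by (simp add: emeasure_density)
        finally show ?thesis .
      qed
      also have "\<dots> \<le> emeasure (density M h) W"
      proof (rule emeasure_mono_AE)
        have "AE x in M. x \<in> A k p \<longrightarrow> x \<in> W"
          using AE_good by eventually_elim (use in_W in blast)
        then have "AE x in M. 0 < h x \<longrightarrow> x \<in> A k p \<longrightarrow> x \<in> W"
          by eventually_elim blast
        then show "AE x in density M h. x \<in> A k p \<longrightarrow> x \<in> W"
          using AE_density[OF h] by blast
      qed (use sW in auto)
      also have "\<dots> \<le> ennreal \<alpha> * emeasure M W"
        unfolding W_def by (rule first_nodes_emeasure_le[OF KF]) (auto simp: K_def)
      also have "\<dots> \<le> ennreal \<alpha> * (emeasure M (A k p) + ennreal e)"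
        using emeasure_mono[OF WU U(2)] U(4) by (intro mult_left_mono) auto
      finally show ?thesis .
    qed
    define a where "a = measure M (A k p)"
    have Ea: "emeasure M (A k p) = ennreal a" unfolding a_def
      using fA by (intro emeasure_eq_ennreal_measure) simp
    have a0: "0 \<le> a" by (simp add: a_def)
    have "a * (1 / real (Suc p)) / \<alpha> \<le> e" if "0 < e" for e
    proof -
      have "ennreal ((\<alpha> + 1 / real (Suc p)) * a) \<le> ennreal (\<alpha> * (a + e))"
        using main[OF that] a0 \<alpha> that unfolding Ea
        by (simp add: ennreal_mult flip: ennreal_plus)
      then have "(\<alpha> + 1 / real (Suc p)) * a \<le> \<alpha> * (a + e)"
        using a0 \<alpha> that by (subst (asm) ennreal_le_iff) auto
      then have "a * (1 / real (Suc p)) \<le> \<alpha> * e" by (simp only: algebra_simps)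
      then show ?thesis using \<alpha> by (simp add: divide_le_eq mult.commute mult.left_commute)
    qed
    then have "a * (1 / real (Suc p)) / \<alpha> \<le> 0"
      by (rule field_le_epsilon[where y = "0::real", simplified add_0])
    then have "a = 0" using a0 \<alpha> by (simp add: divide_le_0_iff mult_le_0_iff)
    then show ?thesis using Ea sA by (intro null_setsI) auto
  qed
  have "AE x in M. x \<notin> A k p" for k p using A_null by (rule AE_not_in)
  then have "AE x in M. \<forall>k p. x \<notin> A k p" by (simp only: AE_all_countable simp_thms)
  then show ?thesis
    unfolding Om_def[symmetric] using AE_space
  proof (eventually_elim, intro impI)
    fix x assume A: "\<forall>k p. x \<notin> A k p" and "x \<in> space M" "x \<notin> Om"
    then obtain k where "x \<in> V k" using V_cover by blast
    then have lt: "h x < ennreal (\<alpha> + 1 / real (Suc p))" for p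
      using A \<open>x \<notin> Om\<close> by (auto simp: A_def not_le)
    have "h x < \<infinity>" using lt[of 0] by (metis ennreal_less_top infinity_ennreal_def less_trans)
    then obtain y where y: "h x = ennreal y" "0 \<le> y"
      by (cases "h x") auto
    have "y \<le> \<alpha> + e" if e: "0 < e" for e
    proof -
      obtain p where "1 / real (Suc p) < e" using nat_approx_posE[OF e] .
      moreover have "y < \<alpha> + 1 / real (Suc p)"
        using lt[of p] y by (simp add: ennreal_less_iff)
      ultimately show ?thesis by linarith
    qed
    then show "h x \<le> ennreal \<alpha>" unfolding y by (rule ennreal_leI[OF field_le_epsilon])
  qed
qed

end

text \<open>\<open>X\<close> holds at most one extra node that must appear among the sets although
  it need not stop; the lower bound on \<open>L1_norm M f\<close> pays for its neighbourhood in (e).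
  The constant \<open>2 * (C + D)\<close> dominates every bound: \<open>C * \<alpha>\<close> for the
  averages, 2 for the norm of a function minus its average, \<open>D\<close> for the balls, and
  \<open>2 * D\<close> in (e), where the extra node is charged as much as all stopping nodes
  together.\<close>

lemma CZ_decomposition_exists:
  assumes d: "\<And>n i. i \<in> Lev n \<Longrightarrow> 0 < \<rho> i \<and> ctr i \<in> space M \<and>
      S i \<subseteq> {y \<in> space M. d (ctr i) y < D * \<rho> i} \<and>
      neighbourhood (space M) d (S i) (\<rho> i) \<in> sets M \<and>
      emeasure M (neighbourhood (space M) d (S i) (\<rho> i)) \<le> ennreal D * emeasure M (S i)"
    and D: "1 \<le> D" and f: "integrable M f" and \<alpha>: "0 < \<alpha>"
    and X: "finite X" "card X \<le> 1" "\<And>n i. (n, i) \<in> X \<Longrightarrow> i \<in> Lev n \<and> ennreal \<alpha> * emeasure M (S i) \<le> L1_norm M f"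
  shows "\<exists>J E r x g b. E ` J \<subseteq> S ` (\<Union>n. Lev n) \<and> S ` snd ` X \<subseteq> E ` J \<and>
    CZ_decomposition (space M) d M (2 * (C + D)) f \<alpha> J E r x g b"
proof -
  define h where "h = (\<lambda>x. ennreal (norm (f x)))"
  have fm [measurable]: "f \<in> borel_measurable M" using f by auto
  have hm: "h \<in> borel_measurable M" unfolding h_def by measurable
  have hf: "(\<integral>\<^sup>+x. h x \<partial>M) = L1_norm M f" by (simp add: h_def L1_norm_def)
  have hfin: "(\<integral>\<^sup>+x. h x \<partial>M) < \<infinity>"
    using f unfolding h_def integrable_iff_bounded by simp
  note st = hm hfin \<alpha>
  define K where "K = stopping h \<alpha>"
  define \<nu> where "\<nu> = density M h"
  define K1 where "K1 = K \<union> X"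
  define T where "T = (\<lambda>\<kappa>::int \<times> 'i. S (snd \<kappa>))"
  have K_Lev: "snd \<kappa> \<in> Lev (fst \<kappa>)" if "\<kappa> \<in> K1" for \<kappa>
    using that stopping_Lev[OF st, of "fst \<kappa>" "snd \<kappa>"] X(3)[of "fst \<kappa>" "snd \<kappa>"]
    unfolding K1_def K_def by auto
  have lower: "ennreal \<alpha> * emeasure M (T \<kappa>) \<le> emeasure \<nu> (T \<kappa>)"
    and upper: "emeasure \<nu> (T \<kappa>) \<le> ennreal (C * \<alpha>) * emeasure M (T \<kappa>)" if "\<kappa> \<in> K" for \<kappa>
    using that stopping_lower[OF st, of "fst \<kappa>" "snd \<kappa>"] stopping_upper[OF st, of "fst \<kappa>" "snd \<kappa>"]
    unfolding K_def \<nu>_def T_def by auto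
  have cK: "countable K" using countable_first_nodes by (simp add: K_def stopping_def[OF st])
  have cK1: "countable K1" using cK X(1) by (simp add: K1_def countable_finite)
  have disj: "disjoint_family_on T K"
    unfolding K_def stopping_def[OF st] T_def by (rule disjoint_family_first_nodes)
  have T_eq: "\<kappa> = \<kappa>'" if "\<kappa> \<in> K" "\<kappa>' \<in> K" "y \<in> T \<kappa>" "y \<in> T \<kappa>'" for \<kappa> \<kappa>' y
    using disjoint_family_onD[OF disj that(1,2)] that(3,4) by blast
  have sT [measurable]: "T \<kappa> \<in> sets M" if "\<kappa> \<in> K1" for \<kappa>
    using sets_S[OF K_Lev[OF that]] by (simp add: T_def)
  have finT: "emeasure M (T \<kappa>) < \<infinity>" and posT: "0 < emeasure M (T \<kappa>)" if "\<kappa> \<in> K1" for \<kappa>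
    using emeasure_S_finite[OF K_Lev[OF that]] emeasure_S_pos[OF K_Lev[OF that]] by (auto simp: T_def)
  have mT: "emeasure M (T \<kappa>) = ennreal (measure M (T \<kappa>))" "0 < measure M (T \<kappa>)" if "\<kappa> \<in> K1" for \<kappa>
  proof -
    show e: "emeasure M (T \<kappa>) = ennreal (measure M (T \<kappa>))"
      using finT[OF that] by (intro emeasure_eq_ennreal_measure) simp
    show "0 < measure M (T \<kappa>)" using posT[OF that] unfolding e by simp
  qed
  have KK1: "\<kappa> \<in> K1" if "\<kappa> \<in> K" for \<kappa> using that by (simp add: K1_def)
  have sum_\<nu>: "(\<Sum>\<kappa>\<in>F. emeasure \<nu> (T \<kappa>)) \<le> L1_norm M f" if "finite F" "F \<subseteq> K" for F
  proof -
    have "(\<Sum>\<kappa>\<in>F. emeasure \<nu> (T \<kappa>)) = emeasure \<nu> (\<Union>\<kappa>\<in>F. T \<kappa>)"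
      using that disj sT KK1
      by (intro sum_emeasure) (auto simp: \<nu>_def intro: disjoint_family_on_mono)
    also have "\<dots> \<le> L1_norm M f"
      unfolding \<nu>_def hf[symmetric] by (rule emeasure_density_le[OF st])
    finally show ?thesis .
  qed
  define avg where "avg = (\<lambda>\<kappa>. (LINT y:T \<kappa>|M. f y) /\<^sub>R measure M (T \<kappa>))"
  \<comment> \<open>An extra node receives the zero function, unless it happens to be a stopping
    node.\<close>
  define B where "B = (\<lambda>\<kappa> y. if \<kappa> \<in> K then indicator (T \<kappa>) y *\<^sub>R (f y - avg \<kappa>) else 0)"
  define g where "g = (\<lambda>y. if \<exists>\<kappa>\<in>K. y \<in> T \<kappa> then avg (THE \<kappa>. \<kappa> \<in> K \<and> y \<in> T \<kappa>) else f y)"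
  have g_on: "g y = avg \<kappa>" if "\<kappa> \<in> K" "y \<in> T \<kappa>" for y \<kappa>
  proof -
    have "(THE \<kappa>. \<kappa> \<in> K \<and> y \<in> T \<kappa>) = \<kappa>" using that T_eq by blast
    then show ?thesis using that by (auto simp: g_def)
  qed
  have \<nu>T: "emeasure \<nu> (T \<kappa>) = (\<integral>\<^sup>+y. norm (indicator (T \<kappa>) y *\<^sub>R f y) \<partial>M)" if "\<kappa> \<in> K1" for \<kappa>
    unfolding \<nu>_def using hm sT[OF that]
    by (subst emeasure_density) (auto intro!: nn_integral_cong simp: h_def split: split_indicator)
  have fi: "integrable M (\<lambda>y. indicator (T \<kappa>) y *\<^sub>R f y)" if "\<kappa> \<in> K1" for \<kappa>
    using f sT[OF that] by (intro integrable_mult_indicator)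
  have ind: "integrable M (\<lambda>y. indicator (T \<kappa>) y *\<^sub>R w)" if "\<kappa> \<in> K1" for \<kappa> and w :: complex
    using sT[OF that] finT[OF that] by (intro integrable_scaleR_left integrable_real_indicator) auto
  have norm_avg: "ennreal (norm (avg \<kappa>)) * emeasure M (T \<kappa>) \<le> emeasure \<nu> (T \<kappa>)" if "\<kappa> \<in> K1" for \<kappa>
  proof -
    have "ennreal (norm (avg \<kappa>)) * emeasure M (T \<kappa>) = ennreal (norm (LINT y:T \<kappa>|M. f y))"
      using mT[OF that] by (simp add: avg_def mT(1) ennreal_mult[symmetric])
    also have "\<dots> \<le> emeasure \<nu> (T \<kappa>)"
      unfolding \<nu>T[OF that] set_lebesgue_integral_def
      by (rule integral_norm_bound_ennreal[OF fi[OF that]])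
    finally show ?thesis .
  qed
  have avg_le: "norm (avg \<kappa>) \<le> C * \<alpha>" if "\<kappa> \<in> K" for \<kappa>
  proof -
    have "ennreal (norm (avg \<kappa>)) * emeasure M (T \<kappa>) \<le> ennreal (C * \<alpha>) * emeasure M (T \<kappa>)"
      using norm_avg[OF KK1[OF that]] upper[OF that] by (rule order_trans)
    then have "ennreal (norm (avg \<kappa>) * measure M (T \<kappa>)) \<le> ennreal (C * \<alpha> * measure M (T \<kappa>))"
      using mT[OF KK1[OF that]] C_ge_1 \<alpha> by (simp add: mT(1) ennreal_mult)
    then have "norm (avg \<kappa>) * measure M (T \<kappa>) \<le> C * \<alpha> * measure M (T \<kappa>)"
      using C_ge_1 \<alpha> by (subst (asm) ennreal_le_iff) auto
    then show ?thesis using mT(2)[OF KK1[OF that]] by simp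
  qed
  have B_eq: "B \<kappa> = (\<lambda>y. indicator (T \<kappa>) y *\<^sub>R f y - indicator (T \<kappa>) y *\<^sub>R avg \<kappa>)" if "\<kappa> \<in> K" for \<kappa>
    using that by (simp add: B_def fun_eq_iff scaleR_diff_right)
  have Bi: "integrable M (B \<kappa>)" for \<kappa>
  proof (cases "\<kappa> \<in> K")
    case True
    show ?thesis unfolding B_eq[OF True]
      by (intro Bochner_Integration.integrable_diff fi ind KK1 True)
  qed (simp add: B_def)
  have B_norm: "L1_norm M (B \<kappa>) \<le> (if \<kappa> \<in> K then 2 * emeasure \<nu> (T \<kappa>) else 0)" if "\<kappa> \<in> K1" for \<kappa>
  proof (cases "\<kappa> \<in> K")
    case True
    note sT[OF that, measurable]
    have "L1_norm M (B \<kappa>) \<le> (\<integral>\<^sup>+y. ennreal (norm (indicator (T \<kappa>) y *\<^sub>R f y)) +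
        ennreal (norm (avg \<kappa>)) * indicator (T \<kappa>) y \<partial>M)"
      unfolding L1_norm_def B_eq[OF True]
      by (intro nn_integral_mono)
        (auto split: split_indicator simp: norm_triangle_ineq4 simp flip: ennreal_plus)
    also have "\<dots> = emeasure \<nu> (T \<kappa>) + ennreal (norm (avg \<kappa>)) * emeasure M (T \<kappa>)"
      using sT[OF that] by (subst nn_integral_add) (auto simp: \<nu>T[OF that] nn_integral_cmult_indicator)
    also have "\<dots> \<le> emeasure \<nu> (T \<kappa>) + emeasure \<nu> (T \<kappa>)"
      using norm_avg[OF that] by (rule add_left_mono)
    finally show ?thesis using True by (simp add: mult_2)
  qed (simp add: B_def L1_norm_def)
  have B_mean: "(LINT y:T \<kappa>|M. B \<kappa> y) = 0" if "\<kappa> \<in> K1" for \<kappa>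
  proof (cases "\<kappa> \<in> K")
    case True
    have "(LINT y:T \<kappa>|M. B \<kappa> y) = (LINT y|M. indicator (T \<kappa>) y *\<^sub>R f y - indicator (T \<kappa>) y *\<^sub>R avg \<kappa>)"
      unfolding set_lebesgue_integral_def B_eq[OF True]
      by (intro Bochner_Integration.integral_cong) (auto split: split_indicator)
    also have "\<dots> = (LINT y:T \<kappa>|M. f y) - measure M (T \<kappa>) *\<^sub>R avg \<kappa>"
      using fi[OF that] ind[OF that] sT[OF that] finT[OF that]
      by (subst Bochner_Integration.integral_diff)
        (auto simp: set_lebesgue_integral_def integral_scaleR_left integrable_real_indicator
          sets.Int_space_eq2 Int_absorb1 sets.sets_into_space)
    also have "\<dots> = 0" using mT(2)[OF that] by (simp add: avg_def)
    finally show ?thesis .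
  qed (simp add: B_def set_lebesgue_integral_def)
  \<comment> \<open>The stopping nodes are disjoint, so at each point at most one summand is
    nonzero.\<close>
  have has_sum: "((\<lambda>\<kappa>. B \<kappa> y) has_sum (f y - g y)) K1" for y
  proof (cases "\<exists>\<kappa>\<in>K. y \<in> T \<kappa>")
    case True
    then obtain \<kappa> where \<kappa>: "\<kappa> \<in> K" "y \<in> T \<kappa>" by blast
    have "((\<lambda>\<kappa>. B \<kappa> y) has_sum (\<Sum>\<kappa>\<in>{\<kappa>}. B \<kappa> y)) {\<kappa>}" by (rule has_sum_finite) simp
    then have "((\<lambda>\<kappa>. B \<kappa> y) has_sum (f y - g y)) {\<kappa>}" using \<kappa> by (simp add: B_def g_on)
    moreover have "B \<kappa>' y = 0" if "\<kappa>' \<noteq> \<kappa>" for \<kappa>'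
    proof (cases "\<kappa>' \<in> K")
      case True
      then have "y \<notin> T \<kappa>'" using that T_eq[OF _ \<kappa>(1) _ \<kappa>(2)] by blast
      then show ?thesis by (simp add: B_def)
    qed (simp add: B_def)
    ultimately show ?thesis
      using KK1[OF \<kappa>(1)] by (subst has_sum_cong_neutral[where T = "{\<kappa>}" and g = "\<lambda>\<kappa>. B \<kappa> y"]) auto
  next
    case False
    then have "f y - g y = 0" by (simp add: g_def)
    moreover have "((\<lambda>\<kappa>. B \<kappa> y) has_sum 0) K1" using False by (intro has_sum_0) (auto simp: B_def)
    ultimately show ?thesis by simp
  qed
  define Om where "Om = (\<Union>\<kappa>\<in>K. T \<kappa>)"
  have g_meas: "g \<in> borel_measurable M"
  \<comment> \<open>\<open>g\<close> equals \<open>f\<close> off \<open>Om\<close> and is constant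
    on each of countably many nodes.\<close>
  proof (rule measurable_piecewise_restrict[where C = "insert (space M - Om) (T ` K)"])
    show "countable (insert (space M - Om) (T ` K))" using cK by simp
    have "Om \<in> sets M" unfolding Om_def using cK sT KK1 by (intro sets.countable_UN'') auto
    then show "\<Omega> \<inter> space M \<in> sets M" if "\<Omega> \<in> insert (space M - Om) (T ` K)" for \<Omega>
      using that sT KK1 by auto
    show "space M \<subseteq> \<Union> (insert (space M - Om) (T ` K))" by (auto simp: Om_def)
    fix \<Omega> assume "\<Omega> \<in> insert (space M - Om) (T ` K)"
    then consider "\<Omega> = space M - Om" | \<kappa> where "\<kappa> \<in> K" "\<Omega> = T \<kappa>" by blast
    then show "g \<in> borel_measurable (restrict_space M \<Omega>)"
    proof cases
      case 1
      have "f \<in> borel_measurable (restrict_space M \<Omega>)" by (rule measurable_restrict_space1) simp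
      then show ?thesis
        by (rule measurable_cong[THEN iffD1, rotated]) (auto simp: 1 space_restrict_space g_def Om_def)
    next
      case 2
      have "(\<lambda>_. avg \<kappa>) \<in> borel_measurable (restrict_space M \<Omega>)" by simp
      then show ?thesis
        by (rule measurable_cong[THEN iffD1, rotated]) (auto simp: 2 space_restrict_space g_on[OF 2(1)])
    qed
  qed
  have g_le: "AE y in M. norm (g y) \<le> 2 * (C + D) * \<alpha>"
    using AE_le_off_stopping[OF st]
  proof eventually_elim
    case (elim y)
    have le: "C * \<alpha> \<le> 2 * (C + D) * \<alpha>" "\<alpha> \<le> 2 * (C + D) * \<alpha>"
      using C_ge_1 D \<alpha> by (auto simp: algebra_simps intro: order_trans[of _ "C * \<alpha>"])
    show ?case
    proof (cases "\<exists>\<kappa>\<in>K. y \<in> T \<kappa>")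
      case True
      then show ?thesis using g_on avg_le le by (metis order_trans)
    next
      case False
      then have "norm (f y) \<le> \<alpha>"
        using elim \<alpha> by (auto simp: h_def K_def T_def ennreal_le_iff)
      then show ?thesis using False le by (simp add: g_def)
    qed
  qed
  \<comment> \<open>\<open>CZ_decomposition\<close> indexes by natural numbers; \<open>K1\<close> is
    countable and may be finite or empty.\<close>
  define J where "J = to_nat_on K1 ` K1"
  define k where "k = from_nat_into K1"
  have kJ: "k ` J = K1" and inj: "inj_on k J"
    using cK1 unfolding J_def k_def
    by (auto simp: image_image inj_on_def)
  have k_in: "j \<in> J \<Longrightarrow> k j \<in> K1" for j using kJ by blast
  have infsum_le: "(\<Sum>\<^sub>\<infinity>j\<in>J. \<Phi> (k j)) \<le> b"
    if b: "\<And>F. finite F \<Longrightarrow> F \<subseteq> K1 \<Longrightarrow> sum \<Phi> F \<le> b" for \<Phi> and b :: ennreal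
  proof (rule infsum_le_finite_sums)
    fix F assume F: "finite F" "F \<subseteq> J"
    have "(\<Sum>j\<in>F. \<Phi> (k j)) = sum \<Phi> (k ` F)"
      using F inj by (subst sum.reindex) (auto intro: inj_on_subset)
    also have "\<dots> \<le> b" using F kJ by (intro b) auto
    finally show "(\<Sum>j\<in>F. \<Phi> (k j)) \<le> b" .
  qed (simp add: nonneg_summable_on_complete)
  have c: "(\<Sum>\<^sub>\<infinity>j\<in>J. L1_norm M (B (k j))) \<le> ennreal (2 * (C + D)) * L1_norm M f"
  proof (rule infsum_le)
    fix F assume F: "finite F" "F \<subseteq> K1"
    have "(\<Sum>\<kappa>\<in>F. L1_norm M (B \<kappa>)) \<le> (\<Sum>\<kappa>\<in>F. if \<kappa> \<in> K then 2 * emeasure \<nu> (T \<kappa>) else 0)"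
      using F(2) by (intro sum_mono B_norm) blast
    also have "\<dots> = (\<Sum>\<kappa>\<in>F \<inter> K. 2 * emeasure \<nu> (T \<kappa>))"
      using F(1) by (simp add: sum.inter_restrict)
    also have "\<dots> = 2 * (\<Sum>\<kappa>\<in>F \<inter> K. emeasure \<nu> (T \<kappa>))" by (rule sum_distrib_left[symmetric])
    also have "\<dots> \<le> ennreal 2 * L1_norm M f"
      using F sum_\<nu>[of "F \<inter> K"] by (auto intro: mult_left_mono)
    also have "\<dots> \<le> ennreal (2 * (C + D)) * L1_norm M f"
      using C_ge_1 D by (intro mult_right_mono ennreal_leI) auto
    finally show "(\<Sum>\<kappa>\<in>F. L1_norm M (B \<kappa>)) \<le> ennreal (2 * (C + D)) * L1_norm M f" .
  qed
  have e: "(\<Sum>\<^sub>\<infinity>j\<in>J. emeasure M (neighbourhood (space M) d (T (k j)) (\<rho> (snd (k j)))))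
      \<le> ennreal (2 * (C + D) / \<alpha>) * L1_norm M f"
  proof (rule infsum_le)
    let ?N = "\<lambda>\<kappa>. emeasure M (neighbourhood (space M) d (T \<kappa>) (\<rho> (snd \<kappa>)))"
    have div: "x \<le> ennreal (1 / \<alpha>) * y" if "ennreal \<alpha> * x \<le> y" for x y
    proof -
      have "x = ennreal (1 / \<alpha>) * (ennreal \<alpha> * x)"
        using \<alpha> by (simp add: mult.assoc[symmetric] ennreal_mult[symmetric])
      also have "\<dots> \<le> ennreal (1 / \<alpha>) * y" using that by (rule mult_left_mono) simp
      finally show ?thesis .
    qed
    have N: "?N \<kappa> \<le> ennreal D * emeasure M (T \<kappa>)" if "\<kappa> \<in> K1" for \<kappa>
      using d[OF K_Lev[OF that]] by (simp add: T_def)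
    fix F assume F: "finite F" "F \<subseteq> K1"
    \<comment> \<open>The stopping nodes, and separately the at most one extra node, are each
      charged to the whole norm of \<open>f\<close>.\<close>
    have "sum ?N F = sum ?N (F \<inter> K) + sum ?N (F - K)"
      using F(1) by (rule sum.Int_Diff)
    also have "\<dots> \<le> ennreal D * (ennreal (1 / \<alpha>) * L1_norm M f) + ennreal D * (ennreal (1 / \<alpha>) * L1_norm M f)"
    proof (rule add_mono)
      have "sum ?N (F \<inter> K) \<le> (\<Sum>\<kappa>\<in>F \<inter> K. ennreal D * (ennreal (1 / \<alpha>) * emeasure \<nu> (T \<kappa>)))"
      proof (rule sum_mono)
        fix \<kappa> assume \<kappa>: "\<kappa> \<in> F \<inter> K"
        have "?N \<kappa> \<le> ennreal D * emeasure M (T \<kappa>)" using \<kappa> N KK1 by simp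
        also have "\<dots> \<le> ennreal D * (ennreal (1 / \<alpha>) * emeasure \<nu> (T \<kappa>))"
          using \<kappa> lower by (intro mult_left_mono div) auto
        finally show "?N \<kappa> \<le> ennreal D * (ennreal (1 / \<alpha>) * emeasure \<nu> (T \<kappa>))" .
      qed
      also have "\<dots> = ennreal D * (ennreal (1 / \<alpha>) * (\<Sum>\<kappa>\<in>F \<inter> K. emeasure \<nu> (T \<kappa>)))"
        by (simp only: sum_distrib_left)
      also have "\<dots> \<le> ennreal D * (ennreal (1 / \<alpha>) * L1_norm M f)"
        using F sum_\<nu>[of "F \<inter> K"] by (intro mult_left_mono) auto
      finally show "sum ?N (F \<inter> K) \<le> ennreal D * (ennreal (1 / \<alpha>) * L1_norm M f)" .
      have FX: "F - K \<subseteq> X" using F by (auto simp: K1_def)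
      then have "card (F - K) \<le> 1" using card_mono[OF X(1)] X(2) by (meson order_trans)
      moreover have "finite (F - K)" using F by simp
      ultimately consider "F - K = {}" | \<kappa> where "F - K = {\<kappa>}"
        by (metis card_0_eq card_1_singletonE le_Suc_eq le_zero_eq One_nat_def)
      then show "sum ?N (F - K) \<le> ennreal D * (ennreal (1 / \<alpha>) * L1_norm M f)"
      proof cases
        case 2
        then have \<kappa>: "\<kappa> \<in> X" using FX by blast
        then have "\<kappa> \<in> K1" by (simp add: K1_def)
        have "?N \<kappa> \<le> ennreal D * emeasure M (T \<kappa>)" using N \<open>\<kappa> \<in> K1\<close> .
        also have "\<dots> \<le> ennreal D * (ennreal (1 / \<alpha>) * L1_norm M f)"
          using X(3)[of "fst \<kappa>" "snd \<kappa>"] \<kappa> by (intro mult_left_mono div) (auto simp: T_def)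
        finally show ?thesis using 2 by simp
      next
        case 1
        show ?thesis unfolding 1 by simp
      qed
    qed
    also have "\<dots> = ennreal (2 * D / \<alpha>) * L1_norm M f"
    proof -
      have "ennreal (2 * D / \<alpha>) = ennreal D * ennreal (1 / \<alpha>) + ennreal D * ennreal (1 / \<alpha>)"
        using D \<alpha> by (simp add: ennreal_mult[symmetric] flip: ennreal_plus)
      then show ?thesis by (simp add: distrib_right mult.assoc)
    qed
    also have "\<dots> \<le> ennreal (2 * (C + D) / \<alpha>) * L1_norm M f"
      using C_ge_1 D \<alpha> by (intro mult_right_mono ennreal_leI divide_right_mono) auto
    finally show "sum ?N F \<le> ennreal (2 * (C + D) / \<alpha>) * L1_norm M f" .
  qed
  have "CZ_decomposition (space M) d M (2 * (C + D)) f \<alpha> J (\<lambda>j. T (k j)) (\<lambda>j. \<rho> (snd (k j)))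
      (\<lambda>j. ctr (snd (k j))) g (\<lambda>j. B (k j))"
    unfolding CZ_decomposition_def
  proof (intro conjI ballI)
    fix j assume j: "j \<in> J"
    note L = d[OF K_Lev[OF k_in[OF j]]]
    show "T (k j) \<in> sets M" using sT k_in j by blast
    show "0 < \<rho> (snd (k j))" "ctr (snd (k j)) \<in> space M" using L by auto
    show "integrable M (B (k j))" by (rule Bi)
    show "B (k j) y = 0" if "y \<in> space M - T (k j)" for y using that by (simp add: B_def)
    show "(LINT y:T (k j)|M. B (k j) y) = 0" using B_mean k_in j by blast
    have "D * \<rho> (snd (k j)) \<le> 2 * (C + D) * \<rho> (snd (k j))"
      using L C_ge_1 D by (intro mult_right_mono) auto
    then have "{y \<in> space M. d (ctr (snd (k j))) y < D * \<rho> (snd (k j))} \<subseteq>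
        {y \<in> space M. d (ctr (snd (k j))) y < 2 * (C + D) * \<rho> (snd (k j))}"
      by (auto intro: less_le_trans)
    then show "T (k j) \<subseteq> {y \<in> space M. d (ctr (snd (k j))) y < 2 * (C + D) * \<rho> (snd (k j))}"
      using L unfolding T_def by blast
    show "neighbourhood (space M) d (T (k j)) (\<rho> (snd (k j))) \<in> sets M"
      using L by (simp add: T_def)
  next
    have "((\<lambda>j. B (k j) y) has_sum f y - g y) J" for y
      using has_sum[of y] unfolding kJ[symmetric] by (simp add: has_sum_reindex[OF inj] o_def)
    then show "AE y in M. ((\<lambda>j. B (k j) y) has_sum f y - g y) J" by simp
  qed (fact g_meas g_le c e)+
  moreover have "(\<lambda>j. T (k j)) ` J = T ` K1" using kJ by (simp add: image_image[symmetric])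
  moreover have "T ` K1 \<subseteq> S ` (\<Union>n. Lev n)" using K_Lev unfolding T_def by blast
  moreover have "S ` snd ` X \<subseteq> T ` K1" by (auto simp: T_def K1_def image_image)
  ultimately show ?thesis by metis
qed

text \<open>A node is selected by the decomposition of its own indicator function at height 1, to which it
  is added with a vanishing bad part; so the whole family is exhausted.\<close>

theorem has_CZP_wrt_levels:
  assumes "\<And>n i. i \<in> Lev n \<Longrightarrow> 0 < \<rho> i \<and> ctr i \<in> space M \<and>
      S i \<subseteq> {y \<in> space M. d (ctr i) y < D * \<rho> i} \<and>
      neighbourhood (space M) d (S i) (\<rho> i) \<in> sets M \<and>
      emeasure M (neighbourhood (space M) d (S i) (\<rho> i)) \<le> ennreal D * emeasure M (S i)"
    and D: "1 \<le> D" and inf: "emeasure M (space M) = \<infinity>"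
  shows "has_CZP_wrt (space M) d M (S ` (\<Union>n. Lev n))"
proof -
  note ex = CZ_decomposition_exists[of \<rho> ctr d D, OF assms(1) D]
  let ?E = "S ` (\<Union>n. Lev n)"
  let ?CZ = "\<lambda>f \<alpha> \<E>. \<exists>J E r x g b. \<E> = E ` J \<and> CZ_decomposition (space M) d M (2 * (C + D)) f \<alpha> J E r x g b"
  \<comment> \<open>The set can be recovered from \<open>indicator P\<close>, so a single choice of
    a decomposition for each pair \<open>(f, \<alpha>)\<close> can serve every node.\<close>
  define special where "special = (\<lambda>(f::'a \<Rightarrow> complex) \<alpha> P. P \<in> ?E \<and> f = indicator P \<and> \<alpha> = (1::real))"
  have special_unique: "P = P'" if "special f \<alpha> P" "special f \<alpha> P'" for f \<alpha> P P'
  proof -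
    have "(indicator P :: 'a \<Rightarrow> complex) = indicator P'" using that by (simp add: special_def)
    then have "(indicator P x :: complex) = indicator P' x" for x by (rule fun_cong)
    then show "P = P'" by (simp add: indicator_eq_0_iff indicator_def of_bool_eq_iff set_eq_iff)
  qed
  have "\<exists>\<E>. ?CZ f \<alpha> \<E> \<and> \<E> \<subseteq> ?E \<and> (\<forall>P. special f \<alpha> P \<longrightarrow> P \<in> \<E>)"
    if f: "integrable M f" "0 < \<alpha>" for f \<alpha>
  proof (cases "\<exists>P. special f \<alpha> P")
    case True
    then obtain P where P: "special f \<alpha> P" by blast
    then obtain n i where "i \<in> Lev n" "P = S i" by (auto simp: special_def)
    then have i: "i \<in> Lev n" "special f \<alpha> (S i)" using P by auto
    then have f_eq: "f = indicator (S i)" "\<alpha> = 1" by (auto simp: special_def)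
    have L1: "L1_norm M f = emeasure M (S i)"
    proof -
      have "L1_norm M f = (\<integral>\<^sup>+x. indicator (S i) x \<partial>M)"
        unfolding L1_norm_def f_eq(1) by (intro nn_integral_cong) (auto split: split_indicator)
      then show ?thesis using sets_S[OF i(1)] by simp
    qed
    \<comment> \<open>The average of the indicator over \<open>S i\<close> is exactly 1, so
      \<open>i\<close> is not a stopping node at height 1. As the extra node it meets the
      requirement on \<open>L1_norm M f\<close> with equality.\<close>
    have "\<exists>J E r x g b. E ` J \<subseteq> ?E \<and> S ` snd ` {(n, i)} \<subseteq> E ` J \<and>
        CZ_decomposition (space M) d M (2 * (C + D)) f \<alpha> J E r x g b"
      by (rule ex[OF _ f]) (use i(1) f_eq(2) L1 in auto)
    then obtain J E r x g b where E: "E ` J \<subseteq> ?E" "S ` snd ` {(n, i)} \<subseteq> E ` J"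
        "CZ_decomposition (space M) d M (2 * (C + D)) f \<alpha> J E r x g b"
      by (elim exE conjE)
    have "P \<in> E ` J" if "special f \<alpha> P" for P
      using special_unique[OF that i(2)] E(2) by simp
    moreover have "?CZ f \<alpha> (E ` J)" using E(3) by (intro exI conjI) (rule refl)
    ultimately show ?thesis using E(1) by (intro exI[of _ "E ` J"]) simp
  next
    case False
    have "\<exists>J E r x g b. E ` J \<subseteq> ?E \<and> S ` snd ` ({} :: (int \<times> 'i) set) \<subseteq> E ` J \<and>
        CZ_decomposition (space M) d M (2 * (C + D)) f \<alpha> J E r x g b"
      by (rule ex[OF _ f]) auto
    then obtain J E r x g b where E: "E ` J \<subseteq> ?E"
        "CZ_decomposition (space M) d M (2 * (C + D)) f \<alpha> J E r x g b"
      by (elim exE conjE)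
    have "?CZ f \<alpha> (E ` J)" using E(2) by (intro exI conjI) (rule refl)
    then show ?thesis using E(1) False by (intro exI[of _ "E ` J"]) simp
  qed
  then obtain F where F: "\<And>f \<alpha>. integrable M f \<Longrightarrow> 0 < \<alpha> \<Longrightarrow>
      ?CZ f \<alpha> (F f \<alpha>) \<and> F f \<alpha> \<subseteq> ?E \<and> (\<forall>P. special f \<alpha> P \<longrightarrow> P \<in> F f \<alpha>)"
    by metis
  have ind: "integrable M (indicator (S i) :: 'a \<Rightarrow> complex)" if "i \<in> Lev n" for i n
  proof -
    have "integrable M (\<lambda>x. indicator (S i) x *\<^sub>R (1 :: complex))"
      using sets_S[OF that] emeasure_S_finite[OF that]
      by (intro integrable_scaleR_left integrable_real_indicator) auto
    moreover have "(\<lambda>x. indicator (S i) x *\<^sub>R (1 :: complex)) = indicator (S i)"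
      by (auto split: split_indicator)
    ultimately show ?thesis by simp
  qed
  have "?E = {E. \<exists>f \<alpha>. integrable M f \<and> \<alpha> > 0 \<and> E \<in> F f \<alpha>}"
  proof (intro equalityI subsetI)
    fix P assume P: "P \<in> ?E"
    then have "special (indicator P) 1 P" by (simp add: special_def)
    moreover have "integrable M (indicator P :: 'a \<Rightarrow> complex)" using P ind by blast
    ultimately show "P \<in> {E. \<exists>f \<alpha>. integrable M f \<and> \<alpha> > 0 \<and> E \<in> F f \<alpha>}"
      using F[of "indicator P" 1] by (metis (mono_tags, lifting) mem_Collect_eq zero_less_one)
  qed (use F in blast)
  moreover have "\<forall>f \<alpha>. integrable M f \<longrightarrow> \<alpha> > 0 \<longrightarrow> ?CZ f \<alpha> (F f \<alpha>)" using F by blast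
  moreover have "1 \<le> 2 * (C + D)" using C_ge_1 D by simp
  ultimately show ?thesis
    unfolding has_CZP_wrt_def using inf by blast
qed

end

section \<open>Admissibility in logarithmic parameters\<close>

text \<open>With $s = \ln r$ and $D = \delta^k / a$, admissibility of $P_{r,Q}(a)$ depends on \<open>s\<close> and
  \<open>D\<close> only.\<close>

definition log_admissible :: "real \<Rightarrow> real \<Rightarrow> real \<Rightarrow> real \<Rightarrow> bool" where
  "log_admissible lam \<gamma> s D \<longleftrightarrow>
    (1 < s \<and> exp (2 * s) \<le> D \<and> D \<le> lam * exp (\<gamma> * s)) \<or>
    (0 < s \<and> s \<le> 1 \<and> exp 2 * s \<le> D \<and> D \<le> lam * exp 2 * s)"

lemma large_admissible_iff:
  assumes "0 < r" "0 < a"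
  shows "large_admissible \<Q> \<delta> lam \<gamma> (r, (k, Q), a) \<longleftrightarrow> Q \<in> \<Q> k \<and> 1 < ln r \<and>
    exp (2 * ln r) \<le> \<delta> powi k / a \<and> \<delta> powi k / a \<le> lam * exp (\<gamma> * ln r)"
proof -
  have "exp 1 < r \<longleftrightarrow> 1 < ln r" using assms by (metis exp_less_cancel_iff exp_ln)
  moreover have "exp (2 * ln r) = r ^ 2"
    using assms by (simp add: exp_double)
  moreover have "exp (\<gamma> * ln r) = r powr \<gamma>" using assms by (simp add: powr_def)
  ultimately show ?thesis using assms by (auto simp: field_simps)
qed

lemma admissible_iff:
  assumes "0 < r" "0 < a"
  shows "admissible \<Q> \<delta> lam \<gamma> (r, (k, Q), a) \<longleftrightarrow>
    Q \<in> \<Q> k \<and> log_admissible lam \<gamma> (ln r) (\<delta> powi k / a)"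
proof -
  have "r \<le> exp 1 \<longleftrightarrow> ln r \<le> 1" using assms by (metis exp_le_cancel_iff exp_ln)
  then have "small_admissible \<Q> \<delta> lam (r, (k, Q), a) \<longleftrightarrow> Q \<in> \<Q> k \<and> 0 < ln r \<and> ln r \<le> 1 \<and>
    exp 2 * ln r \<le> \<delta> powi k / a \<and> \<delta> powi k / a \<le> lam * exp 2 * ln r"
    using assms by (auto simp: field_simps)
  then show ?thesis
    using large_admissible_iff[OF assms, of \<Q> \<delta> lam \<gamma> k Q]
    unfolding admissible_def log_admissible_def by blast
qed

lemma admissible_pos:
  assumes "admissible \<Q> \<delta> lam \<gamma> (r, (k, Q), a)"
  shows "1 < r" "0 < a" "Q \<in> \<Q> k"
proof -
  have "1 < exp (1 :: real)" by simp
  then show "1 < r"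
    using assms less_trans[of 1 "exp 1" r] unfolding admissible_def by auto
qed (use assms in \<open>auto simp: admissible_def\<close>)

lemma exp_half_le_2: "s \<le> 1 \<Longrightarrow> exp (s / 2) \<le> (2 :: real)"
proof -
  assume "s \<le> 1"
  have "(exp (1 / 2 :: real))\<^sup>2 = exp 1" by (simp flip: exp_double)
  also have "\<dots> \<le> 2\<^sup>2" using exp_le by simp
  finally have "exp (1 / 2 :: real) \<le> 2" by (rule power2_le_imp_le) simp
  moreover have "exp (s / 2) \<le> exp (1 / 2)" using \<open>s \<le> 1\<close> by simp
  ultimately show ?thesis by linarith
qed

text \<open>If the two vertical halves of an admissible cylinder are not both admissible, then its base is
  so large compared to its height that one can pass to the next generation of cubes.\<close>

lemma log_admissible_sons:
  assumes \<delta>: "0 < \<delta>" "\<delta> < 1" and lam: "exp 3 / \<delta> < lam" and \<gamma>: "5 \<le> \<gamma>"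
    and adm: "log_admissible lam \<gamma> s D"
    and not: "\<not> (log_admissible lam \<gamma> (s / 2) (D * exp (s / 2)) \<and>
      log_admissible lam \<gamma> (s / 2) (D * exp (- (s / 2))))"
  shows "log_admissible lam \<gamma> s (\<delta> * D)"
proof -
  have lam\<delta>: "exp 3 < \<delta> * lam" using \<delta> lam by (simp add: field_simps)
  have lam0: "0 < lam" using \<delta> lam by (meson divide_pos_pos exp_gt_zero less_trans)
  have s0: "0 < s" and D0: "0 < D"
    using adm by (auto simp: log_admissible_def intro: less_le_trans[OF exp_gt_zero] less_le_trans[rotated])
  have E1: "1 \<le> exp (s / 2)" and E2: "exp (- (s / 2)) \<le> 1" using s0 by simp_all
  have \<delta>D: "\<delta> * D \<le> D" using \<delta> D0 by simp
  \<comment> \<open>When an upper bound fails for the half with parameter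
    \<open>D * exp (s / 2)\<close>, the inequality \<open>exp 3 < \<delta> * lam\<close> turns this
    into a lower bound for \<open>\<delta> * D\<close>. That is the only bound left to prove, since
    \<open>\<delta> * D \<le> D\<close> takes care of the upper one.\<close>
  have big: "exp 3 * b < \<delta> * D" if "lam * b < D * exp (s / 2) * exp (- (s / 2))" "0 \<le> b" for b
  proof -
    have "exp 3 * b \<le> \<delta> * lam * b" using lam\<delta> that(2) by (intro mult_right_mono) auto
    also have "\<dots> = \<delta> * (lam * b)" by simp
    also have "\<dots> < \<delta> * D" using that(1) \<delta>(1) by (simp add: mult.assoc flip: exp_add)
    finally show ?thesis .
  qed
  \<comment> \<open>Once the lower bound holds at the smaller parameter it holds at both, and an
    upper bound that fails at either fails at the larger one. So non-admissibility of a half always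
    becomes a failed upper bound at \<open>D * exp (s / 2)\<close>.\<close>
  have high: "D * exp (- (s / 2)) \<le> D * exp (s / 2)" using D0 s0 by simp
  \<comment> \<open>Halving \<open>s\<close> stays in the large range, crosses from large to small,
    or stays in the small range.\<close>
  consider "2 < s" | "1 < s" "s \<le> 2" | "s \<le> 1" by linarith
  then show ?thesis
  proof cases
    case 1
    then have l: "exp (2 * s) \<le> D" "D \<le> lam * exp (\<gamma> * s)" using adm by (auto simp: log_admissible_def)
    have "exp (2 * (s / 2)) \<le> D * exp (- (s / 2))"
    proof -
      have "exp (2 * (s / 2)) = exp (3 / 2 * s) * exp (- (s / 2))" by (simp flip: exp_add)
      also have "\<dots> \<le> D * exp (- (s / 2))"
      proof (rule mult_right_mono)
        have "exp (3 / 2 * s) \<le> exp (2 * s)" using s0 by simp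
        then show "exp (3 / 2 * s) \<le> D" using l(1) by linarith
      qed simp
      finally show ?thesis .
    qed
    moreover have "1 < s / 2" using 1 by simp
    ultimately have "lam * exp (\<gamma> * (s / 2)) < D * exp (s / 2)"
      using not high unfolding log_admissible_def
      by (meson not_le order_trans)
    then have "lam * (exp (\<gamma> * (s / 2)) * exp (- (s / 2))) < D * exp (s / 2) * exp (- (s / 2))"
      by (simp flip: mult.assoc)
    from big[OF this] have "exp 3 * (exp (\<gamma> * (s / 2)) * exp (- (s / 2))) < \<delta> * D" by simp
    moreover have "exp (2 * s) \<le> exp (\<gamma> * (s / 2)) * exp (- (s / 2))"
    proof -
      \<comment> \<open>This is \<open>\<gamma> \<ge> 5\<close> multiplied by
        \<open>s / 2\<close>.\<close>
      have "2 * s \<le> \<gamma> * (s / 2) - s / 2" using s0 mult_right_mono[OF \<gamma>, of "s / 2"] by linarith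
      then have "exp (2 * s) \<le> exp (\<gamma> * (s / 2) + - (s / 2))" by simp
      then show ?thesis by (simp only: exp_add)
    qed
    moreover have "exp (2 * s) \<le> exp 3 * exp (2 * s)" by simp
    ultimately have "exp (2 * s) \<le> \<delta> * D"
      by (smt (verit) exp_gt_zero mult_left_mono)
    then show ?thesis using 1 l \<delta>D by (simp add: log_admissible_def)
  next
    case 2
    then have l: "exp (2 * s) \<le> D" "D \<le> lam * exp (\<gamma> * s)" using adm by (auto simp: log_admissible_def)
    have "exp 2 * (s / 2) \<le> D * exp (- (s / 2))"
    proof -
      have "exp 2 * (s / 2) = exp (3 / 2) * (exp (1 / 2) * (s / 2))" by (simp flip: exp_add mult.assoc)
      \<comment> \<open>The tangent line of \<open>exp (3 / 2 * s)\<close> at \<open>s = 1\<close>,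
        where the large range begins.\<close>
      also have "\<dots> \<le> exp (3 / 2) * (1 + 3 / 2 * (s - 1))"
      proof (rule mult_left_mono)
        have "exp (1 / 2) * (s / 2) \<le> 2 * (s / 2)"
          using exp_half_le_2[of 1] s0 by (intro mult_right_mono) auto
        then show "exp (1 / 2) * (s / 2) \<le> 1 + 3 / 2 * (s - 1)" using 2 by argo
      qed simp
      also have "\<dots> \<le> exp (3 / 2) * exp (3 / 2 * (s - 1))"
        by (intro mult_left_mono exp_ge_add_one_self) auto
      also have "\<dots> = exp (2 * s) * exp (- (s / 2))" by (simp add: field_simps flip: exp_add)
      also have "\<dots> \<le> D * exp (- (s / 2))" using l(1) by (intro mult_right_mono) auto
      finally show ?thesis .
    qed
    moreover have "0 < s / 2" "s / 2 \<le> 1" using 2 by simp_all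
    ultimately have "lam * exp 2 * (s / 2) < D * exp (s / 2)"
      using not high unfolding log_admissible_def
      by (meson not_le order_trans)
    then have "lam * (exp 2 * (s / 2) * exp (- (s / 2))) < D * exp (s / 2) * exp (- (s / 2))"
      by (simp flip: mult.assoc)
    from big[OF this] have "exp 3 * (exp 2 * (s / 2) * exp (- (s / 2))) < \<delta> * D" using s0 by simp
    moreover have "exp (2 * s) \<le> exp 3 * (exp 2 * (s / 2) * exp (- (s / 2)))"
    proof -
      \<comment> \<open>Up to a positive factor the claim reads
        \<open>1 \<le> (1 - ?u / 2) * exp (5 / 2 * ?u)\<close>, with equality at
        \<open>s = 2\<close>; this is what fixes the \<open>exp 3\<close> in the lower bound on
        \<open>lam\<close>. The estimate \<open>1 + x \<le> exp x\<close> reduces it to a quadratic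
        in \<open>?u\<close>.\<close>
      let ?u = "2 - s"
      have "1 \<le> (1 - ?u / 2) * (1 + 5 / 2 * ?u)"
      proof -
        have "(1 - ?u / 2) * (1 + 5 / 2 * ?u) - 1 = (2 - s) * (2 - 5 / 4 * (2 - s))"
          by (simp add: field_simps)
        moreover have "0 \<le> (2 - s) * (2 - 5 / 4 * (2 - s))" using 2 by (intro mult_nonneg_nonneg) auto
        ultimately show ?thesis by linarith
      qed
      also have "\<dots> \<le> (1 - ?u / 2) * exp (5 / 2 * ?u)"
        using s0 by (intro mult_left_mono exp_ge_add_one_self) auto
      also have "1 - ?u / 2 = s / 2" by (simp add: diff_divide_distrib)
      finally have "exp (2 * s) * 1 \<le> exp (2 * s) * ((s / 2) * exp (5 / 2 * ?u))"
        by (rule mult_left_mono) simp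
      also have "\<dots> = (s / 2) * exp (5 - s / 2)" by (simp add: field_simps flip: exp_add)
      also have "\<dots> = exp 3 * (exp 2 * (s / 2) * exp (- (s / 2)))"
      proof -
        have "exp (5 - s / 2) = exp 3 * exp 2 * exp (- (s / 2))" by (simp flip: exp_add)
        then show ?thesis by (simp only: mult_ac)
      qed
      finally show ?thesis by simp
    qed
    ultimately have "exp (2 * s) \<le> \<delta> * D" by linarith
    then show ?thesis using 2 l \<delta>D by (simp add: log_admissible_def)
  next
    case 3
    then have l: "exp 2 * s \<le> D" "D \<le> lam * exp 2 * s" using adm by (auto simp: log_admissible_def)
    have h: "1 / 2 \<le> exp (- (s / 2))"
      using exp_half_le_2[OF 3] by (simp add: exp_minus field_simps)
    have "exp 2 * (s / 2) \<le> D * exp (- (s / 2))"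
      using mult_mono[OF l(1) h] D0 by simp
    moreover have "0 < s / 2" "s / 2 \<le> 1" using 3 s0 by simp_all
    ultimately have "lam * exp 2 * (s / 2) < D * exp (s / 2)"
      using not high unfolding log_admissible_def
      by (meson not_le order_trans)
    then have "lam * (exp 2 * (s / 2) * exp (- (s / 2))) < D * exp (s / 2) * exp (- (s / 2))"
      by (simp flip: mult.assoc)
    from big[OF this] have "exp 3 * (exp 2 * (s / 2) * exp (- (s / 2))) < \<delta> * D" using s0 by simp
    moreover have "exp 2 * s \<le> exp 3 * (exp 2 * (s / 2) * exp (- (s / 2)))"
    proof -
      \<comment> \<open>Halving \<open>s\<close> loses a factor 2, and
        \<open>exp (- (s / 2))\<close> at most another; \<open>exp 3 \<ge> 4\<close> makes up for
        both.\<close>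
      have "4 * (1 / 2) \<le> exp 3 * exp (- (s / 2))"
        using exp_ge_add_one_self[of 3] h by (intro mult_mono) auto
      then have "exp 2 * (s / 2) * 2 \<le> exp 2 * (s / 2) * (exp 3 * exp (- (s / 2)))"
        using s0 by (intro mult_left_mono) auto
      then show ?thesis by (simp add: mult_ac)
    qed
    ultimately have "exp 2 * s \<le> \<delta> * D" by linarith
    then show ?thesis using 3 s0 l \<delta>D by (simp add: log_admissible_def)
  qed
qed

section \<open>Admissible cylinders over Christ cubes\<close>

locale christ_flow = flow v \<mu> \<phi> for v :: "real^'m::finite" and \<mu> \<phi> +
  fixes \<Q> :: "int \<Rightarrow> (real^'m) set set" and \<delta> C\<^sub>1 c \<gamma> lam :: real
  assumes doubling: "doubling (mu_N \<phi>)"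
    and christ: "christ_decomposition (mu_N \<phi>) \<Q> \<delta> C\<^sub>1 c"
    and C1_ge: "C\<^sub>1 \<ge> 3" and \<gamma>_ge: "\<gamma> \<ge> 5" and lam_gt: "lam > exp 3 / \<delta>"
begin

lemma \<delta>: "0 < \<delta>" "\<delta> < 1" and c_pos: "0 < c"
  and countable_\<Q>: "countable (\<Q> k)"
  and open_\<Q>: "Q \<in> \<Q> k \<Longrightarrow> open Q"
  and null_\<Q>: "emeasure (mu_N \<phi>) (UNIV - \<Union>(\<Q> k)) = 0"
  and parent_\<Q>: "Q \<in> \<Q> k \<Longrightarrow> \<exists>!Q'. Q' \<in> \<Q> (k - 1) \<and> Q \<subseteq> Q'"
  and disjnt_\<Q>: "Q \<in> \<Q> k \<Longrightarrow> Q' \<in> \<Q> (k - 1) \<Longrightarrow> \<not> Q \<subseteq> Q' \<Longrightarrow> disjnt Q Q'"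
  and centre_\<Q>: "Q \<in> \<Q> k \<Longrightarrow>
    \<exists>n\<in>Q. ball n (c * \<delta> powi k) \<subseteq> Q \<and> Q \<subseteq> ball n (C\<^sub>1 * \<delta> powi k)"
  and measure_parent: "q \<in> cubes \<Q> \<Longrightarrow>
    emeasure (mu_N \<phi>) (snd (p_N \<Q> q)) \<le> ennreal C\<^sub>1 * emeasure (mu_N \<phi>) (snd q)"
  using christ unfolding christ_decomposition_def by (simp; fail)+

lemma \<Q>_disjoint:
  assumes "Q \<in> \<Q> k" "Q' \<in> \<Q> k" "n \<in> Q" "n \<in> Q'"
  shows "Q = Q'"
proof -
  have "pairwise disjnt (\<Q> k)" using christ unfolding christ_decomposition_def by simp
  then show ?thesis using assms unfolding pairwise_def disjnt_iff by blast
qed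

lemma \<delta>_powi: "0 < \<delta> powi k" "\<delta> powi (k + 1) = \<delta> * \<delta> powi k" "\<delta> * \<delta> powi (k - 1) = \<delta> powi k"
  using \<delta> by (auto simp: power_int_add power_int_diff)

lemma \<delta>_lam: "exp 3 < \<delta> * lam" and lam_pos: "0 < lam"
proof -
  show "exp 3 < \<delta> * lam" using lam_gt \<delta> by (simp add: field_simps)
  then have "0 < \<delta> * lam" by (meson exp_gt_zero less_trans)
  then show "0 < lam" using \<delta> by (simp add: zero_less_mult_iff)
qed

lemma p_N_eq: "p_N \<Q> (k, Q) = (k - 1, Q') \<longleftrightarrow> Q' \<in> \<Q> (k - 1) \<and> Q \<subseteq> Q'" if "Q \<in> \<Q> k"
  using theI'[OF parent_\<Q>[OF that]] parent_\<Q>[OF that] unfolding p_N_def by auto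

lemma p_N_obtain:
  assumes "Q \<in> \<Q> k"
  obtains Q' where "p_N \<Q> (k, Q) = (k - 1, Q')" "Q' \<in> \<Q> (k - 1)" "Q \<subseteq> Q'"
  using parent_\<Q>[OF assms] p_N_eq[OF assms] by blast

lemma s_N_eq: "s_N \<Q> (k, Q) = {(k + 1, Q') | Q'. Q' \<in> \<Q> (k + 1) \<and> Q' \<subseteq> Q}" if "Q \<in> \<Q> k"
proof (intro equalityI subsetI)
  fix q assume "q \<in> s_N \<Q> (k, Q)"
  then have q: "q \<in> cubes \<Q>" "p_N \<Q> q = (k, Q)" by (auto simp: s_N_def)
  obtain j Q' where jQ: "q = (j, Q')" "Q' \<in> \<Q> j" using q(1) by (auto simp: cubes_def)
  have "j = k + 1" using q(2) by (auto simp: jQ(1) p_N_def)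
  then show "q \<in> {(k + 1, Q') | Q'. Q' \<in> \<Q> (k + 1) \<and> Q' \<subseteq> Q}"
    using q(2) jQ p_N_eq[of Q' "k + 1" Q] by simp
next
  fix q assume "q \<in> {(k + 1, Q') | Q'. Q' \<in> \<Q> (k + 1) \<and> Q' \<subseteq> Q}"
  then show "q \<in> s_N \<Q> (k, Q)"
    using p_N_eq[of _ "k + 1" Q] that by (auto simp: s_N_def cubes_def)
qed

lemma borel_\<Q>: "Q \<in> \<Q> k \<Longrightarrow> Q \<in> sets borel" using open_\<Q> by (intro borel_open)

lemma ball_positive: "0 < r \<Longrightarrow> 0 < emeasure (mu_N \<phi>) (ball n r)"
  and ball_finite: "emeasure (mu_N \<phi>) (ball n r) < \<infinity>"
proof -
  show "0 < r \<Longrightarrow> 0 < emeasure (mu_N \<phi>) (ball n r)"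
    using doubling by (simp add: doubling_def)
  show "emeasure (mu_N \<phi>) (ball n r) < \<infinity>"
  proof (cases "0 < r")
    case False
    then have "ball n r = {}" by simp
    then show ?thesis by (simp only: emeasure_empty) simp
  qed (use doubling in \<open>simp add: doubling_def\<close>)
qed

lemma \<Q>_measure: "Q \<in> \<Q> k \<Longrightarrow> 0 < emeasure (mu_N \<phi>) Q" "Q \<in> \<Q> k \<Longrightarrow> emeasure (mu_N \<phi>) Q < \<infinity>"
proof -
  assume Q: "Q \<in> \<Q> k"
  obtain n where n: "ball n (c * \<delta> powi k) \<subseteq> Q" "Q \<subseteq> ball n (C\<^sub>1 * \<delta> powi k)"
    using centre_\<Q>[OF Q] by blast
  have "0 < emeasure (mu_N \<phi>) (ball n (c * \<delta> powi k))"
    using c_pos \<delta>_powi by (intro ball_positive) simp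
  also have "\<dots> \<le> emeasure (mu_N \<phi>) Q" using n borel_\<Q>[OF Q] by (intro emeasure_mono) auto
  finally show "0 < emeasure (mu_N \<phi>) Q" .
  have "emeasure (mu_N \<phi>) Q \<le> emeasure (mu_N \<phi>) (ball n (C\<^sub>1 * \<delta> powi k))"
    using n by (intro emeasure_mono) auto
  then show "emeasure (mu_N \<phi>) Q < \<infinity>" using ball_finite by (rule order.strict_trans1)
qed

section \<open>Admissible cylinders as flow tiles, and their measures\<close>

abbreviation adm :: "'m cyl \<Rightarrow> bool" where "adm \<equiv> admissible \<Q> \<delta> lam \<gamma>"
abbreviation cyl :: "'m cyl \<Rightarrow> 'm point set" where "cyl \<equiv> cyl_set (v, 1)"

fun heights :: "'m cyl \<Rightarrow> real set" where "heights (r, q, a) = {a / r <..< a * r}"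
fun cube :: "'m cyl \<Rightarrow> (real^'m) set" where "cube (r, q, a) = snd q"
fun log_radius :: "'m cyl \<Rightarrow> real" where "log_radius (r, q, a) = ln r"

lemma adm_facts:
  assumes "adm P"
  obtains r k Q a where "P = (r, (k, Q), a)" "1 < r" "0 < a" "Q \<in> \<Q> k" "a / r < a" "a < a * r"
proof -
  obtain r k Q a where P: "P = (r, (k, Q), a)" by (metis prod.exhaust)
  note p = admissible_pos[OF assms[unfolded P]]
  then have "a / r < a" "a < a * r" by (simp_all add: divide_less_eq)
  then show ?thesis using that P p by blast
qed

lemma cyl_eq: "adm P \<Longrightarrow> cyl P = flow_tile v (cube P) (heights P)"
  by (erule adm_facts) (simp add: cylinder_eq_tile)

lemma mem_cyl: "adm P \<Longrightarrow> x \<in> cyl P \<longleftrightarrow> flow_base v x \<in> cube P \<and> snd x \<in> heights P"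
  by (simp add: cyl_eq flow_tile_def)

lemma heights_pos: "adm P \<Longrightarrow> heights P \<subseteq> {0<..}"
  by (erule adm_facts) (auto intro: less_trans[rotated])

lemma log_radius_pos: "adm P \<Longrightarrow> 0 < log_radius P"
  by (erule adm_facts) auto

lemma cyl_sets:
  assumes P: "adm P"
  shows "cyl P \<in> sets \<mu>"
proof -
  have "open (cyl P)"
    unfolding cyl_eq[OF P] using P by (elim adm_facts) (auto intro!: open_flow_tile open_\<Q>)
  moreover have "cyl P \<subseteq> G_carrier" using heights_pos[OF P] mem_cyl[OF P] by (auto simp: carrier_iff)
  ultimately show ?thesis by (simp add: sets_\<mu>)
qed

lemma emeasure_cyl: "adm P \<Longrightarrow> emeasure \<mu> (cyl P) = emeasure (mu_N \<phi>) (cube P) * ennreal (2 * log_radius P)"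
  by (erule adm_facts) (simp add: emeasure_cylinder borel_\<Q>)

lemma emeasure_cyl_pos: "adm P \<Longrightarrow> 0 < emeasure \<mu> (cyl P)"
  and emeasure_cyl_finite: "adm P \<Longrightarrow> emeasure \<mu> (cyl P) < \<infinity>"
proof -
  assume P: "adm P"
  then have "0 < emeasure (mu_N \<phi>) (cube P)" "emeasure (mu_N \<phi>) (cube P) < \<infinity>"
    by (auto elim!: adm_facts simp: \<Q>_measure simp del: infinity_ennreal_def)
  then show "0 < emeasure \<mu> (cyl P)" "emeasure \<mu> (cyl P) < \<infinity>"
    using log_radius_pos[OF P] by (simp_all add: emeasure_cyl[OF P] ennreal_zero_less_mult_iff ennreal_mult_less_top)
qed

lemma cyl_nonempty: "adm P \<Longrightarrow> \<exists>x. x \<in> cyl P"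
  using emeasure_cyl_pos[of P] by (cases "cyl P = {}") auto

text \<open>Over one cube, measures are in the ratio of the logarithmic radii. The factor 3 is the
  worst case among all vertical passages, that of \<open>p_down\<close>, and
  \<open>C\<^sub>1 \<ge> 3\<close> absorbs it.\<close>

lemma emeasure_cyl_le:
  assumes "adm P" "adm P'" "cube P = cube P'" "log_radius P \<le> 3 * log_radius P'"
  shows "emeasure \<mu> (cyl P) \<le> ennreal C\<^sub>1 * emeasure \<mu> (cyl P')"
proof -
  have "log_radius P \<le> C\<^sub>1 * log_radius P'"
    using assms(4) log_radius_pos[OF assms(2)] mult_right_mono[OF C1_ge, of "log_radius P'"] by linarith
  then have "ennreal (2 * log_radius P) \<le> ennreal C\<^sub>1 * ennreal (2 * log_radius P')"
    using C1_ge log_radius_pos[OF assms(2)] by (simp flip: ennreal_mult)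
  then have "emeasure (mu_N \<phi>) (cube P) * ennreal (2 * log_radius P) \<le>
      emeasure (mu_N \<phi>) (cube P) * (ennreal C\<^sub>1 * ennreal (2 * log_radius P'))"
    by (rule mult_left_mono) simp
  then show ?thesis
    using assms by (simp only: emeasure_cyl mult_ac)
qed

lemma emeasure_cyl_across:
  assumes "adm (r, (k, Q), a)" "adm (r, p_N \<Q> (k, Q), a)"
  shows "emeasure \<mu> (cyl (r, p_N \<Q> (k, Q), a)) \<le> ennreal C\<^sub>1 * emeasure \<mu> (cyl (r, (k, Q), a))"
    and "cyl (r, (k, Q), a) \<subseteq> cyl (r, p_N \<Q> (k, Q), a)"
proof -
  have Q: "Q \<in> \<Q> k" using admissible_pos[OF assms(1)] by simp
  obtain Q' where Q': "p_N \<Q> (k, Q) = (k - 1, Q')" "Q' \<in> \<Q> (k - 1)" "Q \<subseteq> Q'"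
    using p_N_obtain[OF Q] .
  show "cyl (r, (k, Q), a) \<subseteq> cyl (r, p_N \<Q> (k, Q), a)"
    using mem_cyl[OF assms(1)] mem_cyl[OF assms(2)] Q' by auto
  have "emeasure (mu_N \<phi>) Q' \<le> ennreal C\<^sub>1 * emeasure (mu_N \<phi>) Q"
    using measure_parent[of "(k, Q)"] Q Q' by (simp add: cubes_def)
  then have "emeasure (mu_N \<phi>) Q' * ennreal (2 * ln r) \<le> ennreal C\<^sub>1 * emeasure (mu_N \<phi>) Q * ennreal (2 * ln r)"
    by (rule mult_right_mono) simp
  then show "emeasure \<mu> (cyl (r, p_N \<Q> (k, Q), a)) \<le> ennreal C\<^sub>1 * emeasure \<mu> (cyl (r, (k, Q), a))"
    using emeasure_cyl[OF assms(1)] emeasure_cyl[OF assms(2)] Q' by (simp add: mult.assoc)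
qed

section \<open>Admissible cylinders and the distance\<close>

lemma adm_log:
  assumes "adm (r, (k, Q), a)"
  shows "log_admissible lam \<gamma> (ln r) (\<delta> powi k / a)"
proof -
  have "0 < r" "0 < a" using admissible_pos[OF assms] by auto
  then show ?thesis using assms admissible_iff by blast
qed

text \<open>Within distance \<open>s / 2\<close> of a cylinder the heights remain between
  \<open>a * exp (- (3 / 2 * s))\<close> and \<open>a * exp (3 / 2 * s)\<close>, and the base moves
  by at most a multiple of \<open>a * exp (3 / 2 * s) * (s / 2)\<close>. The lower bound of
  admissibility makes this at most a multiple of \<open>d\<close>, the size of the cube. The
  logarithmic width grows from \<open>2 * s\<close> to \<open>3 * s\<close>.\<close>

lemma neighbourhood_cyl:
  obtains D where "0 \<le> D" "\<And>P. adm P \<Longrightarrow>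
    emeasure \<mu> (neighbourhood G_carrier d_G (cyl P) (log_radius P / 2)) \<le> ennreal D * emeasure \<mu> (cyl P)"
proof -
  \<comment> \<open>\<open>B * c = C\<^sub>1 + 1 + norm v + c\<close>: the radius of the cube, the
    horizontal displacement, and the drift along \<open>v\<close> caused by the change of height.
    The last \<open>c\<close> makes \<open>B > 1\<close>, as \<open>doubling\<close> asks.\<close>
  define B where "B = (C\<^sub>1 + 1 + norm v) / c + 1"
  have "1 < B" using c_pos C1_ge by (simp add: B_def add_pos_nonneg)
  then obtain D where D: "1 < D" and dbl: "\<And>x r. 0 < r \<Longrightarrow>
      emeasure (mu_N \<phi>) (ball x (B * r)) \<le> ennreal D * emeasure (mu_N \<phi>) (ball x r)"
    using doubling unfolding doubling_def by blast
  have "emeasure \<mu> (neighbourhood G_carrier d_G (cyl P) (log_radius P / 2)) \<le> ennreal (2 * D) * emeasure \<mu> (cyl P)"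
    if P: "adm P" for P
  proof -
    obtain r k Q a where eq: "P = (r, (k, Q), a)" and r: "1 < r" and a: "0 < a" and Q: "Q \<in> \<Q> k"
      and ar: "a / r < a" "a < a * r" using P by (rule adm_facts)
    define s where "s = ln r"
    have s: "0 < s" "r = exp s" using r by (auto simp: s_def)
    define d where "d = \<delta> powi k"
    have d: "0 < d" using \<delta>_powi by (simp add: d_def)
    have log: "log_admissible lam \<gamma> s (d / a)" using adm_log[OF P[unfolded eq]] by (simp add: s_def d_def)
    \<comment> \<open>One bound for both ranges; in the large one it follows from
      \<open>s / 2 \<le> exp (s / 2)\<close>.\<close>
    have low: "exp (3 / 2 * s) * (s / 2) \<le> d / a"
      using log unfolding log_admissible_def
    proof (elim disjE conjE)
      assume "exp (2 * s) \<le> d / a"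
      moreover have "exp (3 / 2 * s) * (s / 2) \<le> exp (3 / 2 * s) * exp (s / 2)"
        using exp_ge_add_one_self[of "s / 2"] by (intro mult_left_mono) (linarith, simp)
      moreover have "exp (3 / 2 * s) * exp (s / 2) = exp (2 * s)" by (simp flip: exp_add)
      ultimately show ?thesis by linarith
    next
      assume "exp 2 * s \<le> d / a" "s \<le> 1"
      moreover have "exp (3 / 2 * s) * (s / 2) \<le> exp 2 * s"
        using \<open>s \<le> 1\<close> s by (intro mult_mono) auto
      ultimately show ?thesis by linarith
    qed
    obtain n where n: "ball n (c * d) \<subseteq> Q" "Q \<subseteq> ball n (C\<^sub>1 * d)" using centre_\<Q>[OF Q] d_def by blast
    let ?T = "flow_tile v (ball n (B * (c * d))) {a * exp (- (3 / 2 * s)) <..< a * exp (3 / 2 * s)}"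
    have sub: "neighbourhood G_carrier d_G (cyl P) (s / 2) \<subseteq> ?T"
    proof
      have PG: "cyl P \<subseteq> G_carrier" using cyl_sets[OF P] by (simp add: sets_\<mu>)
      fix x assume "x \<in> neighbourhood G_carrier d_G (cyl P) (s / 2)"
      then obtain y where y: "y \<in> cyl P" and x: "x \<in> G_carrier" and dxy: "d_G x y < s / 2"
        unfolding neighbourhood_eq[OF PG] by blast
      have pos: "0 < snd x" "0 < snd y" using x y PG by (auto simp: carrier_iff)
      note dist = d_G_less_distortion[OF dxy pos]
      have yb: "flow_base v y \<in> Q" and yh: "a / r < snd y" "snd y < a * r"
        using y mem_cyl[OF P] by (auto simp: eq)
      have yln: "ln a - s < ln (snd y)" "ln (snd y) < ln a + s"
        using yh pos a r ln_less_cancel_iff[of "a / r" "snd y"] ln_less_cancel_iff[of "snd y" "a * r"]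
        by (simp_all add: ln_div ln_mult s_def)
      have xln: "ln a - 3 / 2 * s < ln (snd x)" "ln (snd x) < ln a + 3 / 2 * s"
        using yln dist(1) by linarith+
      have xh: "a * exp (- (3 / 2 * s)) < snd x" "snd x < a * exp (3 / 2 * s)"
      proof -
        have "exp (ln a + - (3 / 2 * s)) < exp (ln (snd x))" "exp (ln (snd x)) < exp (ln a + 3 / 2 * s)"
          using xln unfolding exp_less_cancel_iff by linarith+
        then show "a * exp (- (3 / 2 * s)) < snd x" "snd x < a * exp (3 / 2 * s)"
          using pos a by (simp_all only: exp_add exp_ln)
      qed
      let ?e = "exp (s / 2) * (s / 2)"
      \<comment> \<open>The base point also moves by the difference of heights times
        \<open>v\<close>, and that difference obeys the same bound as the horizontal
        displacement.\<close>
      have hd: "\<bar>snd y - snd x\<bar> \<le> snd y * ?e"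
      proof -
        have x1: "snd x \<le> snd y * exp (s / 2)"
        proof -
          have "ln (snd x) \<le> ln (snd y) + s / 2" using dist(1) by linarith
          then have "exp (ln (snd x)) \<le> exp (ln (snd y) + s / 2)" by simp
          then show ?thesis using pos by (simp add: exp_add)
        qed
        have x2: "snd y * exp (- (s / 2)) \<le> snd x"
        proof -
          have "ln (snd y) + - (s / 2) \<le> ln (snd x)" using dist(1) by linarith
          then have "exp (ln (snd y) + - (s / 2)) \<le> exp (ln (snd x))" by simp
          then show ?thesis using pos by (simp only: exp_add) simp
        qed
        have m: "1 - s / 2 \<le> exp (- (s / 2))" using exp_ge_add_one_self[of "- (s / 2)"] by simp
        have "exp (s / 2) * (1 - s / 2) \<le> exp (s / 2) * exp (- (s / 2))"
          using m by (rule mult_left_mono) simp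
        then have e1: "exp (s / 2) - 1 \<le> ?e" by (simp add: right_diff_distrib flip: exp_add)
        have e2: "1 - exp (- (s / 2)) \<le> ?e"
        proof -
          have "1 * (s / 2) \<le> ?e" using s(1) by (intro mult_right_mono) auto
          then show ?thesis using m by linarith
        qed
        have "snd y * (exp (s / 2) - 1) \<le> snd y * ?e" "snd y * (1 - exp (- (s / 2))) \<le> snd y * ?e"
          using e1 e2 pos by (intro mult_left_mono; simp)+
        then show ?thesis using x1 x2 by (simp only: right_diff_distrib abs_le_iff) linarith
      qed
      have ye: "snd y * ?e \<le> d"
      proof -
        have "snd y * ?e \<le> (a * exp s) * ?e" using yh(2) s by (intro mult_right_mono) auto
        also have "\<dots> = a * (exp (3 / 2 * s) * (s / 2))" by (simp flip: exp_add)
        also have "\<dots> \<le> a * (d / a)" using low a by (intro mult_left_mono) auto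
        finally show ?thesis using a by simp
      qed
      have bd: "norm (flow_base v y - flow_base v x) \<le> (1 + norm v) * d"
      proof -
        have "flow_base v y - flow_base v x = (fst y - fst x) - (snd y - snd x) *\<^sub>R v"
          by (simp add: flow_base_def algebra_simps)
        then have "norm (flow_base v y - flow_base v x) \<le> norm (fst y - fst x) + \<bar>snd y - snd x\<bar> * norm v"
          using norm_triangle_ineq4[of "fst y - fst x" "(snd y - snd x) *\<^sub>R v"] by simp
        also have "\<dots> \<le> d + d * norm v"
        proof (intro add_mono mult_right_mono)
          show "norm (fst y - fst x) \<le> d" using dist(2) ye by (simp only: mult.assoc)
          show "\<bar>snd y - snd x\<bar> \<le> d" using hd ye by linarith
        qed simp
        finally show ?thesis by (simp add: algebra_simps)
      qed
      have "dist n (flow_base v x) \<le> dist n (flow_base v y) + norm (flow_base v y - flow_base v x)"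
        using dist_triangle[of n "flow_base v x" "flow_base v y"] by (simp add: dist_norm)
      also have "\<dots> < C\<^sub>1 * d + (1 + norm v) * d" using bd yb n(2) by auto
      also have "\<dots> \<le> (B * c) * d"
      proof -
        have "B * c = C\<^sub>1 + 1 + norm v + c" using c_pos by (simp add: B_def field_simps)
        then show ?thesis using c_pos d by (simp add: algebra_simps)
      qed
      also have "\<dots> = B * (c * d)" by simp
      finally show "x \<in> ?T" using xh by (simp add: flow_tile_def)
    qed
    have "emeasure \<mu> (neighbourhood G_carrier d_G (cyl P) (s / 2)) \<le> emeasure \<mu> ?T"
    proof (rule emeasure_mono[OF sub])
      have "0 < a * exp (- (3 / 2 * s))" using a by simp
      then have "?T \<subseteq> G_carrier" unfolding flow_tile_def by (auto simp: carrier_iff)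
      moreover have "?T \<in> sets borel" by (rule borel_flow_tile) auto
      ultimately show "?T \<in> sets \<mu>" by (simp only: sets_\<mu>)
    qed
    also have "\<dots> = emeasure (mu_N \<phi>) (ball n (B * (c * d))) * ennreal (3 * s)"
      using a s by (subst emeasure_flow_tile_Ioo) (auto simp: ln_mult intro!: mult_left_mono)
    \<comment> \<open>\<open>3 * s\<close> is enlarged to \<open>4 * s\<close>, twice the
      logarithmic width \<open>2 * s\<close> of the cylinder.\<close>
    also have "\<dots> \<le> (ennreal D * emeasure (mu_N \<phi>) (ball n (c * d))) * ennreal (4 * s)"
      using dbl[of "c * d" n] c_pos d s by (intro mult_mono ennreal_leI) auto
    also have "\<dots> \<le> (ennreal D * emeasure (mu_N \<phi>) Q) * ennreal (4 * s)"
      using n(1) borel_\<Q>[OF Q] by (intro mult_right_mono mult_left_mono emeasure_mono) auto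
    also have "\<dots> = ennreal (2 * D) * emeasure \<mu> (cyl P)"
    proof -
      have "ennreal (4 * s) = ennreal 2 * ennreal (2 * s)"
        using s ennreal_mult[of 2 "2 * s"] by (simp only: mult.assoc[symmetric]) simp
      moreover have "ennreal (2 * D) = ennreal 2 * ennreal D" using D by (intro ennreal_mult) auto
      moreover have "emeasure \<mu> (cyl P) = emeasure (mu_N \<phi>) Q * ennreal (2 * s)"
        using emeasure_cyl[OF P] by (simp add: eq s_def)
      ultimately show ?thesis by (simp only: mult_ac)
    qed
    finally show ?thesis by (simp add: eq s_def)
  qed
  then show ?thesis using that[of "2 * D"] D by simp
qed

text \<open>Two points of a cylinder are joined by going up along flow lines to a height comparable to the
  diameter of the base, where horizontal displacement is cheap.\<close>

lemma cyl_subset_ball: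
  obtains D where "1 \<le> D" "\<And>P. adm P \<Longrightarrow>
    \<exists>x\<in>G_carrier. cyl P \<subseteq> {y \<in> G_carrier. d_G x y < D * (log_radius P / 2)}"
proof -
  \<comment> \<open>The logarithmic lengths of the way up, \<open>\<gamma> * s\<close>, and of the
    way down, \<open>s + \<gamma> * s\<close>, plus the horizontal move at the top, all divided by
    \<open>s\<close>.\<close>
  define K where "K = (1 + norm v) * (2 * \<gamma> + 1) + C\<^sub>1 * lam * exp 2"
  have K: "0 \<le> K" using \<gamma>_ge C1_ge lam_pos by (simp add: K_def)
  have "\<exists>x\<in>G_carrier. cyl P \<subseteq> {y \<in> G_carrier. d_G x y < (2 * K + 2) * (log_radius P / 2)}"
    if P: "adm P" for P
  proof -
    obtain r k Q a where eq: "P = (r, (k, Q), a)" and r: "1 < r" and a: "0 < a" and Q: "Q \<in> \<Q> k"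
      and ar: "a / r < a" "a < a * r" using P by (rule adm_facts)
    define s where "s = ln r"
    have s: "0 < s" "r = exp s" using r by (auto simp: s_def)
    define d where "d = \<delta> powi k"
    have d: "0 < d" using \<delta>_powi by (simp add: d_def)
    have log: "log_admissible lam \<gamma> s (d / a)" using adm_log[OF P[unfolded eq]] by (simp add: s_def d_def)
    \<comment> \<open>\<open>t\<close> is the logarithmic height to climb before crossing the base
      costs only a multiple of \<open>s\<close>. Large cylinders climb \<open>\<gamma> * s\<close>,
      using \<open>1 \<le> exp 2 * s\<close>; for small ones \<open>t = 0\<close> is enough.\<close>
    obtain t where t: "0 \<le> t" "t \<le> \<gamma> * s" "d / a \<le> lam * exp 2 * s * exp t"
      using log unfolding log_admissible_def
    proof (elim disjE conjE)
      assume "1 < s" and le: "d / a \<le> lam * exp (\<gamma> * s)"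
      then have "1 * 1 \<le> exp 2 * s" by (intro mult_mono) auto
      then have "lam * exp (\<gamma> * s) * 1 \<le> lam * exp (\<gamma> * s) * (exp 2 * s)"
        using lam_pos by (intro mult_left_mono) auto
      then have "d / a \<le> lam * exp 2 * s * exp (\<gamma> * s)" using le by (simp add: mult_ac)
      then show ?thesis using that[of "\<gamma> * s"] s \<gamma>_ge by simp
    next
      assume "d / a \<le> lam * exp 2 * s"
      then show ?thesis using that[of 0] s \<gamma>_ge by simp
    qed
    define H where "H = a * exp t"
    have H: "0 < H" using a by (simp add: H_def)
    obtain n where n: "n \<in> Q" "Q \<subseteq> ball n (C\<^sub>1 * d)" using centre_\<Q>[OF Q] d_def by blast
    define x where "x = (n + (a - 1) *\<^sub>R v, a)"
    have "d_G x y < (2 * K + 2) * (s / 2)" "y \<in> G_carrier" if y: "y \<in> cyl P" for y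
    proof -
      have yb: "flow_base v y \<in> Q" and yh: "a / r < snd y" "snd y < a * r"
        using y mem_cyl[OF P] by (auto simp: eq)
      show yG: "y \<in> G_carrier" using y cyl_sets[OF P] by (auto simp: sets_\<mu>)
      then have ypos: "0 < snd y" by (simp add: carrier_iff)
      define x' where "x' = (fst x + (H - snd x) *\<^sub>R v, H)"
      define y' where "y' = (flow_base v y + (H - 1) *\<^sub>R v, H)"
      have 1: "d_G x x' \<le> (1 + norm v) * (\<gamma> * s)"
      proof -
        have "d_G x x' \<le> (1 + norm v) * \<bar>ln (H / snd x)\<bar>"
          unfolding x'_def by (rule d_G_flow_line) (use a H in \<open>auto simp: x_def\<close>)
        also have "\<dots> \<le> (1 + norm v) * (\<gamma> * s)"
          using a t by (intro mult_left_mono) (auto simp: x_def H_def)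
        finally show ?thesis .
      qed
      have 2: "d_G x' y' \<le> C\<^sub>1 * lam * exp 2 * s"
      proof -
        have "d_G x' y' \<le> norm (y' - x') / H"
          by (rule d_G_segment) (auto simp: x'_def y'_def H)
        also have "y' - x' = (flow_base v y - n, 0)"
          by (simp add: y'_def x'_def x_def algebra_simps)
        also have "norm (flow_base v y - n, 0 :: real) / H \<le> (C\<^sub>1 * d) / H"
          using n yb H by (intro divide_right_mono) (auto simp: norm_Pair dist_norm norm_minus_commute subset_iff)
        also have "\<dots> = C\<^sub>1 * (d / a) / exp t" by (simp add: H_def)
        also have "\<dots> \<le> C\<^sub>1 * (lam * exp 2 * s * exp t) / exp t"
          using t C1_ge by (intro divide_right_mono mult_left_mono) auto
        finally show ?thesis by (simp add: mult_ac)
      qed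
      have 3: "d_G y' y \<le> (1 + norm v) * (s + \<gamma> * s)"
      proof -
        have "y = (fst y' + (snd y - snd y') *\<^sub>R v, snd y)"
          by (simp add: y'_def flow_base_def prod_eq_iff algebra_simps)
        then have "d_G y' y \<le> (1 + norm v) * \<bar>ln (snd y / snd y')\<bar>"
          using d_G_flow_line[of y' "snd y" v] ypos H by (simp add: y'_def)
        also have "\<dots> \<le> (1 + norm v) * (s + \<gamma> * s)"
        proof (rule mult_left_mono)
          have "ln a - s < ln (snd y)" "ln (snd y) < ln a + s"
            using yh ypos a r ln_less_cancel_iff[of "a / r" "snd y"] ln_less_cancel_iff[of "snd y" "a * r"]
            by (simp_all add: ln_div ln_mult s_def)
          moreover have "ln (snd y / snd y') = ln (snd y) - ln a - t"
            using ypos a by (simp add: y'_def H_def ln_div ln_mult)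
          ultimately show "\<bar>ln (snd y / snd y')\<bar> \<le> s + \<gamma> * s" using t s by linarith
        qed simp
        finally show ?thesis .
      qed
      have "d_G x y \<le> d_G x x' + (d_G x' y' + d_G y' y)"
        using d_G_triangle[of x x' y] d_G_triangle[of x' y' y] a H ypos
        by (simp add: x_def x'_def y'_def)
      also have "\<dots> \<le> K * s" using 1 2 3 by (simp add: K_def algebra_simps)
      also have "\<dots> < (2 * K + 2) * (s / 2)" using s by (simp add: algebra_simps)
      finally show "d_G x y < (2 * K + 2) * (s / 2)" .
    qed
    then have "cyl P \<subseteq> {y \<in> G_carrier. d_G x y < (2 * K + 2) * (s / 2)}" by blast
    moreover have "x \<in> G_carrier" using a by (simp add: x_def carrier_iff)
    ultimately show ?thesis unfolding eq s_def by auto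
  qed
  then show ?thesis using that[of "2 * K + 2"] K by simp
qed

text \<open>Passing to a son multiplies this quantity by at most $\max(\delta, 1/2)$, whichever kind of son
  it is.\<close>

fun cyl_size :: "'m cyl \<Rightarrow> real" where "cyl_size (r, (k, Q), a) = \<delta> powi k * ln r"

lemma cyl_size_pos: "adm P \<Longrightarrow> 0 < cyl_size P"
  by (erule adm_facts) (simp add: \<delta>_powi)

text \<open>For \<open>s = ln r > 1\<close>, admissibility makes the cube larger than the height of
  \<open>x\<close>, so a small \<open>cyl_size\<close> forces a small cylinder. There the cube has
  size comparable to \<open>snd x * s\<close>, hence \<open>cyl_size\<close> is comparable to
  \<open>snd x * s\<^sup>2\<close>, and the diameter of the cylinder is at most a multiple of
  \<open>s\<close>.\<close>

lemma cyl_subset_open: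
  assumes x: "x \<in> G_carrier" and U: "open U" "x \<in> U"
  obtains w where "0 < w" "\<And>P. adm P \<Longrightarrow> x \<in> cyl P \<Longrightarrow> cyl_size P < w \<Longrightarrow> cyl P \<subseteq> U"
proof -
  obtain e where e: "0 < e" "\<And>y. dist y x < e \<Longrightarrow> y \<in> U" using U unfolding open_dist by blast
  define h where "h = snd x"
  have h: "0 < h" using x by (simp add: h_def carrier_iff)
  \<comment> \<open>Divided by \<open>s\<close>: twice the bound on the radius of the cube, and the
    range of heights times a bound for \<open>norm (v, 1)\<close>.\<close>
  define K where "K = 2 * C\<^sub>1 * lam * h * exp 3 + (1 + norm v) * (2 * h * exp 2)"
  have "0 < (1 + norm v) * (2 * h * exp 2)" using h by (simp add: add_pos_nonneg)
  moreover have "0 \<le> 2 * C\<^sub>1 * lam * h * exp 3" using h C1_ge lam_pos by simp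
  ultimately have K: "0 < K" unfolding K_def by linarith
  \<comment> \<open>The first bound excludes \<open>s > 1\<close>, where \<open>d * s > h\<close>;
    the second turns \<open>h * s\<^sup>2 \<le> d * s\<close> into \<open>s < e / K\<close>.\<close>
  define w where "w = min h (h * (e / K)\<^sup>2)"
  have "0 < w" using h e K by (simp add: w_def)
  moreover have "cyl P \<subseteq> U" if P: "adm P" and xP: "x \<in> cyl P" and W: "cyl_size P < w" for P
  proof
    obtain r k Q a where eq: "P = (r, (k, Q), a)" and r: "1 < r" and a: "0 < a" and Q: "Q \<in> \<Q> k"
      and ar: "a / r < a" "a < a * r" using P by (rule adm_facts)
    define s where "s = ln r"
    have s: "0 < s" "r = exp s" using r by (auto simp: s_def)
    define d where "d = \<delta> powi k"
    have d: "0 < d" using \<delta>_powi by (simp add: d_def)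
    have log: "log_admissible lam \<gamma> s (d / a)" using adm_log[OF P[unfolded eq]] by (simp add: s_def d_def)
    have Ws: "d * s < w" using W by (simp add: eq d_def s_def)
    have xb: "flow_base v x \<in> Q" and xh: "a / r < h" "h < a * r"
      using xP mem_cyl[OF P] by (auto simp: eq h_def)
    have "s \<le> 1"
    proof (rule ccontr)
      assume "\<not> s \<le> 1"
      then have s1: "1 < s" and "exp (2 * s) \<le> d / a" using log by (auto simp: log_admissible_def)
      then have "a * exp (2 * s) \<le> d" using a by (simp add: field_simps)
      moreover have "a * r \<le> a * exp (2 * s)" using a s by simp
      moreover have "d \<le> d * s" using d s1 by simp
      ultimately show False using xh(2) Ws by (simp add: w_def)
    qed
    then have d1: "exp 2 * s \<le> d / a" and d2: "d / a \<le> lam * exp 2 * s"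
      using log by (auto simp: log_admissible_def)
    have re: "r \<le> exp 1" using \<open>s \<le> 1\<close> s by simp
    have ah: "a \<le> h * exp 1"
    proof -
      have "a < h * r" using xh(1) r by (simp add: divide_less_eq)
      also have "\<dots> \<le> h * exp 1" using re h by (intro mult_left_mono) auto
      finally show ?thesis by simp
    qed
    have ha: "h \<le> a * exp 2"
    proof -
      have "a * r \<le> a * exp 2" using a s \<open>s \<le> 1\<close> by simp
      then show ?thesis using xh(2) by linarith
    qed
    have sK: "s < e / K"
    proof (rule power2_less_imp_less)
      have "h * s\<^sup>2 \<le> (a * exp 2) * s\<^sup>2" using ha by (rule mult_right_mono) simp
      also have "\<dots> = (exp 2 * s) * a * s" by (simp add: power2_eq_square mult_ac)
      also have "\<dots> \<le> d * s" using d1 a s by (intro mult_right_mono) (auto simp: field_simps)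
      also have "\<dots> < h * (e / K)\<^sup>2" using Ws by (simp add: w_def)
      finally show "s\<^sup>2 < (e / K)\<^sup>2" using h by simp
    qed (use e K in simp)
    have dle: "d \<le> lam * h * exp 3 * s"
    proof -
      have "d \<le> a * (lam * exp 2 * s)" using d2 a by (simp add: field_simps)
      also have "\<dots> \<le> (h * exp 1) * (lam * exp 2 * s)"
        using ah lam_pos s by (intro mult_right_mono) auto
      also have "\<dots> = lam * h * (exp 1 * exp 2) * s" by (simp only: mult_ac)
      also have "exp 1 * exp 2 = (exp 3 :: real)" by (simp flip: exp_add)
      finally show ?thesis .
    qed
    have hh: "a * r - a / r \<le> 2 * h * exp 2 * s"
    proof -
      have i1: "1 - s \<le> exp (- s)" using exp_ge_add_one_self[of "- s"] by simp
      have "exp s * (1 - s) \<le> exp s * exp (- s)" using i1 by (rule mult_left_mono) simp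
      then have "exp s - 1 \<le> exp s * s" by (simp add: right_diff_distrib flip: exp_add)
      also have "\<dots> \<le> exp 1 * s" using \<open>s \<le> 1\<close> s by (intro mult_right_mono) auto
      finally have i2: "exp s - 1 \<le> exp 1 * s" .
      have "s \<le> exp 1 * s" using s by simp
      then have "exp s - exp (- s) \<le> 2 * exp 1 * s" using i1 i2 by linarith
      then have "a * (exp s - exp (- s)) \<le> (h * exp 1) * (2 * exp 1 * s)"
        using ah a s h \<open>s \<le> 1\<close> by (intro mult_mono) auto
      also have "\<dots> = 2 * h * (exp 1 * exp 1) * s" by (simp only: mult_ac)
      also have "exp 1 * exp 1 = (exp 2 :: real)" by (simp flip: exp_add)
      finally show ?thesis using s(2) by (simp add: exp_minus divide_inverse right_diff_distrib)
    qed
    obtain n where n: "Q \<subseteq> ball n (C\<^sub>1 * d)" using centre_\<Q>[OF Q] d_def by blast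
    fix y assume "y \<in> cyl P"
    then have yb: "flow_base v y \<in> Q" and yh: "a / r < snd y" "snd y < a * r"
      using mem_cyl[OF P] by (auto simp: eq)
    have "dist (flow_base v y) (flow_base v x) < 2 * (C\<^sub>1 * d)"
    proof -
      have "dist n (flow_base v y) < C\<^sub>1 * d" "dist n (flow_base v x) < C\<^sub>1 * d"
        using n xb yb by (auto simp: subset_iff)
      then show ?thesis using dist_triangle[of "flow_base v y" "flow_base v x" n]
        by (simp add: dist_commute)
    qed
    moreover have "\<bar>snd y - snd x\<bar> \<le> a * r - a / r" using yh xh by (auto simp: h_def)
    moreover have "y - x = (flow_base v y - flow_base v x, 0) + (snd y - snd x) *\<^sub>R (v, 1)"
      by (simp add: flow_base_def prod_eq_iff algebra_simps)
    then have "dist y x \<le> dist (flow_base v y) (flow_base v x) + \<bar>snd y - snd x\<bar> * norm (v, 1 :: real)"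
      using norm_triangle_ineq[of "(flow_base v y - flow_base v x, 0 :: real)" "(snd y - snd x) *\<^sub>R (v, 1)"]
      by (simp add: dist_norm norm_Pair[of _ 0] del: scaleR_Pair)
    moreover have "\<bar>snd y - snd x\<bar> * norm (v, 1 :: real) \<le> (a * r - a / r) * (1 + norm v)"
      using norm_Pair_le[of v "1 :: real"] calculation(2) by (intro mult_mono) auto
    moreover have "(a * r - a / r) * (1 + norm v) \<le> (2 * h * exp 2 * s) * (1 + norm v)"
      using hh by (intro mult_right_mono) auto
    moreover have "2 * (C\<^sub>1 * d) \<le> 2 * (C\<^sub>1 * (lam * h * exp 3 * s))"
      using dle C1_ge by (intro mult_left_mono) auto
    ultimately have "dist y x < 2 * (C\<^sub>1 * (lam * h * exp 3 * s)) + (2 * h * exp 2 * s) * (1 + norm v)"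
      by linarith
    also have "\<dots> = K * s" by (simp add: K_def algebra_simps)
    also have "\<dots> < e" using sK K by (simp add: field_simps)
    finally show "y \<in> U" by (rule e)
  qed
  ultimately show ?thesis using that by blast
qed

declare cyl_set.simps [simp del]

section \<open>Tilings by admissible cylinders\<close>

lemma adm_iff_log:
  assumes "0 < r" "0 < a" "Q \<in> \<Q> k"
  shows "adm (r, (k, Q), a) \<longleftrightarrow> log_admissible lam \<gamma> (ln r) (\<delta> powi k / a)"
  using admissible_iff[of r a] assms by blast

lemma adm_horizontal_son:
  assumes P: "adm (r, (k, Q), a)" and Q': "Q' \<in> \<Q> (k + 1)"
    and not: "\<not> (adm (sqrt r, (k, Q), a / sqrt r) \<and> adm (sqrt r, (k, Q), a * sqrt r))"
  shows "adm (r, (k + 1, Q'), a)"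
proof -
  note p = admissible_pos[OF P]
  have r: "0 < r" "0 < sqrt r" using p by simp_all
  have l: "ln (sqrt r) = ln r / 2" using r(1) by (simp add: ln_sqrt)
  have sqrt_exp: "sqrt r = exp (ln r / 2)" using exp_ln[OF r(2)] unfolding l by simp
  have "log_admissible lam \<gamma> (ln r) (\<delta> * (\<delta> powi k / a))"
  proof (rule log_admissible_sons[OF \<delta> lam_gt \<gamma>_ge])
    show "log_admissible lam \<gamma> (ln r) (\<delta> powi k / a)" by (rule adm_log[OF P])
    \<comment> \<open>Dividing \<open>a\<close> by \<open>sqrt r\<close> multiplies the parameter by
      \<open>exp (ln r / 2)\<close>, and conversely for the upper half.\<close>
    have e: "\<delta> powi k / (a / sqrt r) = \<delta> powi k / a * exp (ln r / 2)"
      "\<delta> powi k / (a * sqrt r) = \<delta> powi k / a * exp (- (ln r / 2))"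
      unfolding sqrt_exp exp_minus divide_inverse inverse_mult_distrib inverse_inverse_eq
      by (simp_all only: mult.assoc)
    have "0 < a / sqrt r" "0 < a * sqrt r" using p r by simp_all
    then show "\<not> (log_admissible lam \<gamma> (ln r / 2) (\<delta> powi k / a * exp (ln r / 2)) \<and>
        log_admissible lam \<gamma> (ln r / 2) (\<delta> powi k / a * exp (- (ln r / 2))))"
      using not adm_iff_log[OF r(2) _ p(3)] unfolding l e[symmetric] by blast
  qed
  then show ?thesis using p Q' r adm_iff_log[of r a Q' "k + 1"] \<delta>_powi by simp
qed

lemma son_cases:
  assumes P: "adm (r, (k, Q), a)" and P': "P' \<in> sons \<Q> \<delta> lam \<gamma> (r, (k, Q), a)"
  obtains (low) "P' = (sqrt r, (k, Q), a / sqrt r)" "adm P'"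
  | (high) "P' = (sqrt r, (k, Q), a * sqrt r)" "adm P'"
  | (horizontal) Q' where "P' = (r, (k + 1, Q'), a)" "adm P'" "Q' \<in> \<Q> (k + 1)" "Q' \<subseteq> Q"
proof (cases "adm (sqrt r, (k, Q), a / sqrt r) \<and> adm (sqrt r, (k, Q), a * sqrt r)")
  case True
  then show ?thesis using P' low high by auto
next
  case False
  then have "P' \<in> {(r, q', a) | q'. q' \<in> s_N \<Q> (k, Q)}" using P' by (simp only: sons.simps if_False)
  then obtain Q' where "P' = (r, (k + 1, Q'), a)" "Q' \<in> \<Q> (k + 1)" "Q' \<subseteq> Q"
    using s_N_eq[of Q k] admissible_pos[OF P] by auto
  then show ?thesis using adm_horizontal_son[OF P _ False] horizontal by blast
qed

lemma heights_halves:
  assumes "1 < r"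
  shows "heights (sqrt r, q, a / sqrt r) = {a / r <..< a}"
    and "heights (sqrt r, q, a * sqrt r) = {a <..< a * r}"
proof -
  have "a / t / t = a / (t * t)" "a / t * t = a" "a * t / t = a" "a * t * t = a * (t * t)"
    if "t \<noteq> 0" for t :: real using that by simp_all
  from this[of "sqrt r"] have "a / sqrt r / sqrt r = a / r" "a / sqrt r * sqrt r = a"
    "a * sqrt r / sqrt r = a" "a * sqrt r * sqrt r = a * r"
    using assms by simp_all
  then show "heights (sqrt r, q, a / sqrt r) = {a / r <..< a}"
    "heights (sqrt r, q, a * sqrt r) = {a <..< a * r}"
    by (simp_all only: heights.simps)
qed

text \<open>A vertical son has half the logarithmic radius over the same cube; a horizontal son
  loses at most the factor \<open>C\<^sub>1\<close> that relates a cube to its parent.\<close>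

lemma son_facts:
  assumes P: "adm P" and P': "P' \<in> sons \<Q> \<delta> lam \<gamma> P"
  shows "adm P'" "heights P' \<subseteq> heights P" "cyl P' \<subseteq> cyl P"
    "emeasure \<mu> (cyl P) \<le> ennreal C\<^sub>1 * emeasure \<mu> (cyl P')"
    "cyl_size P' \<le> max \<delta> (1 / 2) * cyl_size P"
proof -
  obtain r k Q a where eq: "P = (r, (k, Q), a)" and r: "1 < r" and a: "0 < a" and Q: "Q \<in> \<Q> k"
    and ar: "a / r < a" "a < a * r" using P by (rule adm_facts)
  have W: "0 \<le> cyl_size P" using cyl_size_pos[OF P] by simp
  note son = P'[unfolded eq]
  from P[unfolded eq] son show adm': "adm P'" by (rule son_cases)
  from P[unfolded eq] son show h: "heights P' \<subseteq> heights P"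
  proof (rule son_cases)
    assume "P' = (sqrt r, (k, Q), a / sqrt r)"
    then have "heights P' = {a / r <..< a}" by (simp only: heights_halves[OF r])
    then show ?thesis using ar by (auto simp: eq)
  next
    assume "P' = (sqrt r, (k, Q), a * sqrt r)"
    then have "heights P' = {a <..< a * r}" by (simp only: heights_halves[OF r])
    then show ?thesis using ar by (auto simp: eq)
  qed (auto simp: eq)
  from P[unfolded eq] son have "cube P' \<subseteq> cube P"
    by (rule son_cases) (auto simp: eq)
  then show "cyl P' \<subseteq> cyl P" using h mem_cyl[OF P] mem_cyl[OF adm'] by blast
  from P[unfolded eq] son show "emeasure \<mu> (cyl P) \<le> ennreal C\<^sub>1 * emeasure \<mu> (cyl P')"
  proof (rule son_cases)
    fix Q' assume P'eq: "P' = (r, (k + 1, Q'), a)" and "adm P'" and Q': "Q' \<in> \<Q> (k + 1)" "Q' \<subseteq> Q"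
    then have "p_N \<Q> (k + 1, Q') = (k, Q)" using p_N_eq[of Q' "k + 1" Q] Q by simp
    then show ?thesis
      using emeasure_cyl_across(1)[of r "k + 1" Q' a] adm' P unfolding P'eq eq by simp
  qed (use emeasure_cyl_le[OF P adm'] r in \<open>auto simp: eq ln_sqrt\<close>)
  have m: "\<delta> * cyl_size P \<le> max \<delta> (1 / 2) * cyl_size P"
    "1 / 2 * cyl_size P \<le> max \<delta> (1 / 2) * cyl_size P"
    using W by (intro mult_right_mono; simp)+
  from P[unfolded eq] son show "cyl_size P' \<le> max \<delta> (1 / 2) * cyl_size P"
    by (rule son_cases) (use m \<delta>_powi(2)[of k] r in \<open>auto simp: eq ln_sqrt\<close>)
qed

lemma sons_disjoint:
  assumes P: "adm P" and s: "P1 \<in> sons \<Q> \<delta> lam \<gamma> P" "P2 \<in> sons \<Q> \<delta> lam \<gamma> P" and x: "x \<in> cyl P1" "x \<in> cyl P2"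
  shows "P1 = P2"
proof -
  obtain r k Q a where eq: "P = (r, (k, Q), a)" and r: "1 < r" and a: "0 < a" and Q: "Q \<in> \<Q> k"
    and ar: "a / r < a" "a < a * r" using P by (rule adm_facts)
  note adms = son_facts(1)[OF P s(1)] son_facts(1)[OF P s(2)]
  show ?thesis
  proof (cases "adm (sqrt r, (k, Q), a / sqrt r) \<and> adm (sqrt r, (k, Q), a * sqrt r)")
    case True
    define A1 A2 where A: "A1 = (sqrt r, (k, Q), a / sqrt r)" "A2 = (sqrt r, (k, Q), a * sqrt r)"
    have "x \<notin> cyl A1 \<or> x \<notin> cyl A2"
      using True mem_cyl unfolding A
      by (auto simp: heights_halves[OF r] simp del: heights.simps)
    moreover have "sons \<Q> \<delta> lam \<gamma> P = {A1, A2}" using True by (simp add: eq A)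
    ultimately show ?thesis using s x by auto
  next
    case False
    then have "sons \<Q> \<delta> lam \<gamma> P = {(r, q', a) | q'. q' \<in> s_N \<Q> (k, Q)}" by (simp only: eq sons.simps if_False)
    then obtain Q1 Q2 where e: "P1 = (r, (k + 1, Q1), a)" "P2 = (r, (k + 1, Q2), a)"
        "Q1 \<in> \<Q> (k + 1)" "Q2 \<in> \<Q> (k + 1)"
      using s s_N_eq[OF Q] by auto
    then show ?thesis using x adms mem_cyl \<Q>_disjoint[OF e(3,4), of "flow_base v x"] by simp
  qed
qed

lemma countable_sons:
  assumes P: "adm P"
  shows "countable (sons \<Q> \<delta> lam \<gamma> P)"
proof -
  obtain r k Q a where eq: "P = (r, (k, Q), a)" and Q: "Q \<in> \<Q> k" using P by (rule adm_facts)
  have "sons \<Q> \<delta> lam \<gamma> P \<subseteq> {(sqrt r, (k, Q), a / sqrt r), (sqrt r, (k, Q), a * sqrt r)} \<union>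
      (\<lambda>Q'. (r, (k + 1, Q'), a)) ` \<Q> (k + 1)"
    by (auto simp: eq s_N_eq[OF Q])
  then show ?thesis by (rule countable_subset) (use countable_\<Q> in auto)
qed

text \<open>The points left out lie at the height that divides the two vertical halves or over the
  gaps between cubes; both sets are null.\<close>

lemma sons_cover:
  assumes P: "adm P" and x: "x \<in> cyl P" "\<And>k. flow_base v x \<in> \<Union>(\<Q> k)" "snd x \<noteq> snd (snd P)"
  shows "\<exists>P'\<in>sons \<Q> \<delta> lam \<gamma> P. x \<in> cyl P'"
proof -
  obtain r k Q a where eq: "P = (r, (k, Q), a)" and r: "1 < r" and a: "0 < a" and Q: "Q \<in> \<Q> k"
    and ar: "a / r < a" "a < a * r" using P by (rule adm_facts)
  have b: "flow_base v x \<in> Q" "a / r < snd x" "snd x < a * r" "snd x \<noteq> a"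
    using x(1,3) mem_cyl[OF P] by (auto simp: eq)
  show ?thesis
  proof (cases "adm (sqrt r, (k, Q), a / sqrt r) \<and> adm (sqrt r, (k, Q), a * sqrt r)")
    case True
    then have "x \<in> cyl (sqrt r, (k, Q), a / sqrt r) \<or> x \<in> cyl (sqrt r, (k, Q), a * sqrt r)"
      using b mem_cyl by (auto simp: heights_halves[OF r] simp del: heights.simps)
    then show ?thesis using True by (auto simp: eq)
  next
    case False
    obtain Q' where Q': "Q' \<in> \<Q> (k + 1)" "flow_base v x \<in> Q'" using x(2) by blast
    then have "Q' \<subseteq> Q" using disjnt_\<Q>[of Q' "k + 1" Q] Q b(1) by (auto simp: disjnt_iff)
    then have "(r, (k + 1, Q'), a) \<in> sons \<Q> \<delta> lam \<gamma> P"
      using False Q' by (auto simp: eq s_N_eq[OF Q])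
    moreover have "x \<in> cyl (r, (k + 1, Q'), a)"
      using mem_cyl[OF adm_horizontal_son[OF P[unfolded eq] Q'(1) False]] Q'(2) b by auto
    ultimately show ?thesis by blast
  qed
qed

text \<open>A partition, up to a null set, of the strip of heights in \<open>B\<close>. All cubes of
  one generation together fill such a strip, so partitions of \<open>G\<close> can be assembled from
  disjoint ranges of heights.\<close>

definition tiles :: "real set \<Rightarrow> 'm cyl set \<Rightarrow> bool" where
  "tiles B F \<longleftrightarrow> countable F \<and> (\<forall>P\<in>F. adm P \<and> heights P \<subseteq> B) \<and>
    (\<forall>P\<in>F. \<forall>P'\<in>F. \<forall>x. x \<in> cyl P \<longrightarrow> x \<in> cyl P' \<longrightarrow> P = P') \<and>
    (AE x in \<mu>. snd x \<in> B \<longrightarrow> (\<exists>P\<in>F. x \<in> cyl P))"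

lemma AE_base: "AE x in \<mu>. \<forall>k. flow_base v x \<in> \<Union>(\<Q> k)"
  unfolding AE_all_countable
proof
  fix k
  have "UNIV - \<Union>(\<Q> k) \<in> null_sets (mu_N \<phi>)"
  proof (rule null_setsI[OF null_\<Q>])
    have "open (\<Union>(\<Q> k))" using open_\<Q> by blast
    then have "\<Union>(\<Q> k) \<in> sets borel" by (rule borel_open)
    then show "UNIV - \<Union>(\<Q> k) \<in> sets (mu_N \<phi>)" by (simp add: borel_comp Compl_eq_Diff_UNIV[symmetric])
  qed
  then have "flow_tile v (UNIV - \<Union>(\<Q> k)) {0<..} \<in> null_sets \<mu>"
    by (rule flow_tile_null_base) auto
  then have "AE x in \<mu>. x \<notin> flow_tile v (UNIV - \<Union>(\<Q> k)) {0<..}" by (rule AE_not_in)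
  then show "AE x in \<mu>. flow_base v x \<in> \<Union>(\<Q> k)"
    using AE_space by eventually_elim (auto simp: flow_tile_def space_\<mu> carrier_iff)
qed

lemma AE_height:
  assumes "countable H" "H \<subseteq> {0<..}"
  shows "AE x in \<mu>. snd x \<notin> H"
proof -
  have "AE x in \<mu>. \<forall>b\<in>H. x \<notin> flow_tile v UNIV {b}"
    using assms flow_tile_null_height by (subst AE_ball_countable) (auto intro!: AE_not_in)
  then show ?thesis by eventually_elim (auto simp: flow_tile_def)
qed

lemma siblings_eq: "siblings \<Q> (r, (j, Q), a) = (\<lambda>Q'. (r, (j, Q'), a)) ` \<Q> j"
  by auto

lemma tiles_siblings:
  assumes P: "adm P"
  shows "tiles (heights P) (siblings \<Q> P)"
proof -
  obtain r k Q a where eq: "P = (r, (k, Q), a)" and r: "1 < r" and a: "0 < a" and Q: "Q \<in> \<Q> k"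
    using P by (rule adm_facts)
  have A: "adm (r, (k, Q'), a)" if "Q' \<in> \<Q> k" for Q'
    using adm_log[OF P[unfolded eq]] adm_iff_log[of r a Q' k] r a that by simp
  show ?thesis
    unfolding tiles_def
  proof (intro conjI ballI allI impI)
    show "countable (siblings \<Q> P)" using countable_\<Q> unfolding eq siblings_eq by blast
    show "adm P'" "heights P' \<subseteq> heights P" if "P' \<in> siblings \<Q> P" for P'
      using that A by (auto simp: eq)
    show "P1 = P2" if P12: "P1 \<in> siblings \<Q> P" "P2 \<in> siblings \<Q> P" and x: "x \<in> cyl P1" "x \<in> cyl P2" for P1 P2 x
    proof -
      obtain Q1 Q2 where e: "P1 = (r, (k, Q1), a)" "P2 = (r, (k, Q2), a)" "Q1 \<in> \<Q> k" "Q2 \<in> \<Q> k"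
        using P12 unfolding eq siblings_eq by blast
      then show ?thesis using x mem_cyl A \<Q>_disjoint[OF e(3,4), of "flow_base v x"] by simp
    qed
    show "AE x in \<mu>. snd x \<in> heights P \<longrightarrow> (\<exists>P\<in>siblings \<Q> P. x \<in> cyl P)"
      using AE_base
    proof (eventually_elim, intro impI)
      fix x assume "\<forall>k. flow_base v x \<in> \<Union>(\<Q> k)" and h: "snd x \<in> heights P"
      then obtain Q' where Q': "Q' \<in> \<Q> k" "flow_base v x \<in> Q'" by blast
      then have "x \<in> cyl (r, (k, Q'), a)" using mem_cyl[OF A] h by (simp add: eq)
      then show "\<exists>P\<in>siblings \<Q> P. x \<in> cyl P" using Q'(1) unfolding eq siblings_eq by blast
    qed
  qed
qed

lemma tiles_sons:
  assumes T: "tiles B F"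
  shows "tiles B (\<Union>P\<in>F. sons \<Q> \<delta> lam \<gamma> P)"
proof -
  have c: "countable F" and A: "\<And>P. P \<in> F \<Longrightarrow> adm P" and h: "\<And>P. P \<in> F \<Longrightarrow> heights P \<subseteq> B"
    and d: "\<And>P P' x. P \<in> F \<Longrightarrow> P' \<in> F \<Longrightarrow> x \<in> cyl P \<Longrightarrow> x \<in> cyl P' \<Longrightarrow> P = P'"
    and AE: "AE x in \<mu>. snd x \<in> B \<longrightarrow> (\<exists>P\<in>F. x \<in> cyl P)"
    using T unfolding tiles_def by blast+
  show ?thesis
    unfolding tiles_def
  proof (intro conjI ballI allI impI)
    show "countable (\<Union>P\<in>F. sons \<Q> \<delta> lam \<gamma> P)" using c countable_sons A by blast
    show "adm P'" "heights P' \<subseteq> B" if "P' \<in> (\<Union>P\<in>F. sons \<Q> \<delta> lam \<gamma> P)" for P'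
      using that son_facts(1,2) A h by blast+
    show "P1 = P2" if P12: "P1 \<in> (\<Union>P\<in>F. sons \<Q> \<delta> lam \<gamma> P)" "P2 \<in> (\<Union>P\<in>F. sons \<Q> \<delta> lam \<gamma> P)"
      and x: "x \<in> cyl P1" "x \<in> cyl P2" for P1 P2 x
    proof -
      obtain P P' where P: "P \<in> F" "P1 \<in> sons \<Q> \<delta> lam \<gamma> P" "P' \<in> F" "P2 \<in> sons \<Q> \<delta> lam \<gamma> P'"
        using P12 by blast
      then have "P = P'" using d[of P P' x] son_facts(3)[OF A] x by blast
      then show ?thesis using sons_disjoint[OF A] P x by blast
    qed
    \<comment> \<open>The dividing heights of countably many cylinders carry no mass.\<close>
    have "AE x in \<mu>. snd x \<notin> (\<lambda>P. snd (snd P)) ` F"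
      using c admissible_pos(2) A by (intro AE_height) force+
    then show "AE x in \<mu>. snd x \<in> B \<longrightarrow> (\<exists>P\<in>\<Union>P\<in>F. sons \<Q> \<delta> lam \<gamma> P. x \<in> cyl P)"
      using AE AE_base
    proof (eventually_elim, intro impI)
      fix x assume x: "snd x \<notin> (\<lambda>P. snd (snd P)) ` F" "snd x \<in> B \<longrightarrow> (\<exists>P\<in>F. x \<in> cyl P)"
        "\<forall>k. flow_base v x \<in> \<Union>(\<Q> k)" "snd x \<in> B"
      then obtain P where P: "P \<in> F" "x \<in> cyl P" by blast
      then have "\<exists>P'\<in>sons \<Q> \<delta> lam \<gamma> P. x \<in> cyl P'" using sons_cover[OF A, of P x] x by blast
      then show "\<exists>P\<in>\<Union>P\<in>F. sons \<Q> \<delta> lam \<gamma> P. x \<in> cyl P" using P by blast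
    qed
  qed
qed

lemma tiles_sons_pow: "tiles B F \<Longrightarrow> tiles B (\<Union>P\<in>F. sons_pow \<Q> \<delta> lam \<gamma> n P)"
proof (induction n)
  case (Suc n)
  have "(\<Union>P\<in>F. sons_pow \<Q> \<delta> lam \<gamma> (Suc n) P) =
      (\<Union>P'\<in>(\<Union>P\<in>F. sons_pow \<Q> \<delta> lam \<gamma> n P). sons \<Q> \<delta> lam \<gamma> P')"
    by auto
  then show ?case using tiles_sons[OF Suc.IH[OF Suc.prems]] by simp
qed simp

lemma tiles_UN:
  fixes B :: "nat \<Rightarrow> real set"
  assumes T: "\<And>n. tiles (B n) (F n)" and dis: "\<And>m n. m < n \<Longrightarrow> B m \<inter> B n = {}"
  shows "tiles (\<Union>n. B n) (\<Union>n. F n)"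
proof -
  have c: "countable (F n)" and A: "P \<in> F n \<Longrightarrow> adm P" and h: "P \<in> F n \<Longrightarrow> heights P \<subseteq> B n"
    and d: "P \<in> F n \<Longrightarrow> P' \<in> F n \<Longrightarrow> x \<in> cyl P \<Longrightarrow> x \<in> cyl P' \<Longrightarrow> P = P'"
    and AE: "AE x in \<mu>. snd x \<in> B n \<longrightarrow> (\<exists>P\<in>F n. x \<in> cyl P)" for n P P' x
    using T[of n] unfolding tiles_def by blast+
  show ?thesis
    unfolding tiles_def
  proof (intro conjI ballI allI impI)
    show "countable (\<Union>n. F n)" using c by blast
    show "adm P" "heights P \<subseteq> (\<Union>n. B n)" if "P \<in> (\<Union>n. F n)" for P using that A h by blast+
    show "P1 = P2" if P12: "P1 \<in> (\<Union>n. F n)" "P2 \<in> (\<Union>n. F n)" and x: "x \<in> cyl P1" "x \<in> cyl P2" for P1 P2 x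
    proof -
      obtain m n where mn: "P1 \<in> F m" "P2 \<in> F n" using P12 by blast
      then have "snd x \<in> B m" "snd x \<in> B n"
        using x mem_cyl[OF A[OF mn(1)]] mem_cyl[OF A[OF mn(2)]] h by blast+
      then have "m = n" using dis[of m n] dis[of n m] by (cases m n rule: linorder_cases) auto
      then show ?thesis using d mn x by blast
    qed
    have "AE x in \<mu>. \<forall>n. snd x \<in> B n \<longrightarrow> (\<exists>P\<in>F n. x \<in> cyl P)" using AE by (simp add: AE_all_countable)
    then show "AE x in \<mu>. snd x \<in> (\<Union>n. B n) \<longrightarrow> (\<exists>P\<in>\<Union>n. F n. x \<in> cyl P)"
      by eventually_elim blast
  qed
qed

end

section \<open>The ancestors\<close>

locale dyadic_cylinders = christ_flow v \<mu> \<phi> \<Q> \<delta> C\<^sub>1 c \<gamma> lam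
  for v :: "real^'m::finite" and \<mu> \<phi> \<Q> \<delta> C\<^sub>1 c \<gamma> lam +
  fixes r\<^sub>0 :: real and Q\<^sub>0 :: "'m cube"
  assumes large\<^sub>0: "large_admissible \<Q> \<delta> lam \<gamma> (r\<^sub>0, Q\<^sub>0, 1)"
begin

definition anc :: "nat \<Rightarrow> 'm cyl" where
  "anc k = fst (ancestor \<Q> \<delta> lam \<gamma> (r\<^sub>0, Q\<^sub>0, 1) k)"

definition up :: "nat \<Rightarrow> bool" where
  "up k = snd (ancestor \<Q> \<delta> lam \<gamma> (r\<^sub>0, Q\<^sub>0, 1) k)"

definition vertical :: "nat \<Rightarrow> bool" where
  "vertical k \<longleftrightarrow> \<not> adm (p_across \<Q> (anc k))"

lemma anc_0: "anc 0 = (r\<^sub>0, Q\<^sub>0, 1)"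
  by (simp add: anc_def)

lemma anc_Suc: "anc (Suc k) = (if \<not> vertical k then p_across \<Q> (anc k)
    else if up k then p_up (anc k) else p_down (anc k))"
  and up_Suc: "up (Suc k) = (if \<not> vertical k then up k else \<not> up k)"
  by (auto simp: anc_def up_def vertical_def split: prod.split)

text \<open>If the step to the parent cube fails, it can only violate the upper bound, as the
  parameter \<open>D\<close> grows. Hence
  \<open>D > \<delta> * lam * exp (\<gamma> * s) \<ge> exp (5 * s)\<close>, far above the required
  \<open>exp (2 * s)\<close>. This slack permits logarithmic radius \<open>p * s\<close> and
  parameter \<open>D * exp (q * s)\<close>: the lower bound needs \<open>2 * p - q \<le> 5\<close>,
  the upper one \<open>\<gamma> + q \<le> p * \<gamma>\<close>.\<close>

lemma stretched_adm:
  assumes P: "adm (r, (k, Q), a)" and r: "1 < ln r"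
    and not: "\<not> adm (p_across \<Q> (r, (k, Q), a))"
    and p: "1 \<le> p" "2 * p - q \<le> 5" "\<gamma> + q \<le> p * \<gamma>" and b: "0 < b" "b * exp (q * ln r) = a"
    and r': "0 < r'" "ln r' = p * ln r"
  shows "adm (r', (k, Q), b)"
proof -
  note pos = admissible_pos[OF P]
  define s where "s = ln r"
  define D where "D = \<delta> powi k / a"
  have s: "1 < s" "r = exp s" using r pos by (simp_all add: s_def)
  have D: "exp (2 * s) \<le> D" "D \<le> lam * exp (\<gamma> * s)"
    using adm_log[OF P] s(1) by (auto simp: log_admissible_def D_def s_def)
  obtain Q' where Q': "p_N \<Q> (k, Q) = (k - 1, Q')" "Q' \<in> \<Q> (k - 1)" "Q \<subseteq> Q'"
    using p_N_obtain[OF pos(3)] .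
  have "\<not> log_admissible lam \<gamma> s (\<delta> powi (k - 1) / a)"
    using not adm_iff_log[of r a Q' "k - 1"] pos Q' by (simp add: s_def)
  moreover have "D \<le> \<delta> powi (k - 1) / a"
  proof -
    have "\<delta> powi k \<le> 1 * \<delta> powi (k - 1)"
      using \<delta> \<delta>_powi(1)[of "k - 1"] unfolding \<delta>_powi(3)[of k, symmetric] by (intro mult_right_mono) auto
    then show ?thesis using pos unfolding D_def by (intro divide_right_mono) auto
  qed
  ultimately have "lam * exp (\<gamma> * s) < \<delta> powi (k - 1) / a"
    using s D by (auto simp: log_admissible_def not_le)
  then have "\<delta> * (lam * exp (\<gamma> * s)) < \<delta> * (\<delta> powi (k - 1) / a)"
    using \<delta> by (intro mult_strict_left_mono) auto
  also have "\<dots> = D" using \<delta>_powi(3)[of k] by (simp add: D_def)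
  finally have "\<delta> * lam * exp (\<gamma> * s) < D" by (simp add: mult.assoc)
  moreover have "1 * exp (5 * s) \<le> \<delta> * lam * exp (\<gamma> * s)"
  proof (rule mult_mono)
    have "(1 :: real) \<le> exp 3" by simp
    then show "1 \<le> \<delta> * lam" using \<delta>_lam by linarith
    show "exp (5 * s) \<le> exp (\<gamma> * s)" using \<gamma>_ge s by simp
    show "0 \<le> \<delta> * lam" using \<delta> lam_pos by simp
  qed simp
  ultimately have key: "exp (5 * s) \<le> D" by linarith
  have Db: "\<delta> powi k / b = D * exp (q * s)"
    using b pos by (simp add: D_def s_def field_simps)
  have "log_admissible lam \<gamma> (p * s) (D * exp (q * s))"
    unfolding log_admissible_def
  proof (intro disjI1 conjI)
    have "1 * s \<le> p * s" using p(1) s(1) by (intro mult_right_mono) auto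
    then show "1 < p * s" using s(1) by linarith
    have "2 * (p * s) \<le> 5 * s + q * s"
      using mult_right_mono[OF p(2), of s] s(1) by (simp add: algebra_simps)
    then have "exp (2 * (p * s)) \<le> exp (5 * s) * exp (q * s)" by (simp flip: exp_add)
    also have "\<dots> \<le> D * exp (q * s)" using key by (rule mult_right_mono) simp
    finally show "exp (2 * (p * s)) \<le> D * exp (q * s)" .
    have "D * exp (q * s) \<le> (lam * exp (\<gamma> * s)) * exp (q * s)" using D(2) by (rule mult_right_mono) simp
    also have "\<dots> = lam * exp ((\<gamma> + q) * s)" by (simp add: distrib_right exp_add)
    also have "\<dots> \<le> lam * exp (\<gamma> * (p * s))"
    proof (intro mult_left_mono)
      have "(\<gamma> + q) * s \<le> (p * \<gamma>) * s" using p(3) s(1) by (intro mult_right_mono) auto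
      then show "exp ((\<gamma> + q) * s) \<le> exp (\<gamma> * (p * s))" by (simp add: mult_ac)
    qed (use lam_pos in simp)
    finally show "D * exp (q * s) \<le> lam * exp (\<gamma> * (p * s))" .
  qed
  then show ?thesis
    using adm_iff_log[OF r'(1) b(1) pos(3)] r'(2) Db by (simp add: s_def)
qed

lemma exp_mult_ln:
  assumes "0 < (r :: real)"
  shows "exp (2 * ln r) = r ^ 2" "exp (3 * ln r) = r ^ 3" "exp (- 2 * ln r) = 1 / r ^ 2"
  using assms exp_of_nat_mult[of 2 "ln r"] exp_of_nat_mult[of 3 "ln r"]
  by (simp_all add: exp_minus divide_inverse)

text \<open>The exponents \<open>(p, q)\<close> are read off from the four operations.
  \<open>p_up\<close> with \<open>(2, -1)\<close> attains \<open>2 * p - q = 5\<close>; the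
  strongest upper condition is that of \<open>down_difference\<close> with \<open>(2, 3)\<close>,
  namely \<open>\<gamma> \<ge> 3\<close>.\<close>

lemma vertical_steps_adm:
  assumes P: "adm P" and r: "1 < log_radius P" and not: "\<not> adm (p_across \<Q> P)"
  shows "adm (p_up P)" "adm (p_down P)" "adm (up_difference P)" "adm (down_difference P)"
proof -
  obtain r k Q a where eq: "P = (r, (k, Q), a)" and r1: "1 < r" and a: "0 < a"
    using P by (rule adm_facts)
  note S = stretched_adm[OF P[unfolded eq] r[unfolded eq log_radius.simps] not[unfolded eq]]
  note e = exp_mult_ln[of r]
  have r0: "0 < r" using r1 by simp
  show "adm (p_up P)" unfolding eq p_up.simps
    by (rule S[of 2 "-1"]) (use r0 a \<gamma>_ge in \<open>auto simp: exp_minus ln_realpow\<close>)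
  show "adm (p_down P)" unfolding eq p_down.simps
    by (rule S[of 3 2]) (use r0 a \<gamma>_ge e in \<open>auto simp: ln_realpow\<close>)
  show "adm (up_difference P)" unfolding eq up_difference.simps
    by (rule S[of 1 "-2"]) (use r0 a \<gamma>_ge e in auto)
  show "adm (down_difference P)" unfolding eq down_difference.simps
    by (rule S[of 2 3]) (use r0 a \<gamma>_ge e in \<open>auto simp: ln_realpow\<close>)
qed

text \<open>Largeness is carried through the induction because vertical steps are controlled for
  large cylinders only; no step decreases the radius.\<close>

lemma anc_adm: "adm (anc k)" and anc_large: "1 < log_radius (anc k)"
proof (induction k)
  case 0
  obtain k Q where Q0: "Q\<^sub>0 = (k, Q)" by (cases Q\<^sub>0)
  show "adm (anc 0)" using large\<^sub>0 by (simp add: anc_0 admissible_def)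
  have "exp 1 < r\<^sub>0" using large\<^sub>0 by (simp add: Q0)
  then have "ln (exp 1) < ln r\<^sub>0" by (subst ln_less_cancel_iff) (auto intro: less_trans[OF exp_gt_zero])
  then show "1 < log_radius (anc 0)" by (simp add: anc_0)
next
  case (Suc k)
  note V = vertical_steps_adm[OF Suc.IH]
  show "adm (anc (Suc k))"
    using V by (auto simp: anc_Suc vertical_def)
  have r: "0 < r" if "1 < ln r" "adm (r, q, a)" for r a :: real and q
    using admissible_pos(1)[of \<Q> \<delta> lam \<gamma> r "fst q" "snd q" a] that by simp
  obtain r q a where eq: "anc k = (r, q, a)" by (metis prod.exhaust)
  then show "1 < log_radius (anc (Suc k))"
    using Suc.IH r[of r q a] by (auto simp: anc_Suc ln_realpow)
qed

text \<open>The logarithm of the upper end \<open>a * r\<close> of \<open>heights (anc k)\<close>;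
  \<open>bot_log\<close> is that of the lower end \<open>a / r\<close>.\<close>

definition top_log :: "nat \<Rightarrow> real" where
  "top_log k = ln (snd (snd (anc k))) + log_radius (anc k)"

definition bot_log :: "nat \<Rightarrow> real" where
  "bot_log k = ln (snd (snd (anc k))) - log_radius (anc k)"

lemma heights_log:
  assumes "adm P" "0 < h"
  shows "h \<in> heights P \<longleftrightarrow>
    ln (snd (snd P)) - log_radius P < ln h \<and> ln h < ln (snd (snd P)) + log_radius P"
proof -
  obtain r k Q a where eq: "P = (r, (k, Q), a)" and r: "1 < r" and a: "0 < a"
    using assms(1) by (rule adm_facts)
  have "a / r < h \<longleftrightarrow> ln (a / r) < ln h" "h < a * r \<longleftrightarrow> ln h < ln (a * r)"
    using assms(2) r a by (subst ln_less_cancel_iff; simp)+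
  then show ?thesis using r a by (simp add: eq ln_div ln_mult)
qed

lemma anc_heights: "0 < h \<Longrightarrow> h \<in> heights (anc k) \<longleftrightarrow> bot_log k < ln h \<and> ln h < top_log k"
  using heights_log[OF anc_adm] by (simp add: top_log_def bot_log_def)

text \<open>The exponents in \<open>p_up\<close> and \<open>p_down\<close> are such that each moves
  one end of the height interval and keeps the other: \<open>(a * r) / r ^ 2 = a / r\<close> and
  \<open>(a / r ^ 2) * r ^ 3 = a * r\<close>.\<close>

lemma anc_step:
  shows "\<not> vertical k \<Longrightarrow> log_radius (anc (Suc k)) = log_radius (anc k) \<and>
      top_log (Suc k) = top_log k \<and> bot_log (Suc k) = bot_log k"
    and "vertical k \<Longrightarrow> up k \<Longrightarrow> log_radius (anc (Suc k)) = 2 * log_radius (anc k) \<and>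
      top_log (Suc k) = top_log k + 2 * log_radius (anc k) \<and> bot_log (Suc k) = bot_log k"
    and "vertical k \<Longrightarrow> \<not> up k \<Longrightarrow> log_radius (anc (Suc k)) = 3 * log_radius (anc k) \<and>
      top_log (Suc k) = top_log k \<and> bot_log (Suc k) = bot_log k - 4 * log_radius (anc k)"
proof -
  obtain r j Q a where eq: "anc k = (r, (j, Q), a)" and r: "1 < r" and a: "0 < a"
    using anc_adm by (rule adm_facts)
  show "\<not> vertical k \<Longrightarrow> log_radius (anc (Suc k)) = log_radius (anc k) \<and>
      top_log (Suc k) = top_log k \<and> bot_log (Suc k) = bot_log k"
    using eq by (simp add: anc_Suc top_log_def bot_log_def)
  show "vertical k \<Longrightarrow> up k \<Longrightarrow> log_radius (anc (Suc k)) = 2 * log_radius (anc k) \<and>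
      top_log (Suc k) = top_log k + 2 * log_radius (anc k) \<and> bot_log (Suc k) = bot_log k"
    using eq r a by (simp add: anc_Suc top_log_def bot_log_def ln_realpow ln_mult)
  show "vertical k \<Longrightarrow> \<not> up k \<Longrightarrow> log_radius (anc (Suc k)) = 3 * log_radius (anc k) \<and>
      top_log (Suc k) = top_log k \<and> bot_log (Suc k) = bot_log k - 4 * log_radius (anc k)"
    using eq r a by (simp add: anc_Suc top_log_def bot_log_def ln_realpow ln_div)
qed

lemma anc_mono:
  "j \<le> k \<Longrightarrow> log_radius (anc j) \<le> log_radius (anc k)"
  "j \<le> k \<Longrightarrow> top_log j \<le> top_log k"
  "j \<le> k \<Longrightarrow> bot_log k \<le> bot_log j"
proof -
  have s: "log_radius (anc n) \<le> log_radius (anc (Suc n)) \<and> top_log n \<le> top_log (Suc n) \<and>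
      bot_log (Suc n) \<le> bot_log n" for n
    using anc_step[of n] anc_large[of n] by (cases "vertical n"; cases "up n") auto
  show "j \<le> k \<Longrightarrow> log_radius (anc j) \<le> log_radius (anc k)"
    by (rule lift_Suc_mono_le) (use s in auto)
  show "j \<le> k \<Longrightarrow> top_log j \<le> top_log k"
    by (rule lift_Suc_mono_le) (use s in auto)
  show "j \<le> k \<Longrightarrow> bot_log k \<le> bot_log j"
    by (rule lift_Suc_antimono_le) (use s in auto)
qed

text \<open>A horizontal step keeps \<open>r\<close> and \<open>a\<close> and multiplies
  \<open>\<delta> powi j / a\<close> by \<open>1 / \<delta> > 1\<close>, so an endless run of them
  would break the upper bound of admissibility.\<close>

lemma vertical_infinite: "\<exists>k'\<ge>k. vertical k'"
proof (rule ccontr)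
  assume "\<not> ?thesis"
  then have nv: "\<not> vertical k'" if "k \<le> k'" for k' using that by blast
  obtain r j Q a where eq: "anc k = (r, (j, Q), a)" and a: "0 < a"
    using anc_adm by (rule adm_facts)
  have anc_n: "\<exists>Q. anc (k + n) = (r, (j - int n, Q), a)" for n
  proof (induction n)
    case (Suc n)
    then obtain Q where "anc (k + n) = (r, (j - int n, Q), a)" by blast
    then show ?case using nv[of "k + n"] by (simp add: anc_Suc p_N_def)
  qed (use eq in auto)
  have le: "\<delta> powi (j - int n) / a \<le> lam * exp (\<gamma> * ln r)" for n
  proof -
    obtain Q where Q: "anc (k + n) = (r, (j - int n, Q), a)" using anc_n by blast
    then have "1 < ln r" using anc_large[of "k + n"] by simp
    then show ?thesis
      using adm_log[OF anc_adm[of "k + n", unfolded Q]] by (auto simp: log_admissible_def)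
  qed
  have "1 < 1 / \<delta>" using \<delta> by simp
  then obtain n where n: "lam * exp (\<gamma> * ln r) * a / \<delta> powi j < (1 / \<delta>) ^ n"
    using real_arch_pow by blast
  have "\<delta> powi (j - int n) = \<delta> powi j * (1 / \<delta>) ^ n"
    using \<delta> by (simp add: power_int_diff power_divide)
  then have "lam * exp (\<gamma> * ln r) * a < \<delta> powi (j - int n)"
    using n \<delta>_powi(1)[of j] by (simp add: divide_less_eq mult.commute)
  then show False using le[of n] a by (simp add: divide_le_eq)
qed

text \<open>The flag survives horizontal steps and flips right after being used. So the next
  vertical step has the current flag and the one after it the opposite flag.\<close>

lemma vertical_flag: "\<exists>k'\<ge>k. vertical k' \<and> up k' = b"
proof -
  have same: "\<exists>k'\<ge>k. vertical k' \<and> up k' = up k" for k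
  proof -
    define P where "P = (\<lambda>n. vertical (k + n))"
    obtain k' where "k \<le> k'" "vertical k'" using vertical_infinite by blast
    then have "P (k' - k)" by (simp add: P_def)
    then have L: "P (LEAST n. P n)" by (rule LeastI)
    have "up (k + n) = up k" if "n \<le> (LEAST n. P n)" for n
      using that
    proof (induction n)
      case (Suc n)
      then have "\<not> P n" using not_less_Least[of n P] by auto
      then show ?case using Suc by (simp add: up_Suc P_def)
    qed simp
    then show ?thesis using L unfolding P_def by (intro exI[of _ "k + (LEAST n. P n)"]) (auto simp: P_def)
  qed
  show ?thesis
  proof (cases "up k = b")
    case True
    then show ?thesis using same by blast
  next
    case False
    obtain k1 where k1: "k \<le> k1" "vertical k1" "up k1 = up k" using same by blast
    then have "up (Suc k1) = b" using False by (simp add: up_Suc)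
    moreover obtain k2 where "Suc k1 \<le> k2" "vertical k2" "up k2 = up (Suc k1)" using same by blast
    ultimately show ?thesis using k1(1) by (intro exI[of _ k2]) auto
  qed
qed

lemma unbounded_of_jumps:
  fixes f :: "nat \<Rightarrow> real"
  assumes mono: "\<And>j k. j \<le> k \<Longrightarrow> f j \<le> f k" and jump: "\<And>k. \<exists>k'\<ge>k. f k' + 1 \<le> f (Suc k')"
  shows "\<exists>K. \<forall>k\<ge>K. R < f k"
proof -
  have "\<exists>k. f 0 + real n \<le> f k" for n
  proof (induction n)
    case (Suc n)
    then obtain k where k: "f 0 + real n \<le> f k" by blast
    obtain k' where "k \<le> k'" "f k' + 1 \<le> f (Suc k')" using jump by blast
    then show ?case using k mono[of k k'] by (intro exI[of _ "Suc k'"]) simp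
  qed auto
  moreover obtain n where "R - f 0 < real n" using reals_Archimedean2 by blast
  ultimately obtain k where "R < f k" by (smt (verit))
  then show ?thesis using mono by (intro exI[of _ k]) (auto intro: less_le_trans)
qed

text \<open>Both kinds of vertical step recur, and each moves its end by at least twice a
  logarithmic radius that exceeds 1.\<close>

lemma anc_unbounded: "\<exists>K. \<forall>k\<ge>K. R < log_radius (anc k) \<and> R < top_log k \<and> bot_log k < - R"
proof -
  have "\<exists>K. \<forall>k\<ge>K. R < log_radius (anc k)"
  proof (rule unbounded_of_jumps[OF anc_mono(1)])
    fix k
    obtain k' where k': "k \<le> k'" "vertical k'" "up k'" using vertical_flag[of k True] by blast
    then show "\<exists>k'\<ge>k. log_radius (anc k') + 1 \<le> log_radius (anc (Suc k'))"
      using anc_step(2)[of k'] anc_large[of k'] by (intro exI[of _ k']) simp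
  qed
  moreover have "\<exists>K. \<forall>k\<ge>K. R < top_log k"
  proof (rule unbounded_of_jumps[OF anc_mono(2)])
    fix k
    obtain k' where k': "k \<le> k'" "vertical k'" "up k'" using vertical_flag[of k True] by blast
    then show "\<exists>k'\<ge>k. top_log k' + 1 \<le> top_log (Suc k')"
      using anc_step(2)[of k'] anc_large[of k'] by (intro exI[of _ k']) simp
  qed
  moreover have "\<exists>K. \<forall>k\<ge>K. R < - bot_log k"
  proof (rule unbounded_of_jumps)
    show "- bot_log j \<le> - bot_log k" if "j \<le> k" for j k using anc_mono(3)[OF that] by simp
    fix k
    obtain k' where k': "k \<le> k'" "vertical k'" "\<not> up k'" using vertical_flag[of k False] by blast
    then show "\<exists>k'\<ge>k. - bot_log k' + 1 \<le> - bot_log (Suc k')"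
      using anc_step(3)[of k'] anc_large[of k'] by (intro exI[of _ k']) simp
  qed
  ultimately obtain K1 K2 K3 where "\<And>k. K1 \<le> k \<Longrightarrow> R < log_radius (anc k)"
    "\<And>k. K2 \<le> k \<Longrightarrow> R < top_log k" "\<And>k. K3 \<le> k \<Longrightarrow> R < - bot_log k"
    by blast
  then show ?thesis by (intro exI[of _ "max K1 (max K2 K3)"]) force
qed

section \<open>The levels\<close>

abbreviation "Sf \<equiv> S_fam \<Q> \<delta> lam \<gamma> (r\<^sub>0, Q\<^sub>0, 1)"
abbreviation "St \<equiv> S_tilde \<Q> \<delta> lam \<gamma> (r\<^sub>0, Q\<^sub>0, 1)"
abbreviation "Dneg \<equiv> D_neg \<Q> \<delta> lam \<gamma> (r\<^sub>0, Q\<^sub>0, 1)"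
abbreviation "Dpos \<equiv> D_pos \<Q> \<delta> lam \<gamma> (r\<^sub>0, Q\<^sub>0, 1)"
abbreviation "spow \<equiv> sons_pow \<Q> \<delta> lam \<gamma>"

lemma Sf_eq: "Sf k = siblings \<Q> (anc k)" by (simp add: S_fam_def anc_def)

lemma St_eq: "St k = (if \<not> vertical k then {}
    else if up k then siblings \<Q> (up_difference (anc k)) else siblings \<Q> (down_difference (anc k)))"
  by (simp add: S_tilde_def anc_def up_def vertical_def split: prod.split)

text \<open>The heights that the step from \<open>anc k\<close> to \<open>anc (Suc k)\<close> adds,
  up to a common endpoint.\<close>

definition new_heights :: "nat \<Rightarrow> real set" where
  "new_heights k = (if \<not> vertical k then {}
    else if up k then heights (up_difference (anc k)) else heights (down_difference (anc k)))"

lemma tiles_empty: "tiles {} {}" by (simp add: tiles_def)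

lemma tiles_St: "tiles (new_heights k) (St k)"
  using vertical_steps_adm(3,4)[OF anc_adm anc_large, of k] tiles_siblings tiles_empty
  by (auto simp: St_eq new_heights_def vertical_def)

text \<open>A vertical step moves only one end, so at most one of the two alternatives is ever
  possible. The joint form spares the case distinction between the kinds of step later on.\<close>

lemma new_heights_log:
  assumes "0 < h"
  shows "h \<in> new_heights k \<longleftrightarrow>
    (top_log k < ln h \<and> ln h < top_log (Suc k)) \<or> (bot_log (Suc k) < ln h \<and> ln h < bot_log k)"
proof -
  obtain r j Q a where eq: "anc k = (r, (j, Q), a)" and r: "1 < r" and a: "0 < a"
    using anc_adm by (rule adm_facts)
  consider "\<not> vertical k" | "vertical k" "up k" | "vertical k" "\<not> up k" by blast
  then show ?thesis
  proof cases
    case 1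
    then show ?thesis using anc_step(1)[of k] by (simp add: new_heights_def)
  next
    case 2
    have A: "adm (up_difference (anc k))"
      using vertical_steps_adm(3)[OF anc_adm anc_large] 2 by (simp add: vertical_def)
    show ?thesis
      using heights_log[OF A assms] 2 anc_step(2)[OF 2] r a
      by (auto simp: new_heights_def eq top_log_def bot_log_def ln_mult ln_realpow)
  next
    case 3
    have A: "adm (down_difference (anc k))"
      using vertical_steps_adm(4)[OF anc_adm anc_large] 3 by (simp add: vertical_def)
    show ?thesis
      using heights_log[OF A assms] 3 anc_step(3)[OF 3] r a
      by (auto simp: new_heights_def eq top_log_def bot_log_def ln_div ln_realpow)
  qed
qed

lemma new_heights_pos: "new_heights k \<subseteq> {0<..}"
  using vertical_steps_adm(3,4)[OF anc_adm anc_large, of k] heights_pos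
  by (auto simp: new_heights_def vertical_def simp del: heights.simps split: if_splits)

lemma new_heights_disjoint_anc: "j \<le> k \<Longrightarrow> heights (anc j) \<inter> new_heights k = {}"
proof -
  assume jk: "j \<le> k"
  have "False" if "h \<in> heights (anc j)" "h \<in> new_heights k" for h
    using that new_heights_log[of h k] anc_heights[of h j] new_heights_pos anc_mono(2,3)[OF jk] by fastforce
  then show ?thesis by blast
qed

lemma new_heights_disjoint: "j < k \<Longrightarrow> new_heights j \<inter> new_heights k = {}"
proof -
  assume "j < k"
  have "new_heights j \<subseteq> heights (anc (Suc j))"
  proof
    fix h assume h: "h \<in> new_heights j"
    then have "0 < h" using new_heights_pos by blast
    moreover have "bot_log j < top_log j" using anc_large[of j] by (simp add: top_log_def bot_log_def)
    moreover have "top_log j \<le> top_log (Suc j)" "bot_log (Suc j) \<le> bot_log j" using anc_mono(2,3)[of j "Suc j"] by auto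
    ultimately show "h \<in> heights (anc (Suc j))"
      using h new_heights_log[of h j] anc_heights[of h "Suc j"] by auto
  qed
  then show ?thesis using new_heights_disjoint_anc[of "Suc j" k] \<open>j < k\<close> by auto
qed

text \<open>One index for all strips: 0 for the siblings of \<open>anc k\<close>, and
  \<open>Suc i\<close> for the strip added at step \<open>k + i\<close>, subdivided \<open>i\<close>
  times; \<open>i = 0\<close> accounts for \<open>St k\<close> itself. This is the shape that
  \<open>tiles_UN\<close> takes.\<close>

lemma Dneg_eq: "Dneg k = (\<Union>n. case n of 0 \<Rightarrow> Sf k | Suc i \<Rightarrow> (\<Union>P\<in>St (k + i). spow i P))"
proof -
  have "(\<Union>n. case n of 0 \<Rightarrow> Sf k | Suc i \<Rightarrow> (\<Union>P\<in>St (k + i). spow i P)) =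
      Sf k \<union> (\<Union>i. \<Union>P\<in>St (k + i). spow i P)"
    by (subst UNIV_nat_eq) auto
  also have "(\<Union>i. \<Union>P\<in>St (k + i). spow i P) = St k \<union> (\<Union>i. \<Union>P\<in>St (k + Suc i). spow (Suc i) P)"
    by (subst UNIV_nat_eq) auto
  also have "(\<Union>i. \<Union>P\<in>St (k + Suc i). spow (Suc i) P) = (\<Union>l\<in>{k<..}. \<Union>P\<in>St l. spow (l - k) P)"
  proof -
    have "{k<..} = range (\<lambda>i. k + Suc i)"
    proof (intro equalityI subsetI)
      fix l assume "l \<in> {k<..}"
      then show "l \<in> range (\<lambda>i. k + Suc i)" by (intro image_eqI[of _ _ "l - Suc k"]) auto
    qed auto
    then show ?thesis by simp
  qed
  finally show ?thesis by (simp add: D_neg_def Un_assoc)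
qed

lemma tiles_weaken:
  assumes "tiles B F" "AE x in \<mu>. snd x \<in> B"
  shows "tiles {0<..} F"
proof -
  note T = assms(1)[unfolded tiles_def]
  have "AE x in \<mu>. snd x \<in> {0<..} \<longrightarrow> (\<exists>P\<in>F. x \<in> cyl P)"
    using assms(2) T[THEN conjunct2, THEN conjunct2, THEN conjunct2]
    by eventually_elim blast
  moreover have "\<forall>P\<in>F. adm P \<and> heights P \<subseteq> {0<..}"
    using T[THEN conjunct2, THEN conjunct1] heights_pos by simp
  ultimately show ?thesis
    using T[THEN conjunct1] T[THEN conjunct2, THEN conjunct2, THEN conjunct1]
    unfolding tiles_def by (intro conjI)
qed

lemma tiles_Dneg: "tiles {0<..} (Dneg k)"
proof -
  define B where "B = (\<lambda>n. case n of 0 \<Rightarrow> heights (anc k) | Suc i \<Rightarrow> new_heights (k + i))"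
  have "tiles (\<Union>n. B n) (Dneg k)"
    unfolding Dneg_eq
  proof (rule tiles_UN)
    show "tiles (B n) (case n of 0 \<Rightarrow> Sf k | Suc i \<Rightarrow> (\<Union>P\<in>St (k + i). spow i P))" for n
      using tiles_siblings[OF anc_adm] tiles_sons_pow[OF tiles_St]
      by (cases n) (auto simp: B_def Sf_eq)
    show "B m \<inter> B n = {}" if "m < n" for m n
      using that new_heights_disjoint new_heights_disjoint_anc[of k "k + (n - 1)"]
      by (cases m; cases n) (auto simp: B_def)
  qed
  moreover have "AE x in \<mu>. snd x \<in> (\<Union>n. B n)"
  proof -
    \<comment> \<open>The ends of the height intervals are countably many, so the points at these
      heights form a null set.\<close>
    have "AE x in \<mu>. snd x \<notin> range (\<lambda>j. exp (top_log j)) \<union> range (\<lambda>j. exp (bot_log j))"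
      by (rule AE_height) auto
    then show ?thesis using AE_space
    proof eventually_elim
      case (elim x)
      let ?h = "snd x"
      have h: "0 < ?h" using elim(2) by (simp add: space_\<mu> carrier_iff)
      have ne: "ln ?h \<noteq> top_log j" "ln ?h \<noteq> bot_log j" for j
        using elim(1) h exp_ln[OF h] by (metis UnI1 UnI2 rangeI)+
      obtain K where K: "\<And>j. K \<le> j \<Longrightarrow> \<bar>ln ?h\<bar> < top_log j \<and> bot_log j < - \<bar>ln ?h\<bar>"
        using anc_unbounded[of "\<bar>ln ?h\<bar>"] by blast
      \<comment> \<open>A height in \<open>anc (k + n)\<close> was in \<open>anc k\<close> already
        or came in at a step between them; \<open>ne\<close> rules out that it is one of the
        ends.\<close>
      have "?h \<in> heights (anc (k + n)) \<Longrightarrow> ?h \<in> (\<Union>n. B n)" for n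
      proof (induction n)
        case 0
        then show ?case by (auto simp: B_def simp del: heights.simps intro!: exI[of _ 0])
      next
        case (Suc n)
        show ?case
        proof (cases "?h \<in> heights (anc (k + n))")
          case True
          then show ?thesis by (rule Suc.IH)
        next
          case False
          then have "?h \<in> new_heights (k + n)"
            using Suc.prems anc_heights[OF h] new_heights_log[OF h] ne[of "k + n"] by (auto simp: not_less)
          then show ?thesis by (auto simp: B_def intro!: exI[of _ "Suc n"])
        qed
      qed
      moreover have "?h \<in> heights (anc (k + K))"
      proof -
        have "\<bar>ln ?h\<bar> < top_log (k + K)" "bot_log (k + K) < - \<bar>ln ?h\<bar>" using K[of "k + K"] by auto
        then show ?thesis unfolding anc_heights[OF h] by linarith
      qed
      ultimately show ?case by blast
    qed
  qed
  ultimately show ?thesis by (rule tiles_weaken)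
qed

lemma tiles_Dpos: "tiles {0<..} (Dpos k)"
  by (induction k) (simp_all add: tiles_Dneg tiles_sons)

text \<open>Level 0 is both \<open>Dpos 0\<close> and \<open>Dneg 0\<close>, so the passage to
  parents works across the change of sign.\<close>

definition Lev :: "int \<Rightarrow> 'm cyl set" where
  "Lev n = (if 0 \<le> n then Dpos (nat n) else Dneg (nat (- n)))"

lemma Lev_int: "Lev (int k) = Dpos k" and Lev_neg: "Lev (- int k) = Dneg k"
  by (auto simp: Lev_def)

lemma D_family_eq: "D_family (v, 1) \<Q> \<delta> lam \<gamma> (r\<^sub>0, Q\<^sub>0, 1) = cyl ` (\<Union>n. Lev n)"
proof -
  have "(\<Union>k. Dneg k) \<union> (\<Union>k. Dpos k) \<subseteq> (\<Union>n. Lev n)"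
    using Lev_int Lev_neg by blast
  moreover have "Lev n \<subseteq> (\<Union>k. Dneg k) \<union> (\<Union>k. Dpos k)" for n
    unfolding Lev_def by (cases "0 \<le> n") auto
  then have "(\<Union>n. Lev n) \<subseteq> (\<Union>k. Dneg k) \<union> (\<Union>k. Dpos k)" by (rule UN_least)
  ultimately have "(\<Union>k. Dneg k) \<union> (\<Union>k. Dpos k) = (\<Union>n. Lev n)" by (rule subset_antisym)
  then show ?thesis by (simp only: D_family_def)
qed

lemma tiles_Lev: "tiles {0<..} (Lev n)"
  by (simp add: Lev_def tiles_Dneg tiles_Dpos)

lemma tiles_member: "tiles B F \<Longrightarrow> P \<in> F \<Longrightarrow> adm P \<and> heights P \<subseteq> B"
  by (simp add: tiles_def)

lemma Lev_countable: "countable (Lev n)"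
  and Lev_adm: "P \<in> Lev n \<Longrightarrow> adm P"
  and Lev_disjoint: "P \<in> Lev n \<Longrightarrow> P' \<in> Lev n \<Longrightarrow> x \<in> cyl P \<Longrightarrow> x \<in> cyl P' \<Longrightarrow> P = P'"
  and Lev_cover: "AE x in \<mu>. snd x \<in> {0<..} \<longrightarrow> (\<exists>P\<in>Lev n. x \<in> cyl P)"
proof -
  note T = tiles_Lev[of n, unfolded tiles_def]
  show "countable (Lev n)" by (rule T[THEN conjunct1])
  show "P \<in> Lev n \<Longrightarrow> adm P" using T[THEN conjunct2, THEN conjunct1] by simp
  show "P \<in> Lev n \<Longrightarrow> P' \<in> Lev n \<Longrightarrow> x \<in> cyl P \<Longrightarrow> x \<in> cyl P' \<Longrightarrow> P = P'"
    using T[THEN conjunct2, THEN conjunct2, THEN conjunct1] by blast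
  show "AE x in \<mu>. snd x \<in> {0<..} \<longrightarrow> (\<exists>P\<in>Lev n. x \<in> cyl P)"
    by (rule T[THEN conjunct2, THEN conjunct2, THEN conjunct2])
qed

section \<open>Parents, shrinking and growth along the levels\<close>

lemma cyl_mono:
  assumes "adm P" "adm P'" "cube P \<subseteq> cube P'" "heights P \<subseteq> heights P'"
  shows "cyl P \<subseteq> cyl P'"
  using assms mem_cyl by blast

abbreviation has_parent :: "'m cyl set \<Rightarrow> 'm cyl \<Rightarrow> bool" where
  "has_parent F P \<equiv> \<exists>P'\<in>F. cyl P \<subseteq> cyl P' \<and> emeasure \<mu> (cyl P') \<le> ennreal C\<^sub>1 * emeasure \<mu> (cyl P)"

text \<open>The parent lies over the same cube, with the radius and centre of
  \<open>P\<^sub>2\<close>. This serves the siblings of an ancestor as well as the cylinders newly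
  added by a vertical step.\<close>

lemma siblings_parent:
  assumes A: "adm P\<^sub>1" "adm P\<^sub>2" and q: "fst (snd P\<^sub>1) = fst (snd P\<^sub>2)"
    and h: "heights P\<^sub>1 \<subseteq> heights P\<^sub>2" and r: "log_radius P\<^sub>2 \<le> 3 * log_radius P\<^sub>1"
    and P: "P \<in> siblings \<Q> P\<^sub>1"
  shows "has_parent (siblings \<Q> P\<^sub>2) P"
proof -
  obtain r1 j Q a1 where e1: "P\<^sub>1 = (r1, (j, Q), a1)" using A(1) by (rule adm_facts)
  obtain r2 a2 where e2: "P\<^sub>2 = (r2, (j, Q), a2)" using q unfolding e1 by (metis fst_conv prod.exhaust snd_conv)
  obtain Q' where Q': "P = (r1, (j, Q'), a1)" "Q' \<in> \<Q> j" using P by (auto simp: e1)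
  define P' where "P' = (r2, (j, Q'), a2)"
  have sib: "P' \<in> siblings \<Q> P\<^sub>2" using Q' by (simp add: P'_def e2)
  have adms: "adm P" "adm P'"
    using tiles_member[OF tiles_siblings[OF A(1)] P] tiles_member[OF tiles_siblings[OF A(2)] sib] by simp_all
  have "cyl P \<subseteq> cyl P'"
    by (rule cyl_mono[OF adms]) (use h in \<open>auto simp: Q' P'_def e1 e2\<close>)
  moreover have "emeasure \<mu> (cyl P') \<le> ennreal C\<^sub>1 * emeasure \<mu> (cyl P)"
    by (rule emeasure_cyl_le[OF adms(2,1)]) (use r in \<open>simp_all add: Q' P'_def e1 e2\<close>)
  ultimately show ?thesis using sib by blast
qed

text \<open>The generation drops by 1 for all siblings at once, so each of them goes to the parent
  of its own cube.\<close>

lemma across_siblings_parent: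
  assumes A: "adm P\<^sub>1" "adm (p_across \<Q> P\<^sub>1)" and P: "P \<in> siblings \<Q> P\<^sub>1"
  shows "has_parent (siblings \<Q> (p_across \<Q> P\<^sub>1)) P"
proof -
  obtain r j Q a where e1: "P\<^sub>1 = (r, (j, Q), a)" and r: "1 < r" and a: "0 < a" and Q: "Q \<in> \<Q> j"
    using A(1) by (rule adm_facts)
  obtain Q2 where Q2: "p_N \<Q> (j, Q) = (j - 1, Q2)" using p_N_obtain[OF Q] .
  obtain Q' where Q': "P = (r, (j, Q'), a)" "Q' \<in> \<Q> j" using P by (auto simp: e1)
  obtain Q'' where Q'': "p_N \<Q> (j, Q') = (j - 1, Q'')" "Q'' \<in> \<Q> (j - 1)"
    using p_N_obtain[OF Q'(2)] by metis
  define P' where "P' = (r, p_N \<Q> (j, Q'), a)"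
  have sib: "P' \<in> siblings \<Q> (p_across \<Q> P\<^sub>1)" using Q'' by (simp add: P'_def e1 Q2)
  have adms: "adm P" "adm P'"
    using tiles_member[OF tiles_siblings[OF A(1)] P] tiles_member[OF tiles_siblings[OF A(2)] sib] by simp_all
  then show ?thesis
    using emeasure_cyl_across[of r j Q' a] sib unfolding Q'(1) P'_def by blast
qed

lemma anc_sib_parent: "P \<in> Sf k \<Longrightarrow> has_parent (Sf (Suc k)) P"
  and new_sib_parent: "P \<in> St k \<Longrightarrow> has_parent (Sf (Suc k)) P"
proof -
  note A = anc_adm[of k] anc_adm[of "Suc k"]
  obtain r j Q a where eq: "anc k = (r, (j, Q), a)" and r: "1 < r" and a: "0 < a"
    using anc_adm by (rule adm_facts)
  have h: "heights (anc k) \<subseteq> heights (anc (Suc k))"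
  proof
    fix x assume x: "x \<in> heights (anc k)"
    then have "0 < x" using heights_pos[OF A(1)] by blast
    then show "x \<in> heights (anc (Suc k))"
      using x anc_heights[of x] anc_mono(2,3)[of k "Suc k"] by auto
  qed
  have nh: "new_heights k \<subseteq> heights (anc (Suc k))"
  proof
    fix h assume h: "h \<in> new_heights k"
    then have "0 < h" using new_heights_pos by blast
    moreover have "bot_log k < top_log k" using anc_large[of k] by (simp add: top_log_def bot_log_def)
    moreover have "top_log k \<le> top_log (Suc k)" "bot_log (Suc k) \<le> bot_log k" using anc_mono(2,3)[of k "Suc k"] by auto
    ultimately show "h \<in> heights (anc (Suc k))"
      using h new_heights_log[of h k] anc_heights[of h "Suc k"] by auto
  qed
  have l: "0 < ln r" using r by simp
  show "has_parent (Sf (Suc k)) P" if P: "P \<in> Sf k"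
  proof (cases "vertical k")
    case True
    show ?thesis
      unfolding Sf_eq
    proof (rule siblings_parent[OF A _ h])
      show "fst (snd (anc k)) = fst (snd (anc (Suc k)))" using True eq by (simp add: anc_Suc)
      show "log_radius (anc (Suc k)) \<le> 3 * log_radius (anc k)"
        using True anc_step(2,3)[of k] l eq by (cases "up k") auto
    qed (use P Sf_eq in simp)
  next
    case False
    then have "anc (Suc k) = p_across \<Q> (anc k)" by (simp add: anc_Suc)
    then show ?thesis using across_siblings_parent[OF A(1), of P] A(2) P unfolding Sf_eq by simp
  qed
  show "has_parent (Sf (Suc k)) P" if P: "P \<in> St k"
  proof -
    have V: "vertical k" using P by (auto simp: St_eq split: if_splits)
    note V' = V[unfolded vertical_def]
    show ?thesis
    proof (cases "up k")
      case True
      show ?thesis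
        unfolding Sf_eq
      proof (rule siblings_parent[OF vertical_steps_adm(3)[OF A(1) anc_large V'] A(2)])
        show "fst (snd (up_difference (anc k))) = fst (snd (anc (Suc k)))"
          using V True eq by (simp add: anc_Suc)
        show "heights (up_difference (anc k)) \<subseteq> heights (anc (Suc k))"
          using nh V True by (simp add: new_heights_def)
        show "log_radius (anc (Suc k)) \<le> 3 * log_radius (up_difference (anc k))"
          using V True anc_step(2)[of k] l eq by simp
      qed (use P V True St_eq in simp)
    next
      case False
      show ?thesis
        unfolding Sf_eq
      proof (rule siblings_parent[OF vertical_steps_adm(4)[OF A(1) anc_large V'] A(2)])
        show "fst (snd (down_difference (anc k))) = fst (snd (anc (Suc k)))"
          using V False eq by (simp add: anc_Suc)
        show "heights (down_difference (anc k)) \<subseteq> heights (anc (Suc k))"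
          using nh V False by (simp add: new_heights_def)
        show "log_radius (anc (Suc k)) \<le> 3 * log_radius (down_difference (anc k))"
          using V False anc_step(3)[of k] l r eq by (simp add: ln_realpow)
      qed (use P V False St_eq in simp)
    qed
  qed
qed

text \<open>Cylinders in the strips up to step \<open>k\<close> are absorbed by the siblings of
  \<open>anc (Suc k)\<close>. Those of a strip added at a later step \<open>l\<close> have been
  subdivided \<open>l - k\<close> times, and their parents \<open>l - Suc k\<close> times.\<close>

lemma Dneg_parent:
  assumes P: "P \<in> Dneg k"
  shows "has_parent (Dneg (Suc k)) P"
proof -
  have sub: "Sf (Suc k) \<subseteq> Dneg (Suc k)" by (auto simp: D_neg_def)
  consider "P \<in> Sf k" | "P \<in> St k" | l P0 where "k < l" "P0 \<in> St l" "P \<in> spow (l - k) P0"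
    using P unfolding D_neg_def by blast
  then show ?thesis
  proof cases
    case 1
    then show ?thesis using anc_sib_parent sub by blast
  next
    case 2
    then show ?thesis using new_sib_parent sub by blast
  next
    case 3
    have lk: "l - k = Suc (l - Suc k)" using 3(1) by simp
    obtain P1 where P1: "P1 \<in> spow (l - Suc k) P0" "P \<in> sons \<Q> \<delta> lam \<gamma> P1"
      using 3(3) unfolding lk by auto
    \<comment> \<open>For \<open>l = Suc k\<close> no subdivision is left, and \<open>P1\<close>
      belongs to \<open>St (Suc k)\<close>.\<close>
    have "P1 \<in> Dneg (Suc k)"
    proof (cases "l = Suc k")
      case True
      then show ?thesis using P1(1) 3(2) by (auto simp: D_neg_def)
    next
      case False
      then have "l \<in> {Suc k<..}" using 3(1) by simp
      then show ?thesis using P1(1) 3(2) unfolding D_neg_def by blast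
    qed
    moreover have "adm P1" using calculation Lev_adm[of P1 "- int (Suc k)"] by (simp only: Lev_neg)
    ultimately show ?thesis using son_facts(3,4)[OF _ P1(2)] by blast
  qed
qed

lemma Lev_parent:
  assumes "P \<in> Lev (n + 1)"
  shows "has_parent (Lev n) P"
proof (cases "0 \<le> n")
  case True
  then obtain k where k: "n = int k" using nonneg_int_cases by blast
  then have "P \<in> Dpos (Suc k)" using assms Lev_int[of "Suc k"] by (simp add: add.commute)
  then obtain P1 where P1: "P1 \<in> Dpos k" "P \<in> sons \<Q> \<delta> lam \<gamma> P1" by auto
  then have "adm P1" using Lev_adm[of P1 n] by (simp add: k Lev_int)
  then show ?thesis using son_facts(3,4)[OF _ P1(2)] P1(1) by (auto simp: k Lev_int)
next
  case False
  define k where "k = nat (- n - 1)"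
  have k: "n = - int (Suc k)" "n + 1 = - int k" using False by (auto simp: k_def)
  have "P \<in> Dneg k" using assms unfolding k(2) Lev_neg .
  then show ?thesis unfolding k(1) Lev_neg by (rule Dneg_parent)
qed

lemma Dpos_ancestor:
  "P \<in> Dpos n \<Longrightarrow> \<exists>P0\<in>Dpos 0. cyl P \<subseteq> cyl P0 \<and> cyl_size P \<le> (max \<delta> (1 / 2)) ^ n * cyl_size P0"
proof (induction n arbitrary: P)
  case (Suc n)
  then obtain P1 where P1: "P1 \<in> Dpos n" "P \<in> sons \<Q> \<delta> lam \<gamma> P1" by auto
  then have "adm P1" using Lev_adm[of P1 "int n"] by (simp add: Lev_int)
  note F = son_facts(3,5)[OF this P1(2)]
  obtain P0 where P0: "P0 \<in> Dpos 0" "cyl P1 \<subseteq> cyl P0" "cyl_size P1 \<le> (max \<delta> (1 / 2)) ^ n * cyl_size P0"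
    using Suc.IH[OF P1(1)] by blast
  have "max \<delta> (1 / 2) * cyl_size P1 \<le> max \<delta> (1 / 2) * ((max \<delta> (1 / 2)) ^ n * cyl_size P0)"
    using P0(3) by (rule mult_left_mono) simp
  then have "cyl_size P \<le> (max \<delta> (1 / 2)) ^ Suc n * cyl_size P0" using F(2) by simp
  then show ?case using F(1) P0 by blast
qed auto

text \<open>On the nonnegative levels every cylinder containing \<open>x\<close> descends from the
  one cylinder of level 0 containing \<open>x\<close>. So its \<open>cyl_size\<close> decays
  geometrically from a fixed value, and \<open>cyl_subset_open\<close> applies once it is below
  \<open>w\<close>.\<close>

lemma Lev_shrink:
  assumes x: "x \<in> G_carrier" "\<exists>P\<in>Lev 0. x \<in> cyl P" and U: "open U" "x \<in> U"
  shows "\<exists>n. \<forall>P\<in>Lev n. x \<in> cyl P \<longrightarrow> cyl P \<subseteq> U"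
proof -
  have L0: "Lev 0 = Dpos 0" using Lev_int[of 0] by simp
  obtain w where w: "0 < w" "\<And>P. adm P \<Longrightarrow> x \<in> cyl P \<Longrightarrow> cyl_size P < w \<Longrightarrow> cyl P \<subseteq> U"
    using cyl_subset_open[OF x(1) U] by blast
  obtain P0 where P0: "P0 \<in> Lev 0" "x \<in> cyl P0" using x(2) by blast
  have W0: "0 < cyl_size P0" using P0 Lev_adm cyl_size_pos by blast
  have "max \<delta> (1 / 2) < 1" using \<delta> by simp
  then obtain n where n: "(max \<delta> (1 / 2)) ^ n < w / cyl_size P0"
    using real_arch_pow_inv[of "w / cyl_size P0" "max \<delta> (1 / 2)"] w(1) W0 by auto
  have "cyl P \<subseteq> U" if P: "P \<in> Lev (int n)" "x \<in> cyl P" for P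
  proof (rule w(2))
    show "adm P" using P Lev_adm by blast
    obtain P1 where P1: "P1 \<in> Lev 0" "cyl P \<subseteq> cyl P1" "cyl_size P \<le> (max \<delta> (1 / 2)) ^ n * cyl_size P1"
      using Dpos_ancestor[of P n] P(1) unfolding Lev_int L0 by blast
    have "P1 = P0" using Lev_disjoint[OF P1(1) P0(1)] P1(2) P(2) P0(2) by blast
    then have "cyl_size P \<le> (max \<delta> (1 / 2)) ^ n * cyl_size P0" using P1(3) by simp
    also have "\<dots> < w" using n W0 by (simp add: less_divide_eq)
    finally show "cyl_size P < w" .
  qed (use P in simp)
  then show ?thesis by blast
qed

text \<open>Every other member of level \<open>-k\<close> lives in a strip added at step
  \<open>k\<close> or later, which is disjoint from the heights of \<open>anc k\<close>. This
  identifies a distant ancestor and thereby its radius.\<close>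

lemma Dneg_heights:
  assumes P: "P \<in> Dneg k" and h: "h \<in> heights P" "h \<in> heights (anc k)"
  shows "P \<in> Sf k"
proof (rule ccontr)
  assume "P \<notin> Sf k"
  obtain n where n: "P \<in> (case n of 0 \<Rightarrow> Sf k | Suc i \<Rightarrow> (\<Union>P\<in>St (k + i). spow i P))"
    using P unfolding Dneg_eq by blast
  with \<open>P \<notin> Sf k\<close> obtain i where "n = Suc i" by (cases n) auto
  with n obtain P0 where "P0 \<in> St (k + i)" "P \<in> spow i P0" by auto
  then have "P \<in> (\<Union>P\<in>St (k + i). spow i P)" by blast
  then have "heights P \<subseteq> new_heights (k + i)"
    using tiles_member[OF tiles_sons_pow[OF tiles_St]] by blast
  then show False using h new_heights_disjoint_anc[of k "k + i"] by auto
qed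

lemma cube_mono:
  assumes "adm P" "adm P'" "cyl P \<subseteq> cyl P'"
  shows "cube P \<subseteq> cube P'"
proof
  fix n assume n: "n \<in> cube P"
  obtain h where h: "h \<in> heights P" using cyl_nonempty[OF assms(1)] mem_cyl[OF assms(1)] by blast
  let ?x = "(n + (h - 1) *\<^sub>R v, h)"
  have b: "flow_base v ?x = n" by (simp add: flow_base_def)
  then have "?x \<in> cyl P" using n h mem_cyl[OF assms(1)] by simp
  then have "?x \<in> cyl P'" using assms(3) by blast
  then show "n \<in> cube P'" using b mem_cyl[OF assms(2)] by simp
qed

text \<open>For large \<open>k\<close> the interval of \<open>anc k\<close> contains a given height
  of \<open>P\<close>, so the cylinder of level \<open>-k\<close> around \<open>P\<close> is a
  sibling of \<open>anc k\<close>. Its logarithmic radius is unbounded in \<open>k\<close>, while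
  its cube contains that of \<open>P\<close>.\<close>

lemma Lev_growth:
  assumes P: "P \<in> Lev n"
  shows "\<exists>m\<le>n. \<forall>P'\<in>Lev m. cyl P \<subseteq> cyl P' \<longrightarrow> ennreal R < emeasure \<mu> (cyl P')"
proof -
  have A: "adm P" using Lev_adm[OF P] .
  define p where "p = measure (mu_N \<phi>) (cube P)"
  have pe: "emeasure (mu_N \<phi>) (cube P) = ennreal p" and p: "0 < p"
  proof -
    have "0 < emeasure (mu_N \<phi>) (cube P)" "emeasure (mu_N \<phi>) (cube P) < \<infinity>"
      using A by (auto elim!: adm_facts simp: \<Q>_measure simp del: infinity_ennreal_def)
    moreover show "emeasure (mu_N \<phi>) (cube P) = ennreal p"
      unfolding p_def using calculation(2) by (intro emeasure_eq_ennreal_measure) simp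
    ultimately show "0 < p" by simp
  qed
  obtain x where x: "x \<in> cyl P" using cyl_nonempty[OF A] by blast
  then have hx: "0 < snd x" using mem_cyl[OF A] heights_pos[OF A] by auto
  \<comment> \<open>\<open>\<bar>R / p\<bar>\<close> makes the radius large enough for the measure,
    \<open>\<bar>ln (snd x)\<bar>\<close> puts the height of \<open>x\<close> inside
    \<open>anc k\<close>.\<close>
  obtain K where K: "\<And>k. K \<le> k \<Longrightarrow> max \<bar>R / p\<bar> \<bar>ln (snd x)\<bar> < log_radius (anc k) \<and>
      max \<bar>R / p\<bar> \<bar>ln (snd x)\<bar> < top_log k \<and> bot_log k < - max \<bar>R / p\<bar> \<bar>ln (snd x)\<bar>"
    using anc_unbounded by blast
  define k where "k = max K (nat (- n))"
  have k: "\<bar>R / p\<bar> < log_radius (anc k)" "\<bar>ln (snd x)\<bar> < top_log k" "bot_log k < - \<bar>ln (snd x)\<bar>"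
  proof -
    have "K \<le> k" by (simp add: k_def)
    from K[OF this] show "\<bar>R / p\<bar> < log_radius (anc k)" "\<bar>ln (snd x)\<bar> < top_log k"
      "bot_log k < - \<bar>ln (snd x)\<bar>"
      by linarith+
  qed
  have hk: "snd x \<in> heights (anc k)" unfolding anc_heights[OF hx] using k by linarith
  have "ennreal R < emeasure \<mu> (cyl P')" if P': "P' \<in> Lev (- int k)" "cyl P \<subseteq> cyl P'" for P'
  proof -
    have A': "adm P'" using Lev_adm[OF P'(1)] .
    have "snd x \<in> heights P'" using x P'(2) mem_cyl[OF A'] by blast
    then have "P' \<in> Sf k" using P'(1) hk Dneg_heights unfolding Lev_neg by blast
    then have lr: "log_radius P' = log_radius (anc k)"
      using anc_adm[of k] unfolding Sf_eq by (auto elim!: adm_facts)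
    have "R < p * (2 * log_radius (anc k))"
    proof -
      have "R / p < 2 * log_radius (anc k)" using k(1) by linarith
      then show ?thesis using p by (simp add: divide_less_eq mult_ac)
    qed
    moreover have "0 < p * (2 * log_radius (anc k))" using p anc_large[of k] by simp
    ultimately have "ennreal R < ennreal (p * (2 * log_radius (anc k)))"
      \<comment> \<open>For negative \<open>R\<close>, \<open>ennreal R\<close> is 0.\<close>
      by (cases "0 \<le> R") (auto simp: ennreal_less_iff ennreal_neg)
    also have "\<dots> = emeasure (mu_N \<phi>) (cube P) * ennreal (2 * log_radius P')"
      unfolding pe lr using p by (intro ennreal_mult) (use anc_large[of k] in auto)
    also have "\<dots> \<le> emeasure (mu_N \<phi>) (cube P') * ennreal (2 * log_radius P')"
    proof (rule mult_right_mono[OF emeasure_mono[OF cube_mono[OF A A' P'(2)]]])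
      show "cube P' \<in> sets (mu_N \<phi>)" using A' by (auto elim!: adm_facts simp: borel_\<Q>)
    qed simp
    also have "\<dots> = emeasure \<mu> (cyl P')" by (rule emeasure_cyl[OF A', symmetric])
    finally show ?thesis .
  qed
  then show ?thesis by (intro exI[of _ "- int k"]) (auto simp: k_def)
qed

section \<open>The cylinders as a dyadic system of levels\<close>

definition good :: "'m point set" where
  "good = {x \<in> G_carrier. \<forall>n. \<exists>P\<in>Lev n. x \<in> cyl P}"

text \<open>Bounded base and heights away from 0 and infinity make these tiles open and of finite
  measure, as outer regularity requires.\<close>

definition exhaust :: "nat \<Rightarrow> 'm point set" where
  "exhaust k = flow_tile v (ball 0 (real k + 1)) {1 / (real k + 2) <..< real k + 2}"

lemma open_exhaust: "open (exhaust k)"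
  unfolding exhaust_def by (rule open_flow_tile) auto

lemma exhaust_subset: "exhaust k \<subseteq> G_carrier"
proof
  fix x assume "x \<in> exhaust k"
  then have "1 / (real k + 2) < snd x" by (simp add: exhaust_def flow_tile_def)
  moreover have "0 < 1 / (real k + 2)" by simp
  ultimately have "0 < snd x" by linarith
  then show "x \<in> G_carrier" by (simp add: carrier_iff)
qed

lemma exhaust_finite: "emeasure \<mu> (exhaust k) < \<infinity>"
proof -
  have "1 / (real k + 2) \<le> real k + 2" by (simp add: divide_le_eq mult_le_cancel_left1)
    (simp add: algebra_simps)
  then have "emeasure \<mu> (exhaust k) =
      emeasure (mu_N \<phi>) (ball 0 (real k + 1)) * ennreal (ln (real k + 2) - ln (1 / (real k + 2)))"
    unfolding exhaust_def by (intro emeasure_flow_tile_Ioo) auto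
  then show ?thesis using ball_finite[of 0 "real k + 1"] by (simp add: ennreal_mult_less_top)
qed

lemma exhaust_cover: "G_carrier \<subseteq> (\<Union>k. exhaust k)"
proof
  fix x :: "'m point" assume "x \<in> G_carrier"
  then have x: "0 < snd x" by (simp add: carrier_iff)
  obtain k where k: "max (norm (flow_base v x)) (max (snd x) (1 / snd x)) < real k"
    using reals_Archimedean2 by blast
  then have "1 / snd x < real k + 2" by simp
  then have "1 / (real k + 2) < snd x" using x by (simp add: field_simps)
  then have "x \<in> exhaust k" using k by (simp add: exhaust_def flow_tile_def)
  then show "x \<in> (\<Union>k. exhaust k)" by blast
qed

lemma dyadic_levels: "dyadic_levels \<mu> Lev cyl C\<^sub>1 good exhaust"
proof
  show "countable (Lev n)" for n by (rule Lev_countable)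
  show "cyl P \<in> sets \<mu>" "0 < emeasure \<mu> (cyl P)" "emeasure \<mu> (cyl P) < \<infinity>" if "P \<in> Lev n" for P n
    using Lev_adm[OF that] cyl_sets emeasure_cyl_pos emeasure_cyl_finite by blast+
  show "P = P'" if "P \<in> Lev n" "P' \<in> Lev n" "x \<in> cyl P" "x \<in> cyl P'" for P P' n x
    using that by (rule Lev_disjoint)
  have "AE x in \<mu>. \<forall>n. snd x \<in> {0<..} \<longrightarrow> (\<exists>P\<in>Lev n. x \<in> cyl P)"
    using Lev_cover by (simp only: AE_all_countable simp_thms)
  then show "AE x in \<mu>. x \<in> good"
    using AE_space by eventually_elim (simp add: good_def space_\<mu> carrier_iff)
  show "\<exists>P\<in>Lev n. x \<in> cyl P" if "x \<in> good" for x n using that by (simp add: good_def)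
  show "has_parent (Lev n) P" if "P \<in> Lev (n + 1)" for P n using that by (rule Lev_parent)
  show "\<exists>m\<le>n. \<forall>P'\<in>Lev m. cyl P \<subseteq> cyl P' \<longrightarrow> ennreal R < emeasure \<mu> (cyl P')" if "P \<in> Lev n" for P n R
    using that by (rule Lev_growth)
  show "\<exists>n. \<forall>P\<in>Lev n. x \<in> cyl P \<longrightarrow> cyl P \<subseteq> U" if "x \<in> good" "open U" "x \<in> U" for x U
    using that by (intro Lev_shrink) (auto simp: good_def)
  show "1 \<le> C\<^sub>1" using C1_ge by simp
  show sV: "exhaust k \<in> sets \<mu>" for k using open_exhaust exhaust_subset by (simp add: sets_\<mu>)
  show "emeasure \<mu> (exhaust k) < \<infinity>" for k by (rule exhaust_finite)
  show "space \<mu> \<subseteq> (\<Union>k. exhaust k)" using exhaust_cover by (simp add: space_\<mu>)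
  show "\<exists>U. open U \<and> U \<in> sets \<mu> \<and> A \<subseteq> U \<and> emeasure \<mu> U \<le> emeasure \<mu> A + ennreal e"
    if A: "A \<in> sets \<mu>" "A \<subseteq> exhaust k" and e: "0 < e" for A k e
  proof -
    obtain U where "open U" "A \<subseteq> U" "U \<subseteq> exhaust k" "emeasure \<mu> U \<le> emeasure \<mu> A + ennreal e"
      using outer_regular_\<mu>[OF A open_exhaust exhaust_subset exhaust_finite, of "ennreal e"] e by auto
    moreover from this have "U \<in> sets \<mu>" using exhaust_subset by (auto simp: sets_\<mu>)
    ultimately show ?thesis by blast
  qed
qed

theorem has_CZP_wrt_cylinders:
  "has_CZP_wrt G_carrier d_G \<mu> (D_family (v, 1) \<Q> \<delta> lam \<gamma> (r\<^sub>0, Q\<^sub>0, 1))"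
proof -
  interpret levels: dyadic_levels \<mu> Lev cyl C\<^sub>1 good exhaust by (rule dyadic_levels)
  obtain D1 where D1: "0 \<le> D1" "\<And>P. adm P \<Longrightarrow>
      emeasure \<mu> (neighbourhood G_carrier d_G (cyl P) (log_radius P / 2)) \<le> ennreal D1 * emeasure \<mu> (cyl P)"
    by (rule neighbourhood_cyl) (rule that)
  obtain D2 where D2: "1 \<le> D2" "\<And>P. adm P \<Longrightarrow>
      \<exists>x\<in>G_carrier. cyl P \<subseteq> {y \<in> G_carrier. d_G x y < D2 * (log_radius P / 2)}"
    by (rule cyl_subset_ball) (rule that)
  let ?ball = "\<lambda>P x. {y \<in> G_carrier. d_G x y < D2 * (log_radius P / 2)}"
  define ctr where "ctr = (\<lambda>P. SOME x. x \<in> G_carrier \<and> cyl P \<subseteq> ?ball P x)"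
  have ctr: "ctr P \<in> G_carrier \<and> cyl P \<subseteq> ?ball P (ctr P)" if "adm P" for P
    unfolding ctr_def using D2(2)[OF that] unfolding Bex_def by (rule someI_ex)
  have "has_CZP_wrt (space \<mu>) d_G \<mu> (cyl ` (\<Union>n. Lev n))"
  \<comment> \<open>The radius attached to \<open>P\<close> is \<open>log_radius P / 2\<close>, and
    \<open>D1 + D2\<close> is a common constant for balls and neighbourhoods; both are fixed by
    unification below.\<close>
  proof (rule levels.has_CZP_wrt_levels)
    fix n P assume "P \<in> Lev n"
    then have A: "adm P" by (rule Lev_adm)
    have l: "0 < log_radius P / 2" using log_radius_pos[OF A] by simp
    have "D2 * (log_radius P / 2) \<le> (D1 + D2) * (log_radius P / 2)"
      using D1(1) l by (intro mult_right_mono) auto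
    then have "{y \<in> G_carrier. d_G (ctr P) y < D2 * (log_radius P / 2)} \<subseteq>
        {y \<in> G_carrier. d_G (ctr P) y < (D1 + D2) * (log_radius P / 2)}"
      by (auto intro: less_le_trans)
    moreover have PG: "cyl P \<subseteq> G_carrier" using cyl_sets[OF A] by (simp add: sets_\<mu>)
    moreover have "neighbourhood G_carrier d_G (cyl P) (log_radius P / 2) \<in> sets \<mu>"
      unfolding sets_\<mu>
    proof
      show "neighbourhood G_carrier d_G (cyl P) (log_radius P / 2) \<subseteq> G_carrier"
        by (auto simp: neighbourhood_def)
      show "neighbourhood G_carrier d_G (cyl P) (log_radius P / 2) \<in> sets borel"
        by (rule borel_open[OF open_neighbourhood[OF PG]])
    qed
    moreover have "ennreal D1 * emeasure \<mu> (cyl P) \<le> ennreal (D1 + D2) * emeasure \<mu> (cyl P)"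
      using D2(1) by (intro mult_right_mono ennreal_leI) auto
    moreover note D1(2)[OF A]
    ultimately show "0 < log_radius P / 2 \<and> ctr P \<in> space \<mu> \<and>
        cyl P \<subseteq> {y \<in> space \<mu>. d_G (ctr P) y < (D1 + D2) * (log_radius P / 2)} \<and>
        neighbourhood (space \<mu>) d_G (cyl P) (log_radius P / 2) \<in> sets \<mu> \<and>
        emeasure \<mu> (neighbourhood (space \<mu>) d_G (cyl P) (log_radius P / 2)) \<le> ennreal (D1 + D2) * emeasure \<mu> (cyl P)"
      using l ctr[OF A] unfolding space_\<mu> by (intro conjI) (blast | rule order_trans, assumption+)+
  next
    show "1 \<le> D1 + D2" using D1 D2 by simp
    \<comment> \<open>Doubling includes positivity on balls, so \<open>N\<close> is not null and
      \<open>infinite_\<mu>\<close> applies.\<close>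
    have "0 < emeasure (mu_N \<phi>) (ball 0 1)" by (rule ball_positive) simp
    also have "\<dots> \<le> emeasure (mu_N \<phi>) UNIV" by (rule emeasure_mono) auto
    finally show "emeasure \<mu> (space \<mu>) = \<infinity>" unfolding space_\<mu> by (intro infinite_\<mu>) simp
  qed
  then show ?thesis unfolding space_\<mu> D_family_eq .
qed

end

theorem theorem6p2:
  fixes Z :: "'m::finite lie"
    and \<mu> :: "'m point measure"
    and \<phi> :: "'m point \<Rightarrow> real"
    and \<Q> :: "int \<Rightarrow> (real^'m) set set"
    and \<delta> C\<^sub>1 c \<gamma> lam r\<^sub>0 :: real
    and Q\<^sub>0 :: "'m cube"
  assumes "Z \<in> calZ"
    and "\<mu> \<in> flow_measures Z"
    and "flow_density Z \<mu> \<phi>"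
    and "christ_decomposition (mu_N \<phi>) \<Q> \<delta> C\<^sub>1 c"
    and "C\<^sub>1 \<ge> 3"
    and "\<forall>q\<in>cubes \<Q>. card (s_N \<Q> q) \<ge> 2"
    and "\<gamma> \<ge> 5"
    and "lam > exp 3 / \<delta>"
    and "large_admissible \<Q> \<delta> lam \<gamma> (r\<^sub>0, Q\<^sub>0, 1)"
  shows "has_CZP_wrt G_carrier d_G \<mu> (D_family Z \<Q> \<delta> lam \<gamma> (r\<^sub>0, Q\<^sub>0, 1))"
proof -
  \<comment> \<open>The coefficient of \<open>X0\<close> is the inner product with
    \<open>X0\<close>.\<close>
  have "Z = (fst Z, 1)"
    using assms(1) by (simp add: calZ_def X0_def inner_prod_def prod_eq_iff)
  then obtain v where Z: "Z = (v, 1)" by blast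
  \<comment> \<open>\<open>flow_measures\<close> asks for doubling with every density of
    \<open>\<mu>\<close>, hence with the given one.\<close>
  have "doubling (mu_N \<phi>)" using assms(2,3) by (simp add: flow_measures_def)
  then interpret dyadic_cylinders v \<mu> \<phi> \<Q> \<delta> C\<^sub>1 c \<gamma> lam r\<^sub>0 Q\<^sub>0
    using assms by unfold_locales (simp_all add: Z)
  show ?thesis unfolding Z by (rule has_CZP_wrt_cylinders)
qed


end
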